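(* Assume that $\mathbb{H}_*$ is closed under the action of $D_*$ (for example, that $D$ has a kernel $\mathcal{D}:\Lambda^3\to\mathbb{R}$, $D_\lambda(v,w)=\int_{\Lambda^2}\mathcal{D}(\lambda,\nu,\sigma)v_\nu w_\sigma\,d\mu_\nu\,d\mu_\sigma$, such that either the bilinear map $|D|$ with kernel $|\mathcal{D}|$ is bounded from $\mathbb{H}\times\mathbb{H}$ to $\mathbb{H}$, or $\int_{\Lambda^3}|\mathcal{D}|^2\,d\mu_\lambda\,d\mu_\nu\,d\mu_\sigma<\infty$). Then for every integer $r\ge1$ there exists a $C^r$ local stable manifold $\mathcal{M}_{\mathrm{s}}\subset\mathbb{H}$ near $0$ for the equation $\Gamma u'+u=D(u,u)$, expressible as the graph of a $C^r$ function $\mathcal{J}_{\mathrm{s}}$ from a neighborhood of $0$ in $\mathbb{H}_{\mathrm{s}}$ to $\mathbb{H}_{\mathrm{u}}$, that is locally invariant under the flow of $\Gamma u'+u=D(u,u)$ and is uniquely determined by the property that $u\in\mathbb{H}_*$. Precisely: there exist $\varepsilon_1,\varepsilon_2>0$ such that, with $B=\{h\in\mathbb{H}_{\mathrm{s}}:\|h\|<\varepsilon_1\}$, for every $h\in B$ there is exactly one solution $u=\mathbf{u}(\cdot,h)$ of the equation on $\mathbb{R}_+$ with $u\in\mathbb{H}_*$, $\|u\|_{\mathbb{H}_*}\le\varepsilon_2$ and $\Pi_{\mathrm{s}}u(0)=h$; the set $\mathcal{M}_{\mathrm{s}}=\{\mathbf{u}(0,h):h\in B\}$ equals the graph $\{h+\mathcal{J}_{\mathrm{s}}(h):h\in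 B\}$ of a $C^r$ function $\mathcal{J}_{\mathrm{s}}:B\to\mathbb{H}_{\mathrm{u}}$; and if $h\in B$ and $x_0\ge0$ are such that $\Pi_{\mathrm{s}}\mathbf{u}(x_0,h)\in B$, then $\mathbf{u}(x_0,h)\in\mathcal{M}_{\mathrm{s}}$.
   Context: $\mathbb{H}$ is a real Hilbert space, $\Gamma$ is a bounded linear operator on $\mathbb{H}$ that is self-adjoint, one-to-one, but not (boundedly) invertible, and $D:\mathbb{H}\times\mathbb{H}\to\mathbb{H}$ is a bounded bilinear map. By spectral decomposition of $\Gamma$, each $u\in\mathbb{H}$ is identified with its spectral coordinates $(u_\lambda)_{\lambda\in\Lambda}\in L^2(\Lambda,d\mu_\lambda)$, with $\mu$ the spectral measure and $\|u\|_{\mathbb{H}}^2=\int_\Lambda|u_\lambda|^2\,d\mu_\lambda$; in these coordinates $\Gamma$ is multiplication by a real bounded function $(\gamma_\lambda)_{\lambda\in\Lambda}$. $D_\lambda(u,v)$ denotes the $\lambda$-coordinate of $D(u,v)$. The reverse norm of a function $u$ on $\mathbb{R}_+=[0,\infty)$ with values in $\mathbb{H}$ is $$\|u\|_{\mathbb{H}_*}=\Big(\int_\Lambda\big(\sup_{x\ge0}|u_\lambda(x)|\big)^2\,d\mu_\lambda\Big)^{1/2},$$ and $\mathbb{H}_*$ is the space of functions on $\mathbb{R}_+$ with finite $\|\cdot\|_{\mathbb{H}_*}$ norm. $D_*$ is the pointwise extension of $D$ to functions: $D_*(u,v)(x)=D(u(x),v(x))$. The space $\mathbb{H}_*$ is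 said to be closed under the action of $D_*$ if $D_*(v,v)\in\mathbb{H}_*$ for every $v\in\mathbb{H}_*$ and there is a constant $C$ with $\|D_*(v,v)\|_{\mathbb{H}_*}\le C\|v\|_{\mathbb{H}_*}^2$ for all $v\in\mathbb{H}_*$. Let $\Lambda_\pm=\{\lambda\in\Lambda:\pm\gamma_\lambda>0\}$. The stable and unstable subspaces of $u'=-\Gamma^{-1}u$ are $\mathbb{H}_{\mathrm{s}}=\{h\in\mathbb{H}:h_\lambda=0\text{ for a.e. }\lambda\notin\Lambda_+\}$ and $\mathbb{H}_{\mathrm{u}}=\{h\in\mathbb{H}:h_\lambda=0\text{ for a.e. }\lambda\notin\Lambda_-\}$, with orthogonal projections $\Pi_{\mathrm{s}},\Pi_{\mathrm{u}}$; the stable semigroup is $(T_{\mathrm{s}}(x)h)_\lambda=e^{-x/\gamma_\lambda}h_\lambda$ for $x\ge0$, $h\in\mathbb{H}_{\mathrm{s}}$. Solutions of $\Gamma u'+u=D(u,u)$ on $\mathbb{R}_+$ are understood in the mild sense: $$u=T_{\mathrm{s}}(\cdot)\Pi_{\mathrm{s}}u(0)+\chi_+K\big(\chi_+D_*(u,u)\big),$$ where $\chi_+$ is the characteristic function of $\mathbb{R}_+$ and $K=(\Gamma\partial_x+\mathrm{Id})^{-1}$ acts coordinatewise by $(Kf)_\lambda(x)=\int_{\mathbb{R}}\mathcal{K}(x-y,\lambda)f_\lambda(y)\,dy$, with $\mathcal{K}(x,\lambda)=\gamma_\lambda^{-1}e^{-x/\gamma_\lambda}$ if $x>0,\ \lambda\in\Lambda_+$;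 $\mathcal{K}(x,\lambda)=-\gamma_\lambda^{-1}e^{-x/\gamma_\lambda}$ if $x<0,\ \lambda\in\Lambda_-$; and $\mathcal{K}(x,\lambda)=0$ otherwise. *)

theory Defs
  imports "HOL-Analysis.Analysis"
begin

subsection \<open>Spectral coordinates\<close>

text \<open>
  \<open>co u \<lambda>\<close> is the coordinate \<open>u\<^sub>\<lambda>\<close>, so that \<open>u \<mapsto> co u\<close> (modulo null sets) is a surjective
  linear isometry of the Hilbert space onto the real \<open>L\<^sup>2\<close> space of \<open>M\<close>, turning \<open>\<Gamma>\<close> into
  multiplication by \<open>\<gamma>\<close>. Each \<open>co u\<close> is one chosen representative of its class, which is why
  linearity holds only almost everywhere. The spectral measure is not required to be sigma-finite,
  so non-separable Hilbert spaces are covered.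
\<close>

definition spectral_representation ::
  "'l measure \<Rightarrow> ('h::real_inner \<Rightarrow> 'l \<Rightarrow> real) \<Rightarrow> ('l \<Rightarrow> real) \<Rightarrow> ('h \<Rightarrow> 'h) \<Rightarrow> bool" where
  "spectral_representation M co \<gamma> \<Gamma> \<longleftrightarrow>
     \<gamma> \<in> borel_measurable M \<and> (\<exists>C. \<forall>l\<in>space M. \<bar>\<gamma> l\<bar> \<le> C) \<and>
     (\<forall>u. co u \<in> borel_measurable M \<and> integrable M (\<lambda>l. (co u l)\<^sup>2) \<and>
          (norm u)\<^sup>2 = (\<integral>l. (co u l)\<^sup>2 \<partial>M)) \<and>
     (\<forall>u v. AE l in M. co (u + v) l = co u l + co v l) \<and>
     (\<forall>c u. AE l in M. co (c *\<^sub>R u) l = c * co u l) \<and>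
     (\<forall>f \<in> borel_measurable M. integrable M (\<lambda>l. (f l)\<^sup>2) \<longrightarrow> (\<exists>u. AE l in M. co u l = f l)) \<and>
     (\<forall>u. AE l in M. co (\<Gamma> u) l = \<gamma> l * co u l)"

definition of_coords :: "'l measure \<Rightarrow> ('h \<Rightarrow> 'l \<Rightarrow> real) \<Rightarrow> ('l \<Rightarrow> real) \<Rightarrow> 'h" where
  "of_coords M co f = (THE h. AE l in M. co h l = f l)"


subsection \<open>The reverse norm\<close>

text \<open>
  Functions on \<open>[0,\<infinity>)\<close> with values in the Hilbert space are represented by functions on the reals
  of which only the values on \<open>{0..}\<close> are used. For each \<open>x\<close> the coordinates of \<open>u x\<close> are
  determined only up to a null set depending on \<open>x\<close>, so the supremum over \<open>x\<close> inside the reverse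
  norm is meaningful only for a choice of coordinate functions \<open>U x \<lambda>\<close> that is jointly measurable
  and has a measurable supremum. The reverse norm is the least value of the defining expression
  over all such choices; the space consists of the functions for which it is finite. (A function
  without any admissible choice has infinite reverse norm, the infimum of the empty set.)
\<close>

definition coord_versions ::
  "'l measure \<Rightarrow> ('h \<Rightarrow> 'l \<Rightarrow> real) \<Rightarrow> (real \<Rightarrow> 'h) \<Rightarrow> (real \<Rightarrow> 'l \<Rightarrow> real) set" where
  "coord_versions M co u =
     {U. (\<lambda>(x, l). U x l) \<in> borel_measurable (restrict_space borel {0..} \<Otimes>\<^sub>M M) \<and>
         (\<lambda>l. SUP x\<in>{0..}. ennreal \<bar>U x l\<bar>) \<in> borel_measurable M \<and>
         (\<forall>x\<ge>0. AE l in M. U x l = co (u x) l)}"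

definition sup_square_integral :: "'l measure \<Rightarrow> (real \<Rightarrow> 'l \<Rightarrow> real) \<Rightarrow> ennreal" where
  "sup_square_integral M U = (\<integral>\<^sup>+ l. (SUP x\<in>{0..}. ennreal \<bar>U x l\<bar>)\<^sup>2 \<partial>M)"

definition reverse_norm_sq ::
  "'l measure \<Rightarrow> ('h \<Rightarrow> 'l \<Rightarrow> real) \<Rightarrow> (real \<Rightarrow> 'h) \<Rightarrow> ennreal" where
  "reverse_norm_sq M co u = (INF U \<in> coord_versions M co u. sup_square_integral M U)"

definition reverse_space ::
  "'l measure \<Rightarrow> ('h \<Rightarrow> 'l \<Rightarrow> real) \<Rightarrow> (real \<Rightarrow> 'h) set" where
  "reverse_space M co = {u. reverse_norm_sq M co u < \<infinity>}"

definition reverse_norm ::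
  "'l measure \<Rightarrow> ('h \<Rightarrow> 'l \<Rightarrow> real) \<Rightarrow> (real \<Rightarrow> 'h) \<Rightarrow> real" where
  "reverse_norm M co u = sqrt (enn2real (reverse_norm_sq M co u))"


subsection \<open>The pointwise bilinear map\<close>

definition D_star :: "('h \<Rightarrow> 'h \<Rightarrow> 'h) \<Rightarrow> (real \<Rightarrow> 'h) \<Rightarrow> (real \<Rightarrow> 'h) \<Rightarrow> real \<Rightarrow> 'h" where
  "D_star D u v = (\<lambda>x. D (u x) (v x))"

definition closed_under_D_star ::
  "'l measure \<Rightarrow> ('h \<Rightarrow> 'l \<Rightarrow> real) \<Rightarrow> ('h \<Rightarrow> 'h \<Rightarrow> 'h) \<Rightarrow> bool" where
  "closed_under_D_star M co D \<longleftrightarrow>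
     (\<forall>v \<in> reverse_space M co. D_star D v v \<in> reverse_space M co) \<and>
     (\<exists>C. \<forall>v \<in> reverse_space M co.
        reverse_norm M co (D_star D v v) \<le> C * (reverse_norm M co v)\<^sup>2)"

text \<open>
  The integrals over \<open>\<Lambda>\<^sup>2\<close> and \<open>\<Lambda>\<^sup>3\<close> below are written as iterated integrals, since \<open>M\<close> need not be
  sigma-finite; absolute convergence is required explicitly.
\<close>

definition has_kernel ::
  "'l measure \<Rightarrow> ('h \<Rightarrow> 'l \<Rightarrow> real) \<Rightarrow> ('h \<Rightarrow> 'h \<Rightarrow> 'h) \<Rightarrow> ('l \<Rightarrow> 'l \<Rightarrow> 'l \<Rightarrow> real) \<Rightarrow> bool" where
  "has_kernel M co D \<kappa> \<longleftrightarrow>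
     (\<lambda>(l, n, s). \<kappa> l n s) \<in> borel_measurable (M \<Otimes>\<^sub>M (M \<Otimes>\<^sub>M M)) \<and>
     (\<forall>v w. AE l in M.
        (\<integral>\<^sup>+ n. (\<integral>\<^sup>+ s. ennreal \<bar>\<kappa> l n s * co v n * co w s\<bar> \<partial>M) \<partial>M) < \<infinity> \<and>
        co (D v w) l = (\<integral>n. (\<integral>s. \<kappa> l n s * co v n * co w s \<partial>M) \<partial>M))"

definition abs_kernel_bounded ::
  "'l measure \<Rightarrow> ('h::real_normed_vector \<Rightarrow> 'l \<Rightarrow> real) \<Rightarrow> ('l \<Rightarrow> 'l \<Rightarrow> 'l \<Rightarrow> real) \<Rightarrow> bool" where
  "abs_kernel_bounded M co \<kappa> \<longleftrightarrow>
     (\<exists>D'. bounded_bilinear D' \<and> has_kernel M co D' (\<lambda>l n s. \<bar>\<kappa> l n s\<bar>))"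

definition kernel_square_integrable ::
  "'l measure \<Rightarrow> ('l \<Rightarrow> 'l \<Rightarrow> 'l \<Rightarrow> real) \<Rightarrow> bool" where
  "kernel_square_integrable M \<kappa> \<longleftrightarrow>
     (\<integral>\<^sup>+ l. (\<integral>\<^sup>+ n. (\<integral>\<^sup>+ s. ennreal (\<bar>\<kappa> l n s\<bar>\<^sup>2) \<partial>M) \<partial>M) \<partial>M) < \<infinity>"


subsection \<open>Stable and unstable subspaces, mild solutions\<close>

definition stable_subspace ::
  "'l measure \<Rightarrow> ('h \<Rightarrow> 'l \<Rightarrow> real) \<Rightarrow> ('l \<Rightarrow> real) \<Rightarrow> 'h set" where
  "stable_subspace M co \<gamma> = {h. AE l in M. \<not> \<gamma> l > 0 \<longrightarrow> co h l = 0}"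

definition unstable_subspace ::
  "'l measure \<Rightarrow> ('h \<Rightarrow> 'l \<Rightarrow> real) \<Rightarrow> ('l \<Rightarrow> real) \<Rightarrow> 'h set" where
  "unstable_subspace M co \<gamma> = {h. AE l in M. \<not> \<gamma> l < 0 \<longrightarrow> co h l = 0}"

definition orth_proj :: "'h::real_inner set \<Rightarrow> 'h \<Rightarrow> 'h" where
  "orth_proj V h = (THE p. p \<in> V \<and> (\<forall>v\<in>V. inner (h - p) v = 0))"

abbreviation stable_proj ::
  "'l measure \<Rightarrow> ('h::real_inner \<Rightarrow> 'l \<Rightarrow> real) \<Rightarrow> ('l \<Rightarrow> real) \<Rightarrow> 'h \<Rightarrow> 'h" where
  "stable_proj M co \<gamma> \<equiv> orth_proj (stable_subspace M co \<gamma>)"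

definition stable_semigroup ::
  "'l measure \<Rightarrow> ('h \<Rightarrow> 'l \<Rightarrow> real) \<Rightarrow> ('l \<Rightarrow> real) \<Rightarrow> real \<Rightarrow> 'h \<Rightarrow> 'h" where
  "stable_semigroup M co \<gamma> x h = of_coords M co (\<lambda>l. exp (- x / \<gamma> l) * co h l)"

definition resolvent_kernel :: "('l \<Rightarrow> real) \<Rightarrow> real \<Rightarrow> 'l \<Rightarrow> real" where
  "resolvent_kernel \<gamma> x l =
     (if x > 0 \<and> \<gamma> l > 0 then exp (- x / \<gamma> l) / \<gamma> l
      else if x < 0 \<and> \<gamma> l < 0 then - (exp (- x / \<gamma> l) / \<gamma> l)
      else 0)"

text \<open>
  The value at \<open>x\<close> of \<open>K (\<chi>\<^sub>+ f)\<close> for \<open>f\<close> of finite reverse norm. The coordinate functions of \<open>f\<close>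
  entering the integral are a version with finite reverse integral; two such versions agree, for
  almost every \<open>l\<close>, at almost every \<open>y\<close>, so the result does not depend on the choice.
\<close>

definition coord_version ::
  "'l measure \<Rightarrow> ('h \<Rightarrow> 'l \<Rightarrow> real) \<Rightarrow> (real \<Rightarrow> 'h) \<Rightarrow> real \<Rightarrow> 'l \<Rightarrow> real" where
  "coord_version M co f =
     (SOME F. F \<in> coord_versions M co f \<and> sup_square_integral M F < \<infinity>)"

definition K_plus ::
  "'l measure \<Rightarrow> ('h \<Rightarrow> 'l \<Rightarrow> real) \<Rightarrow> ('l \<Rightarrow> real) \<Rightarrow> (real \<Rightarrow> 'h) \<Rightarrow> real \<Rightarrow> 'h" where
  "K_plus M co \<gamma> f x =
     of_coords M co
       (\<lambda>l. \<integral>y. resolvent_kernel \<gamma> (x - y) l * (indicator {0..} y * coord_version M co f y l) \<partial>lborel)"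

definition mild_solution ::
  "'l measure \<Rightarrow> ('h::real_inner \<Rightarrow> 'l \<Rightarrow> real) \<Rightarrow> ('l \<Rightarrow> real) \<Rightarrow> ('h \<Rightarrow> 'h \<Rightarrow> 'h) \<Rightarrow> (real \<Rightarrow> 'h) \<Rightarrow> bool"
  where
  "mild_solution M co \<gamma> D u \<longleftrightarrow>
     (\<forall>x\<ge>0. u x = stable_semigroup M co \<gamma> x (stable_proj M co \<gamma> (u 0))
                   + K_plus M co \<gamma> (D_star D u u) x)"


subsection \<open>Functions of class \<open>C\<^sup>r\<close> on relatively open subsets of a subspace\<close>

text \<open>
  Frechet differentiability of order \<open>r\<close> for a map defined on a relatively open subset \<open>S\<close> of a
  linear subspace \<open>V\<close>. The \<open>k\<close>-th derivative at \<open>x\<close> is a bounded \<open>k\<close>-linear map on \<open>V\<close>, encoded as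
  a function of the list of its \<open>k\<close> arguments (spaces of \<open>k\<close>-linear maps for varying \<open>k\<close> do not fit
  into one type); differentiability and continuity of the derivatives refer to the operator norm on
  \<open>k\<close>-linear maps.
\<close>

definition bounded_multilinear_on ::
  "'a::real_normed_vector set \<Rightarrow> nat \<Rightarrow> ('a list \<Rightarrow> 'b::real_normed_vector) \<Rightarrow> bool" where
  "bounded_multilinear_on V k m \<longleftrightarrow>
     (\<forall>us vs x y a b. set us \<subseteq> V \<and> set vs \<subseteq> V \<and> x \<in> V \<and> y \<in> V \<and>
        length us + 1 + length vs = k \<longrightarrow>
        m (us @ [a *\<^sub>R x + b *\<^sub>R y] @ vs) = a *\<^sub>R m (us @ [x] @ vs) + b *\<^sub>R m (us @ [y] @ vs)) \<and>
     (\<exists>C. \<forall>vs. set vs \<subseteq> V \<and> length vs = k \<longrightarrow> norm (m vs) \<le> C * prod_list (map norm vs))"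

definition C_r_on ::
  "'a::real_normed_vector set \<Rightarrow> nat \<Rightarrow> 'a set \<Rightarrow> ('a \<Rightarrow> 'b::real_normed_vector) \<Rightarrow> bool" where
  "C_r_on V r S f \<longleftrightarrow>
     (\<exists>d :: nat \<Rightarrow> 'a \<Rightarrow> 'a list \<Rightarrow> 'b.
        (\<forall>x\<in>S. d 0 x [] = f x) \<and>
        (\<forall>k\<le>r. \<forall>x\<in>S. bounded_multilinear_on V k (d k x)) \<and>
        (\<forall>k<r. \<forall>x\<in>S. \<forall>e>0. \<exists>\<delta>>0. \<forall>y\<in>S. norm (y - x) < \<delta> \<longrightarrow>
           (\<forall>vs. set vs \<subseteq> V \<and> length vs = k \<longrightarrow>
              norm (d k y vs - d k x vs - d (Suc k) x ((y - x) # vs))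
                \<le> e * norm (y - x) * prod_list (map norm vs))) \<and>
        (\<forall>x\<in>S. \<forall>e>0. \<exists>\<delta>>0. \<forall>y\<in>S. norm (y - x) < \<delta> \<longrightarrow>
           (\<forall>vs. set vs \<subseteq> V \<and> length vs = r \<longrightarrow>
              norm (d r y vs - d r x vs) \<le> e * prod_list (map norm vs))))"


subsection \<open>Local stable manifolds\<close>

definition small_solution ::
  "'l measure \<Rightarrow> ('h::real_inner \<Rightarrow> 'l \<Rightarrow> real) \<Rightarrow> ('l \<Rightarrow> real) \<Rightarrow> ('h \<Rightarrow> 'h \<Rightarrow> 'h) \<Rightarrow>
   real \<Rightarrow> 'h \<Rightarrow> (real \<Rightarrow> 'h) \<Rightarrow> bool" where
  "small_solution M co \<gamma> D \<epsilon> h u \<longleftrightarrow>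
     u \<in> reverse_space M co \<and> mild_solution M co \<gamma> D u \<and>
     reverse_norm M co u \<le> \<epsilon> \<and> stable_proj M co \<gamma> (u 0) = h"

end

theory Submission
  imports Defs "HOL-Real_Asymp.Real_Asymp"
begin

text \<open>
  The mild equation says that \<open>u\<close> is a fixed point of \<open>u \<mapsto> T h + Q(u, u)\<close>, where \<open>h\<close> is the stable
  part of \<open>u 0\<close>, \<open>T\<close> is the stable semigroup and \<open>Q(u, v)\<close> is \<open>K\<close> applied to the symmetrization of
  \<open>D(u, v)\<close> on the half line. The point of the reverse norm is that \<open>K\<close>, which need not be bounded
  in the sup norm, does not increase it: at a fixed \<open>\<lambda>\<close> the kernel \<open>\<K>(\<cdot>, \<lambda>)\<close> has total mass at most one, hence
  \<open>\<bar>(K f)\<^sub>\<lambda>(x)\<bar> \<le> sup \<bar>f\<^sub>\<lambda>\<bar>\<close> for every \<open>x\<close> (\<open>K_integrand\<close>). Likewise \<open>T\<close> has norm at most one. If the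
  space is closed under \<open>D\<^sub>*\<close>, polarization of the quadratic bound makes \<open>Q\<close> a bounded bilinear map
  (\<open>symmetrized_bound\<close>), and the space is complete (\<open>majorized_suminf\<close>).

  For small \<open>h\<close> the fixed point is the convergent series \<open>\<Sum> p\<^sub>n(h, \<dots>, h)\<close>, where \<open>p\<^sub>n\<close> is \<open>n\<close>-linear,
  \<open>p\<^sub>1 = T\<close>, and \<open>p\<^sub>n(h\<^sub>1, \<dots>, h\<^sub>n)\<close> is the sum of \<open>Q(p\<^sub>i(h\<^sub>1, \<dots>, h\<^sub>i), p\<^sub>n\<^sub>-\<^sub>i(h\<^sub>i\<^sub>+\<^sub>1, \<dots>, h\<^sub>n))\<close> over \<open>0 < i < n\<close>
  (\<open>expansion\<close>, \<open>solution_fixed_point\<close>); it is the only small one because \<open>Q(u, u)\<close> is quadratic in \<open>u\<close>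
  (\<open>small_fixed_point_unique\<close>). At \<open>x = 0\<close> the term \<open>K(\<dots>)\<close> has coordinates only where \<open>\<gamma> < 0\<close>, so
  \<open>u 0 = h + J h\<close> with \<open>J h\<close> unstable, and \<open>J\<close> is given by a power series in \<open>h\<close> with values in the
  Hilbert space. Differentiating such a series termwise gives series of the same kind, which yields
  all derivatives (\<open>C_r_on_power_sum\<close>). Local invariance holds because a translate \<open>u(x\<^sub>0 + \<cdot>)\<close> of a
  mild solution is a mild solution of no larger norm (\<open>shifted_mild_solution\<close>), to which uniqueness
  applies.

  The measure theory has two delicate points. The supremum over \<open>x \<ge> 0\<close> of a jointly measurable
  function need not be measurable; but a jointly measurable choice of coordinates that is dominated by
  a square-integrable function can be truncated at a countable essential supremum, after which its
  supremum is measurable (\<open>majorized_imp_reverse_norm_sq_le\<close>). So a bound on the reverse norm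
  only requires a dominating function. Secondly, the spectral measure need not be sigma-finite; but
  all functions that occur vanish outside the support of a square-integrable one, and there the
  measure is sigma-finite (\<open>sigma_finite_support\<close>), so that Fubini's theorem applies.

  If \<open>D\<close> has a kernel \<open>\<kappa>\<close>, a function dominated by \<open>S\<close> is mapped by \<open>D\<^sub>*\<close> to one dominated by
  \<open>\<integral>\<integral> \<bar>\<kappa>\<bar> S S\<close> (\<open>has_kernel_majorized\<close>). The latter is square-integrable when the map with kernel
  \<open>\<bar>\<kappa>\<bar>\<close> is bounded, or by two applications of the Cauchy-Schwarz inequality when \<open>\<kappa>\<close> is.
\<close>

section \<open>Power series given by multilinear maps\<close>

definition multilinear :: "('a::real_vector list \<Rightarrow> 'b::real_vector) \<Rightarrow> bool" where
  "multilinear F \<longleftrightarrow> (\<forall>us vs x y a b.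
     F (us @ (a *\<^sub>R x + b *\<^sub>R y) # vs) = a *\<^sub>R F (us @ x # vs) + b *\<^sub>R F (us @ y # vs))"

text \<open>
  One function on lists stands for a sequence of \<open>n\<close>-linear maps, one for each length \<open>n\<close>, with norms
  bounded by \<open>A R\<^sup>n\<close>; these are the coefficients of a power series that converges for \<open>norm x < 1 / R\<close>.
\<close>

definition geometric_family ::
  "real \<Rightarrow> real \<Rightarrow> ('a::real_normed_vector list \<Rightarrow> 'b::real_normed_vector) \<Rightarrow> bool" where
  "geometric_family A R F \<longleftrightarrow> multilinear F \<and> 0 \<le> A \<and> 0 \<le> R \<and>
     (\<forall>hs. norm (F hs) \<le> A * R ^ length hs * prod_list (map norm hs))"

lemma multilinearD:
  "multilinear F \<Longrightarrow>
    F (us @ (a *\<^sub>R x + b *\<^sub>R y) # vs) = a *\<^sub>R F (us @ x # vs) + b *\<^sub>R F (us @ y # vs)"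
  unfolding multilinear_def by blast

lemma prod_list_norm_nonneg: "0 \<le> prod_list (map norm hs)"
  by (induction hs) auto

lemma multilinear_Cons: "multilinear F \<Longrightarrow> multilinear (\<lambda>hs. F (z # hs))"
  unfolding multilinear_def by (metis append_Cons)

lemma geometric_family_Cons:
  assumes "geometric_family A R F"
  shows "geometric_family (A * R * norm z) R (\<lambda>hs. F (z # hs))"
proof -
  have "norm (F (z # hs)) \<le> A * R * norm z * R ^ length hs * prod_list (map norm hs)" for hs
  proof -
    have "norm (F (z # hs)) \<le> A * R ^ length (z # hs) * prod_list (map norm (z # hs))"
      using assms unfolding geometric_family_def by blast
    then show ?thesis by (simp add: mult_ac)
  qed
  then show ?thesis
    using assms multilinear_Cons[of F z] unfolding geometric_family_def by auto
qed

lemma geometric_family_Cons_le: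
  assumes "geometric_family A R F" "norm z \<le> c"
  shows "geometric_family (A * R * c) R (\<lambda>hs. F (z # hs))"
proof -
  note g = geometric_family_Cons[OF assms(1), of z]
  have "0 \<le> A * R" using assms(1) unfolding geometric_family_def by auto
  then have le: "A * R * norm z \<le> A * R * c" and c: "0 \<le> A * R * c"
    using assms(2) order_trans[OF norm_ge_zero assms(2)]
    by (auto intro: mult_left_mono mult_nonneg_nonneg)
  have "norm (F (z # hs)) \<le> A * R * c * R ^ length hs * prod_list (map norm hs)" for hs
  proof -
    have "norm (F (z # hs)) \<le> A * R * norm z * R ^ length hs * prod_list (map norm hs)"
      using g unfolding geometric_family_def by blast
    also have "\<dots> \<le> A * R * c * R ^ length hs * prod_list (map norm hs)"
      using le g unfolding geometric_family_def
      by (intro mult_right_mono prod_list_norm_nonneg) auto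
    finally show ?thesis .
  qed
  then show ?thesis using g c unfolding geometric_family_def by auto
qed

lemma multilinear_Cons_diff:
  assumes "multilinear F"
  shows "F (y # hs) - F (x # hs) = F ((y - x) # hs)"
  using multilinearD[OF assms, of "[]" 1 y "-1" x hs] by simp

lemma norm_geometric_power:
  assumes "geometric_family A R F" "norm x \<le> \<rho>"
  shows "norm (F (replicate n x)) \<le> A * (R * \<rho>) ^ n"
proof -
  have "norm (F (replicate n x)) \<le> A * R ^ n * norm x ^ n"
    using assms(1)[unfolded geometric_family_def] by (metis length_replicate map_replicate prod_list_replicate)
  also have "\<dots> \<le> A * R ^ n * \<rho> ^ n"
    using assms by (intro mult_left_mono power_mono) (auto simp: geometric_family_def)
  finally show ?thesis by (simp add: power_mult_distrib)
qed

text \<open>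
  The arguments are replaced one at a time: fixing the first argument of the family gives another
  geometric family, to which the induction hypothesis applies, with \<open>A\<close> multiplied by
  \<open>R * \<rho>\<close>; the difference in the first argument contributes the factor \<open>A * R * norm (y - x)\<close>.
\<close>

lemma power_diff_bound:
  assumes "geometric_family A R F" "norm x \<le> \<rho>" "norm y \<le> \<rho>" "0 < \<rho>"
  shows "norm (F (replicate n y) - F (replicate n x))
           \<le> A * (R * \<rho>) ^ n * (real n * (norm (y - x) / \<rho>))"
  using assms(1)
proof (induction n arbitrary: F A)
  case 0
  then show ?case by simp
next
  case (Suc n)
  let ?s = "norm (y - x) / \<rho>"
  have ml: "multilinear F" using Suc.prems unfolding geometric_family_def by auto
  have "F (replicate (Suc n) y) - F (replicate (Suc n) x) =
      (F (y # replicate n y) - F (y # replicate n x)) + F ((y - x) # replicate n x)"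
    using multilinear_Cons_diff[OF ml, of y "replicate n x" x] by (simp add: algebra_simps)
  also have "norm \<dots> \<le> A * R * \<rho> * (R * \<rho>) ^ n * (real n * ?s) + A * R * norm (y - x) * (R * \<rho>) ^ n"
    by (intro norm_triangle_mono Suc.IH[OF geometric_family_Cons_le[OF Suc.prems assms(3)]]
          norm_geometric_power[OF geometric_family_Cons[OF Suc.prems] assms(2)])
  also have "\<dots> = A * (R * \<rho>) ^ Suc n * (real (Suc n) * ?s)"
    using assms(4) by (simp add: field_simps)
  finally show ?case .
qed

text \<open>
  On lists of length \<open>n\<close> this is the \<open>n\<close>-linear part of the derivative in direction \<open>v\<close> of the power
  series of \<open>F\<close>: the derivative of \<open>x \<mapsto> F(x, \<dots>, x)\<close> with \<open>n + 1\<close> arguments replaces each argument in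
  turn by \<open>v\<close>.
\<close>

definition directional :: "('a list \<Rightarrow> 'b::comm_monoid_add) \<Rightarrow> 'a \<Rightarrow> 'a list \<Rightarrow> 'b" where
  "directional F v hs = (\<Sum>i\<le>length hs. F (take i hs @ v # drop i hs))"

lemma directional_replicate_Suc:
  "directional F w (replicate (Suc n) x)
     = F (w # replicate (Suc n) x) + directional (\<lambda>hs. F (x # hs)) w (replicate n x)"
  unfolding directional_def by (simp add: sum.atMost_Suc_shift del: sum.atMost_Suc)

text \<open>
  Second-order Taylor remainder of a single homogeneous term. As in \<open>power_diff_bound\<close> the first
  argument is split off; the part that this leaves over is a first-order difference in the remaining
  arguments, with \<open>y - x\<close> in the first place, and so is of second order in \<open>y - x\<close>.
\<close>

lemma power_remainder_bound:
  assumes "geometric_family A R F" "norm x \<le> \<rho>" "norm y \<le> \<rho>" "0 < \<rho>"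
  shows "norm (F (replicate (Suc n) y) - F (replicate (Suc n) x) - directional F (y - x) (replicate n x))
           \<le> A * (R * \<rho>) ^ Suc n * ((real (Suc n))\<^sup>2 * (norm (y - x) / \<rho>)\<^sup>2)"
  using assms(1)
proof (induction n arbitrary: F A)
  case 0
  then have "multilinear F" and A: "0 \<le> A" "0 \<le> R" by (auto simp: geometric_family_def)
  then show ?case using multilinear_Cons_diff[of F y "[]" x] assms(4)
    by (auto simp: directional_def intro!: mult_nonneg_nonneg)
next
  case (Suc n)
  let ?s = "norm (y - x) / \<rho>"
  let ?w = "y - x"
  let ?Fx = "\<lambda>hs. F (x # hs)" and ?Fw = "\<lambda>hs. F (?w # hs)"
  have ml: "multilinear F" and A: "0 \<le> A" "0 \<le> R"
    using Suc.prems unfolding geometric_family_def by auto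
  have "F (replicate (Suc (Suc n)) y) - F (replicate (Suc (Suc n)) x)
        - directional F ?w (replicate (Suc n) x)
      = (?Fx (replicate (Suc n) y) - ?Fx (replicate (Suc n) x) - directional ?Fx ?w (replicate n x))
        + (?Fw (replicate (Suc n) y) - ?Fw (replicate (Suc n) x))"
    using multilinear_Cons_diff[OF ml, of y "replicate (Suc n) y" x]
    unfolding directional_replicate_Suc by (simp add: algebra_simps)
  also have "norm \<dots> \<le> A * R * \<rho> * (R * \<rho>) ^ Suc n * ((real (Suc n))\<^sup>2 * ?s\<^sup>2)
       + A * R * norm ?w * (R * \<rho>) ^ Suc n * (real (Suc n) * ?s)"
    by (intro norm_triangle_mono Suc.IH[OF geometric_family_Cons_le[OF Suc.prems assms(2)]]
          power_diff_bound[OF geometric_family_Cons[OF Suc.prems] assms(2-4)])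
  also have "\<dots> = A * (R * \<rho>) ^ Suc (Suc n) * (((real (Suc n))\<^sup>2 + real (Suc n)) * ?s\<^sup>2)"
    using assms(4) by (simp add: field_simps power2_eq_square)
  also have "\<dots> \<le> A * (R * \<rho>) ^ Suc (Suc n) * ((real (Suc (Suc n)))\<^sup>2 * ?s\<^sup>2)"
    using A assms(4) by (intro mult_left_mono mult_right_mono)
      (auto simp: power2_eq_square algebra_simps)
  finally show ?case .
qed

lemma split_at_slot:
  "\<exists>us1 vs1. \<forall>z. take i (us @ z # vs) @ v # drop i (us @ z # vs) = us1 @ z # vs1"
proof (cases "i \<le> length us")
  case True
  then show ?thesis by (intro exI[of _ "take i us @ v # drop i us"] exI[of _ vs]) auto
next
  case False
  then obtain j where "i = length us + Suc j" by (metis add_Suc_right less_iff_Suc_add not_le)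
  then show ?thesis
    by (intro exI[of _ us] exI[of _ "take j vs @ v # drop j vs"]) auto
qed

lemma multilinear_directional:
  assumes "multilinear F"
  shows "multilinear (directional F v)"
  unfolding multilinear_def
proof (intro allI)
  fix us vs x y and a b :: real
  have *: "F (take i (us @ (a *\<^sub>R x + b *\<^sub>R y) # vs) @ v # drop i (us @ (a *\<^sub>R x + b *\<^sub>R y) # vs))
     = a *\<^sub>R F (take i (us @ x # vs) @ v # drop i (us @ x # vs))
     + b *\<^sub>R F (take i (us @ y # vs) @ v # drop i (us @ y # vs))" for i
  proof -
    obtain us1 vs1 where "\<forall>z. take i (us @ z # vs) @ v # drop i (us @ z # vs) = us1 @ z # vs1"
      using split_at_slot[of i us vs v] by (elim exE)
    then show ?thesis using multilinearD[OF assms] by simp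
  qed
  show "directional F v (us @ (a *\<^sub>R x + b *\<^sub>R y) # vs)
      = a *\<^sub>R directional F v (us @ x # vs) + b *\<^sub>R directional F v (us @ y # vs)"
    unfolding directional_def *
    by (simp add: sum.distrib scaleR_right.sum scaleR_right_distrib del: take_append drop_append)
qed

lemma directional_linear:
  assumes "multilinear F"
  shows "directional F (a *\<^sub>R x + b *\<^sub>R y) hs = a *\<^sub>R directional F x hs + b *\<^sub>R directional F y hs"
  unfolding directional_def multilinearD[OF assms] by (simp add: sum.distrib scaleR_right.sum)

text \<open>
  There are \<open>n + 1\<close> places to insert \<open>v\<close> into a list of length \<open>n\<close>. Bounding \<open>n + 1\<close> by \<open>2\<^sup>n\<close> keeps the
  derivative among the geometric families, at the price of halving the radius.
\<close>

lemma geometric_family_directional: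
  assumes "geometric_family A R F"
  shows "geometric_family (A * R * norm v) (2 * R) (directional F v)"
proof -
  have A: "0 \<le> A" "0 \<le> R" and ml: "multilinear F"
    and bd: "\<And>hs. norm (F hs) \<le> A * R ^ length hs * prod_list (map norm hs)"
    using assms unfolding geometric_family_def by auto
  have "norm (directional F v hs) \<le> A * R * norm v * (2 * R) ^ length hs * prod_list (map norm hs)" for hs
  proof -
    let ?P = "prod_list (map norm hs)"
    have *: "norm (F (take i hs @ v # drop i hs)) \<le> A * R * norm v * R ^ length hs * ?P"
      if "i \<le> length hs" for i
    proof -
      have "prod_list (map norm (take i hs)) * prod_list (map norm (drop i hs)) = ?P"
        by (metis append_take_drop_id map_append prod_list.append)
      moreover have "length (take i hs @ v # drop i hs) = Suc (length hs)" using that by simp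
      ultimately show ?thesis
        using bd[of "take i hs @ v # drop i hs"] by (simp add: mult_ac)
    qed
    have "norm (directional F v hs) \<le> (\<Sum>i\<le>length hs. A * R * norm v * R ^ length hs * ?P)"
      unfolding directional_def using * by (intro sum_norm_le) auto
    also have "\<dots> = real (Suc (length hs)) * (A * R * norm v * R ^ length hs * ?P)" by simp
    also have "\<dots> \<le> 2 ^ length hs * (A * R * norm v * R ^ length hs * ?P)"
    proof (intro mult_right_mono)
      have "Suc n \<le> 2 ^ n" for n by (induction n) auto
      then show "real (Suc (length hs)) \<le> 2 ^ length hs"
        by (metis of_nat_le_iff of_nat_numeral of_nat_power)
      show "0 \<le> A * R * norm v * R ^ length hs * ?P"
        using A by (intro mult_nonneg_nonneg prod_list_norm_nonneg) auto
    qed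
    finally show ?thesis by (simp add: power_mult_distrib mult_ac)
  qed
  then show ?thesis using multilinear_directional[OF ml] A unfolding geometric_family_def by auto
qed

text \<open>
  With \<open>k\<close> directions in the list, these are the coefficients of the \<open>k\<close>-th derivative applied to
  these directions. The direction added last is at the head, as in the definition of \<open>C_r_on\<close>.
\<close>

fun iterated_directional :: "('a list \<Rightarrow> 'b::comm_monoid_add) \<Rightarrow> 'a list \<Rightarrow> 'a list \<Rightarrow> 'b" where
  "iterated_directional F [] = F"
| "iterated_directional F (v # vs) = directional (iterated_directional F vs) v"

lemma iterated_directional_geometric:
  assumes "geometric_family A R F"
  shows "\<exists>A'\<ge>0. \<forall>vs. length vs = k \<longrightarrow>
    geometric_family (A' * prod_list (map norm vs)) (2 ^ k * R) (iterated_directional F vs)"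
proof (induction k)
  case 0
  then show ?case using assms by (intro exI[of _ A]) (auto simp: geometric_family_def)
next
  case (Suc k)
  then obtain A' where A': "0 \<le> A'" "\<And>vs. length vs = k \<Longrightarrow>
    geometric_family (A' * prod_list (map norm vs)) (2 ^ k * R) (iterated_directional F vs)"
    by blast
  have R: "0 \<le> R" using assms unfolding geometric_family_def by auto
  show ?case
  proof (intro exI[of _ "A' * (2 ^ k * R)"] conjI allI impI)
    fix vs :: "'a list" assume "length vs = Suc k"
    then obtain w ws where "vs = w # ws" "length ws = k" by (cases vs) auto
    then show "geometric_family (A' * (2 ^ k * R) * prod_list (map norm vs)) (2 ^ Suc k * R)
        (iterated_directional F vs)"
      using geometric_family_directional[OF A'(2)[of ws], of w] by (simp add: mult_ac)
  qed (use A' R in auto)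
qed

lemma iterated_directional_multilinear:
  assumes "multilinear F"
  shows "multilinear (iterated_directional F vs)"
  by (induction vs) (auto simp: assms multilinear_directional)

lemma iterated_directional_linear:
  assumes "multilinear F"
  shows "iterated_directional F (us @ (a *\<^sub>R x + b *\<^sub>R y) # vs) hs
    = a *\<^sub>R iterated_directional F (us @ x # vs) hs + b *\<^sub>R iterated_directional F (us @ y # vs) hs"
proof (induction us arbitrary: hs)
  case Nil
  then show ?case
    by (simp add: directional_linear[OF iterated_directional_multilinear[OF assms]])
next
  case (Cons u us)
  show ?case by (simp add: directional_def Cons sum.distrib scaleR_right.sum)
qed

definition power_sum :: "('a list \<Rightarrow> 'b::real_normed_vector) \<Rightarrow> 'a \<Rightarrow> 'b" where
  "power_sum F x = (\<Sum>n. F (replicate n x))"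

lemma summable_powers:
  fixes F :: "'a::real_normed_vector list \<Rightarrow> 'b::banach"
  assumes "geometric_family A R F" "norm x \<le> \<rho>" "R * \<rho> \<le> 1/8" "0 < \<rho>"
  shows "summable (\<lambda>n. F (replicate n x))" "norm (power_sum F x) \<le> 2 * A"
proof -
  have A: "0 \<le> A" "0 \<le> R" using assms unfolding geometric_family_def by auto
  have le: "norm (F (replicate n x)) \<le> A * (1/2) ^ n" for n
  proof -
    have "norm (F (replicate n x)) \<le> A * (R * \<rho>) ^ n" by (rule norm_geometric_power[OF assms(1,2)])
    also have "\<dots> \<le> A * (1/2) ^ n"
      using A assms by (intro mult_left_mono power_mono) auto
    finally show ?thesis .
  qed
  have s: "(\<lambda>n. A * (1/2::real) ^ n) sums (A * 2)"
    using sums_mult[OF geometric_sums[of "1/2::real"], of A] by simp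
  show "summable (\<lambda>n. F (replicate n x))"
    by (rule summable_comparison_test'[OF sums_summable[OF s]]) (rule le)
  have "norm (power_sum F x) \<le> (\<Sum>n. A * (1/2) ^ n)"
    unfolding power_sum_def by (rule norm_suminf_le[OF le sums_summable[OF s]])
  then show "norm (power_sum F x) \<le> 2 * A" using sums_unique[OF s] by simp
qed

text \<open>
  The factors \<open>n\<^sup>2\<close> in the Taylor remainders are absorbed by evaluating all series at most at one eighth
  of their radius of convergence.
\<close>

lemma square_times_eighth_power: "((real n)\<^sup>2) * (1/8) ^ n \<le> (1/2) ^ n"
proof -
  have "real n \<le> 2 ^ n" using less_exp[of n] by (metis less_imp_le of_nat_le_iff of_nat_numeral of_nat_power)
  then have "(real n)\<^sup>2 \<le> (2 ^ n)\<^sup>2" by (intro power_mono) auto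
  then have "(real n)\<^sup>2 * (1/8) ^ n \<le> (2 ^ n)\<^sup>2 * (1/8) ^ n" by (intro mult_right_mono) auto
  also have "\<dots> = (1/2::real) ^ n"
    by (simp add: power2_eq_square flip: power_mult_distrib)
  finally show ?thesis .
qed

lemma power_sum_lipschitz:
  fixes F :: "'a::real_normed_vector list \<Rightarrow> 'b::banach"
  assumes F: "geometric_family A R F" and \<rho>: "R * \<rho> \<le> 1/8" "0 < \<rho>"
    and x: "norm x \<le> \<rho>" and y: "norm y \<le> \<rho>"
  shows "norm (power_sum F y - power_sum F x) \<le> 2 * A * (norm (y - x) / \<rho>)"
proof -
  have A: "0 \<le> A" "0 \<le> R" using F unfolding geometric_family_def by auto
  let ?s = "norm (y - x) / \<rho>"
  have s0: "0 \<le> ?s" using \<rho> by auto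
  have le: "norm (F (replicate n y) - F (replicate n x)) \<le> A * ?s * (1/2) ^ n" for n
  proof -
    have "norm (F (replicate n y) - F (replicate n x)) \<le> A * (R * \<rho>) ^ n * (real n * ?s)"
      by (rule power_diff_bound[OF F x y \<rho>(2)])
    also have "\<dots> \<le> A * (1/8) ^ n * ((real n)\<^sup>2 * ?s)"
      using A \<rho> s0 by (intro mult_mono mult_left_mono power_mono mult_right_mono)
        (auto simp: power2_nat_le_imp_le power2_eq_square simp flip: of_nat_mult)
    also have "\<dots> = A * ?s * ((real n)\<^sup>2 * (1/8) ^ n)" by simp
    also have "\<dots> \<le> A * ?s * (1/2) ^ n"
      using A s0 by (intro mult_left_mono square_times_eighth_power mult_nonneg_nonneg)
    finally show ?thesis .
  qed
  have s: "(\<lambda>n. A * ?s * (1/2::real) ^ n) sums (A * ?s * 2)"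
    using sums_mult[OF geometric_sums[of "1/2::real"], of "A * ?s"] by simp
  have "power_sum F y - power_sum F x = (\<Sum>n. F (replicate n y) - F (replicate n x))"
    unfolding power_sum_def
    by (rule suminf_diff) (rule summable_powers[OF F _ \<rho>], fact)+
  also have "norm \<dots> \<le> (\<Sum>n. A * ?s * (1/2) ^ n)"
    by (rule norm_suminf_le[OF le sums_summable[OF s]])
  finally show ?thesis unfolding sums_unique[OF s, symmetric] by (simp add: mult_ac)
qed

lemma power_sum_remainder:
  fixes F :: "'a::real_normed_vector list \<Rightarrow> 'b::banach"
  assumes F: "geometric_family A R F" and \<rho>: "2 * R * \<rho> \<le> 1/8" "0 < \<rho>"
    and x: "norm x \<le> \<rho>" and y: "norm y \<le> \<rho>"
  shows "norm (power_sum F y - power_sum F x - power_sum (directional F (y - x)) x)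
     \<le> A * (norm (y - x) / \<rho>)\<^sup>2"
proof -
  have A: "0 \<le> A" "0 \<le> R" using F unfolding geometric_family_def by auto
  have \<rho>': "R * \<rho> \<le> 1/8" using A \<rho>
    by (metis mult.assoc mult_2 mult_nonneg_nonneg le_add_same_cancel1 less_eq_real_def order_trans)
  let ?s = "norm (y - x) / \<rho>"
  let ?E = "\<lambda>n. F (replicate (Suc n) y) - F (replicate (Suc n) x) - directional F (y - x) (replicate n x)"
  have s0: "0 \<le> ?s\<^sup>2" by auto
  have le: "norm (?E n) \<le> A * ?s\<^sup>2 * (1/2) ^ Suc n" for n
  proof -
    have "norm (?E n) \<le> A * (R * \<rho>) ^ Suc n * ((real (Suc n))\<^sup>2 * ?s\<^sup>2)"
      by (rule power_remainder_bound[OF F x y \<rho>(2)])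
    also have "\<dots> \<le> A * (1/8) ^ Suc n * ((real (Suc n))\<^sup>2 * ?s\<^sup>2)"
      using A \<rho> \<rho>' s0 by (intro mult_right_mono mult_left_mono power_mono) auto
    also have "\<dots> = A * ?s\<^sup>2 * ((real (Suc n))\<^sup>2 * (1/8) ^ Suc n)" by simp
    also have "\<dots> \<le> A * ?s\<^sup>2 * (1/2) ^ Suc n"
      using A s0 by (intro mult_left_mono square_times_eighth_power) auto
    finally show ?thesis .
  qed
  have s: "(\<lambda>n. A * ?s\<^sup>2 * (1/2::real) ^ Suc n) sums (A * ?s\<^sup>2)"
    using sums_mult[OF geometric_sums[of "1/2::real"], of "A * ?s\<^sup>2 / 2"] by simp
  note sy = summable_powers(1)[OF F y \<rho>' \<rho>(2)] and sx = summable_powers(1)[OF F x \<rho>' \<rho>(2)]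
  note sd = summable_powers(1)[OF geometric_family_directional[OF F] x \<rho>]
  have "power_sum F z = F [] + (\<Sum>n. F (replicate (Suc n) z))"
    if "summable (\<lambda>n. F (replicate n z))" for z
    unfolding power_sum_def using suminf_split_head[OF that] by simp
  then have "power_sum F y - power_sum F x - power_sum (directional F (y - x)) x = 
     (\<Sum>n. F (replicate (Suc n) y)) - (\<Sum>n. F (replicate (Suc n) x)) - power_sum (directional F (y - x)) x"
    using sx sy by simp
  also have "\<dots> = (\<Sum>n. ?E n)"
    using summable_Suc_iff[THEN iffD2, OF sx] summable_Suc_iff[THEN iffD2, OF sy] sd
    unfolding power_sum_def by (simp add: suminf_diff summable_diff)
  also have "norm \<dots> \<le> (\<Sum>n. A * ?s\<^sup>2 * (1/2) ^ Suc n)"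
    by (rule norm_suminf_le[OF le sums_summable[OF s]])
  finally show ?thesis using sums_unique[OF s] by simp
qed

text \<open>
  The \<open>k\<close>-th derivative is the power series of the \<open>k\<close>-fold directional family. Every
  derivative halves the admissible radius, hence the factor \<open>2\<^sup>r\<close> in the bound for \<open>\<epsilon>\<close>.
\<close>

lemma C_r_on_power_sum:
  fixes F :: "'a::real_normed_vector list \<Rightarrow> 'b::banach"
  assumes F: "geometric_family A R F" and \<epsilon>: "0 < \<epsilon>" "2 ^ r * R * \<epsilon> \<le> 1/8"
    and S: "\<And>x. x \<in> S \<Longrightarrow> norm x \<le> \<epsilon>"
  shows "C_r_on V r S (power_sum F)"
proof -
  have R: "0 \<le> R" and ml: "multilinear F" using F unfolding geometric_family_def by auto
  define d where "d = (\<lambda>(k::nat) x vs. power_sum (iterated_directional F vs) x)"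
  obtain A' where A': "\<And>k. 0 \<le> A' k" "\<And>k vs. length vs = k \<Longrightarrow>
    geometric_family (A' k * prod_list (map norm vs)) (2 ^ k * R) (iterated_directional F vs)"
    using iterated_directional_geometric[OF F] by metis
  have small: "2 ^ k * R * \<epsilon> \<le> 1/8" if "k \<le> r" for k
  proof -
    have "2 ^ k * (R * \<epsilon>) \<le> 2 ^ r * (R * \<epsilon>)"
      using that R \<epsilon> by (intro mult_right_mono power_increasing) auto
    then show ?thesis using \<epsilon> by (simp add: mult_ac)
  qed
  show ?thesis
    unfolding C_r_on_def
  proof (intro exI[of _ d] conjI ballI allI impI)
    fix x assume "x \<in> S"
    show "d 0 x [] = power_sum F x" unfolding d_def by simp
  next
    fix k x assume k: "k \<le> r" and x: "x \<in> S"
    have sm: "summable (\<lambda>n. iterated_directional F vs (replicate n x))" if "length vs = k" for vs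
      using summable_powers(1)[OF A'(2)[OF that] S[OF x] small \<epsilon>(1)] k by simp
    show "bounded_multilinear_on V k (d k x)"
      unfolding bounded_multilinear_on_def
    proof (intro conjI allI impI)
      fix us vs :: "'a list" and z y :: 'a and a b :: real
      assume *: "set us \<subseteq> V \<and> set vs \<subseteq> V \<and> z \<in> V \<and> y \<in> V \<and> length us + 1 + length vs = k"
      have sz: "summable (\<lambda>n. iterated_directional F (us @ z # vs) (replicate n x))"
        and sy: "summable (\<lambda>n. iterated_directional F (us @ y # vs) (replicate n x))"
        using * by (auto intro!: sm)
      show "d k x (us @ [a *\<^sub>R z + b *\<^sub>R y] @ vs)
          = a *\<^sub>R d k x (us @ [z] @ vs) + b *\<^sub>R d k x (us @ [y] @ vs)"
        unfolding d_def power_sum_def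
        by (simp add: iterated_directional_linear[OF ml] sz sy summable_scaleR_right
              suminf_add[symmetric] suminf_scaleR_right[symmetric])
    next
      show "\<exists>C. \<forall>vs. set vs \<subseteq> V \<and> length vs = k \<longrightarrow> norm (d k x vs) \<le> C * prod_list (map norm vs)"
      proof (intro exI[of _ "2 * A' k"] allI impI)
        fix vs assume "set vs \<subseteq> V \<and> length vs = k"
        then show "norm (d k x vs) \<le> 2 * A' k * prod_list (map norm vs)"
          using summable_powers(2)[OF A'(2)[of vs k] S[OF x] small \<epsilon>(1)] k
          unfolding d_def by simp
      qed
    qed
  next
    fix k x and e :: real assume k: "k < r" and x: "x \<in> S" and e: "0 < e"
    show "\<exists>\<delta>>0. \<forall>y\<in>S. norm (y - x) < \<delta> \<longrightarrow> (\<forall>vs. set vs \<subseteq> V \<and> length vs = k \<longrightarrow>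
       norm (d k y vs - d k x vs - d (Suc k) x ((y - x) # vs)) \<le> e * norm (y - x) * prod_list (map norm vs))"
    proof (intro exI[of _ "e * \<epsilon>\<^sup>2 / (A' k + 1)"] conjI ballI allI impI)
      show "0 < e * \<epsilon>\<^sup>2 / (A' k + 1)"
        using e \<epsilon> A'(1)[of k] by (auto intro!: divide_pos_pos mult_pos_pos)
      fix y vs assume y: "y \<in> S" and d: "norm (y - x) < e * \<epsilon>\<^sup>2 / (A' k + 1)"
        and vs: "set vs \<subseteq> V \<and> length vs = k"
      let ?P = "prod_list (map norm vs)" and ?n = "norm (y - x)"
      have "2 * (2 ^ k * R) * \<epsilon> \<le> 1/8" using small[of "Suc k"] k by simp
      from power_sum_remainder[OF A'(2)[of vs k] this \<epsilon>(1) S[OF x] S[OF y]] vs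
      have "norm (d k y vs - d k x vs - d (Suc k) x ((y - x) # vs)) \<le> A' k * ?P * (?n / \<epsilon>)\<^sup>2"
        unfolding d_def by simp
      also have "\<dots> \<le> (A' k + 1) * ?P * (?n / \<epsilon>)\<^sup>2"
        by (intro mult_right_mono) (auto simp: prod_list_norm_nonneg)
      also have "\<dots> = ((A' k + 1) * ?n / \<epsilon>\<^sup>2) * (?n * ?P)"
        by (simp add: power2_eq_square)
      also have "\<dots> \<le> e * (?n * ?P)"
      proof (intro mult_right_mono)
        have "?n * (A' k + 1) < e * \<epsilon>\<^sup>2"
          using d A'(1)[of k] by (simp add: pos_less_divide_eq)
        then show "(A' k + 1) * ?n / \<epsilon>\<^sup>2 \<le> e"
          using \<epsilon> by (simp add: pos_divide_le_eq mult.commute)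
      qed (auto simp: prod_list_norm_nonneg)
      finally show "norm (d k y vs - d k x vs - d (Suc k) x ((y - x) # vs)) \<le> e * ?n * ?P"
        by (simp add: mult_ac)
    qed
  next
    fix x and e :: real assume x: "x \<in> S" and e: "0 < e"
    show "\<exists>\<delta>>0. \<forall>y\<in>S. norm (y - x) < \<delta> \<longrightarrow> (\<forall>vs. set vs \<subseteq> V \<and> length vs = r \<longrightarrow>
       norm (d r y vs - d r x vs) \<le> e * prod_list (map norm vs))"
    proof (intro exI[of _ "e * \<epsilon> / (2 * A' r + 1)"] conjI ballI allI impI)
      show "0 < e * \<epsilon> / (2 * A' r + 1)"
        using e \<epsilon> A'(1)[of r] by (auto intro!: divide_pos_pos mult_pos_pos)
      fix y vs assume y: "y \<in> S" and d: "norm (y - x) < e * \<epsilon> / (2 * A' r + 1)"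
        and vs: "set vs \<subseteq> V \<and> length vs = r"
      let ?P = "prod_list (map norm vs)" and ?n = "norm (y - x)"
      from power_sum_lipschitz[OF A'(2)[of vs r] small \<epsilon>(1) S[OF x] S[OF y]] vs
      have "norm (d r y vs - d r x vs) \<le> 2 * (A' r * ?P) * (?n / \<epsilon>)"
        unfolding d_def by simp
      also have "\<dots> = (2 * A' r * ?n / \<epsilon>) * ?P" by simp
      also have "\<dots> \<le> e * ?P"
      proof (intro mult_right_mono)
        have "2 * A' r * ?n \<le> ?n * (2 * A' r + 1)" by (simp add: algebra_simps)
        also have "\<dots> < e * \<epsilon>"
          using d A'(1)[of r] by (subst (asm) pos_less_divide_eq) auto
        finally show "2 * A' r * ?n / \<epsilon> \<le> e"
          using \<epsilon> by (simp add: pos_divide_le_eq mult.commute)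
      qed (auto simp: prod_list_norm_nonneg)
      finally show "norm (d r y vs - d r x vs) \<le> e * ?P" .
    qed
  qed
qed

section \<open>A quadratic fixed-point equation\<close>

text \<open>
  The equation \<open>u = L h + Q(u, u)\<close> in a Banach space of functions. The space is a set \<open>X\<close> with a norm
  \<open>N\<close>, since the space of interest depends on the spectral representation and is not a type. Completeness
  is stated as convergence of norm-dominated series, with pointwise sums. The pointwise
  bound \<open>norm_le_N\<close> turns convergence in \<open>X\<close> into convergence of the values.
\<close>

locale quadratic_equation =
  fixes X :: "('i \<Rightarrow> 'b::banach) set"
    and N :: "('i \<Rightarrow> 'b) \<Rightarrow> real"
    and L :: "'a::real_normed_vector \<Rightarrow> 'i \<Rightarrow> 'b"
    and Q :: "('i \<Rightarrow> 'b) \<Rightarrow> ('i \<Rightarrow> 'b) \<Rightarrow> 'i \<Rightarrow> 'b"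
    and C :: real
  assumes X_comb: "\<And>u v a b. u \<in> X \<Longrightarrow> v \<in> X \<Longrightarrow> (\<lambda>i. a *\<^sub>R u i + b *\<^sub>R v i) \<in> X"
    and N_triangle: "\<And>u v. u \<in> X \<Longrightarrow> v \<in> X \<Longrightarrow> N (\<lambda>i. u i + v i) \<le> N u + N v"
    and N_scale: "\<And>u a. u \<in> X \<Longrightarrow> N (\<lambda>i. a *\<^sub>R u i) \<le> \<bar>a\<bar> * N u"
    and norm_le_N: "\<And>u i. u \<in> X \<Longrightarrow> norm (u i) \<le> N u"
    and X_complete: "\<And>u a. (\<And>n::nat. u n \<in> X) \<Longrightarrow> (\<And>n. N (u n) \<le> a n) \<Longrightarrow> summable a \<Longrightarrow>
          (\<lambda>i. \<Sum>n. u n i) \<in> X \<and> N (\<lambda>i. \<Sum>n. u n i) \<le> suminf a"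
    and L_mem: "\<And>h. L h \<in> X"
    and L_comb: "\<And>a x b y. L (a *\<^sub>R x + b *\<^sub>R y) = (\<lambda>i. a *\<^sub>R L x i + b *\<^sub>R L y i)"
    and N_L: "\<And>h. N (L h) \<le> norm h"
    and Q_mem: "\<And>u v. u \<in> X \<Longrightarrow> v \<in> X \<Longrightarrow> Q u v \<in> X"
    and Q_left: "\<And>u v w a b. u \<in> X \<Longrightarrow> v \<in> X \<Longrightarrow> w \<in> X \<Longrightarrow>
          Q (\<lambda>i. a *\<^sub>R u i + b *\<^sub>R v i) w = (\<lambda>i. a *\<^sub>R Q u w i + b *\<^sub>R Q v w i)"
    and Q_right: "\<And>u v w a b. u \<in> X \<Longrightarrow> v \<in> X \<Longrightarrow> w \<in> X \<Longrightarrow>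
          Q w (\<lambda>i. a *\<^sub>R u i + b *\<^sub>R v i) = (\<lambda>i. a *\<^sub>R Q w u i + b *\<^sub>R Q w v i)"
    and N_Q: "\<And>u v. u \<in> X \<Longrightarrow> v \<in> X \<Longrightarrow> N (Q u v) \<le> C * N u * N v"
    and C_pos: "0 < C"
begin

lemma N_nonneg: "u \<in> X \<Longrightarrow> 0 \<le> N u"
  using norm_le_N[of u undefined] norm_ge_zero order_trans by blast

lemma X_zero: "(\<lambda>i. 0) \<in> X"
  using X_comb[OF L_mem L_mem, of 0 undefined 0 undefined] by simp

lemma X_add: "u \<in> X \<Longrightarrow> v \<in> X \<Longrightarrow> (\<lambda>i. u i + v i) \<in> X"
  using X_comb[of u v 1 1] by simp

lemma X_diff: "u \<in> X \<Longrightarrow> v \<in> X \<Longrightarrow> (\<lambda>i. u i - v i) \<in> X"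
  using X_comb[of u v 1 "-1"] by simp

lemma N_zero: "N (\<lambda>i. 0) = 0"
  using N_scale[OF X_zero, of 0] N_nonneg[OF X_zero] by simp

lemma Q_zero_left: "w \<in> X \<Longrightarrow> Q (\<lambda>i. 0) w = (\<lambda>i. 0)"
  using Q_left[OF X_zero X_zero, of w 0 0] by simp

lemma Q_zero_right: "w \<in> X \<Longrightarrow> Q w (\<lambda>i. 0) = (\<lambda>i. 0)"
  using Q_right[OF X_zero X_zero, of w 0 0] by simp

lemma X_sum:
  assumes "finite I" "\<And>k. k \<in> I \<Longrightarrow> f k \<in> X"
  shows "(\<lambda>i. \<Sum>k\<in>I. f k i) \<in> X" "N (\<lambda>i. \<Sum>k\<in>I. f k i) \<le> (\<Sum>k\<in>I. N (f k))"
proof -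
  have "(\<lambda>i. \<Sum>k\<in>I. f k i) \<in> X \<and> N (\<lambda>i. \<Sum>k\<in>I. f k i) \<le> (\<Sum>k\<in>I. N (f k))"
    using assms
  proof (induction I rule: finite_induct)
    case empty
    then show ?case by (simp add: X_zero N_zero)
  next
    case (insert x I)
    then have 1: "(\<lambda>i. \<Sum>k\<in>I. f k i) \<in> X" "N (\<lambda>i. \<Sum>k\<in>I. f k i) \<le> (\<Sum>k\<in>I. N (f k))" "f x \<in> X"
      by auto
    have "N (\<lambda>i. f x i + (\<Sum>k\<in>I. f k i)) \<le> N (f x) + N (\<lambda>i. \<Sum>k\<in>I. f k i)"
      by (rule N_triangle[OF 1(3) 1(1)])
    then show ?case
      using insert(1,2) X_add[OF 1(3) 1(1)] 1(2) by auto
  qed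
  then show "(\<lambda>i. \<Sum>k\<in>I. f k i) \<in> X" "N (\<lambda>i. \<Sum>k\<in>I. f k i) \<le> (\<Sum>k\<in>I. N (f k))" by auto
qed

lemma Q_sum_left:
  assumes "finite I" "\<And>k. k \<in> I \<Longrightarrow> f k \<in> X" "w \<in> X"
  shows "Q (\<lambda>i. \<Sum>k\<in>I. f k i) w = (\<lambda>i. \<Sum>k\<in>I. Q (f k) w i)"
  using assms(1,2)
proof (induction I rule: finite_induct)
  case empty
  then show ?case by (simp add: Q_zero_left assms)
next
  case (insert x I)
  then show ?case using Q_left[of "f x" "\<lambda>i. \<Sum>k\<in>I. f k i" w 1 1] X_sum(1)[of I f] assms(3)
    by simp
qed

lemma Q_sum_right:
  assumes "finite I" "\<And>k. k \<in> I \<Longrightarrow> f k \<in> X" "w \<in> X"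
  shows "Q w (\<lambda>i. \<Sum>k\<in>I. f k i) = (\<lambda>i. \<Sum>k\<in>I. Q w (f k) i)"
  using assms(1,2)
proof (induction I rule: finite_induct)
  case empty
  then show ?case by (simp add: Q_zero_right assms)
next
  case (insert x I)
  then show ?case using Q_right[of "f x" "\<lambda>i. \<Sum>k\<in>I. f k i" w 1 1] X_sum(1)[of I f] assms(3)
    by simp
qed

lemma Q_square_diff:
  assumes "u \<in> X" "v \<in> X"
  shows "N (\<lambda>i. Q u u i - Q v v i) \<le> C * N (\<lambda>i. u i - v i) * (N u + N v)"
proof -
  let ?w = "\<lambda>i. u i - v i"
  have w: "?w \<in> X" by (rule X_diff[OF assms])
  have "Q ?w u = (\<lambda>i. Q u u i - Q v u i)" "Q v ?w = (\<lambda>i. Q v u i - Q v v i)"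
    using Q_left[OF assms assms(1), of 1 "-1"] Q_right[OF assms assms(2), of 1 "-1"] by simp_all
  then have eq: "(\<lambda>i. Q u u i - Q v v i) = (\<lambda>i. Q ?w u i + Q v ?w i)" by simp
  have "N (\<lambda>i. Q u u i - Q v v i) \<le> N (Q ?w u) + N (Q v ?w)"
    unfolding eq by (intro N_triangle Q_mem w assms)
  also have "\<dots> \<le> C * N ?w * N u + C * N v * N ?w"
    by (intro add_mono N_Q w assms)
  finally show ?thesis by (simp add: algebra_simps)
qed

text \<open>
  For two solutions the bilinear identity \<open>Q(u, u) - Q(v, v) = Q(u - v, u) + Q(v, u - v)\<close> gives
  \<open>N (u - v) \<le> C * N (u - v) * (N u + N v)\<close>, and the last two factors contribute at most \<open>1 / (2 * C)\<close>.
\<close>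

lemma small_fixed_point_unique:
  assumes "u \<in> X" "v \<in> X" "N u \<le> 1 / (4 * C)" "N v \<le> 1 / (4 * C)"
    and "u = (\<lambda>i. L h i + Q u u i)" "v = (\<lambda>i. L h i + Q v v i)"
  shows "u = v"
proof -
  let ?w = "\<lambda>i. u i - v i"
  have w: "?w \<in> X" by (rule X_diff[OF assms(1,2)])
  have "u i = L h i + Q u u i" "v i = L h i + Q v v i" for i
    using assms(5,6) by metis+
  then have "?w = (\<lambda>i. Q u u i - Q v v i)" by auto
  then have "N ?w \<le> C * N ?w * (N u + N v)" using Q_square_diff[OF assms(1,2)] by simp
  also have "\<dots> \<le> C * N ?w * (1 / (4 * C) + 1 / (4 * C))"
    using assms C_pos N_nonneg[OF w] by (intro mult_left_mono add_mono) auto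
  also have "\<dots> = N ?w / 2" using C_pos by simp
  finally have "N ?w \<le> 0" by simp
  then have "norm (u i - v i) \<le> 0" for i
    using norm_le_N[OF w, of i] by linarith
  then show ?thesis by auto
qed

text \<open>
  The multilinear coefficients of the formal solution, obtained by comparing terms of
  equal degree in \<open>u = L h + Q(u, u)\<close>. They are not symmetric in their arguments, which is why they
  are functions of lists.
\<close>

function expansion :: "'a list \<Rightarrow> 'i \<Rightarrow> 'b" where
  "expansion hs = (if length hs = 1 then L (hd hs)
     else (\<lambda>j. \<Sum>i\<in>{1..<length hs}. Q (expansion (take i hs)) (expansion (drop i hs)) j))"
  by auto
termination by (relation "Wellfounded.measure length") auto

declare expansion.simps [simp del]

lemma expansion_Nil: "expansion [] = (\<lambda>j. 0)"
  by (subst expansion.simps) simp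

lemma expansion_single: "expansion [h] = L h"
  by (subst expansion.simps) simp

lemma expansion_rec:
  "length hs \<noteq> 1 \<Longrightarrow>
    expansion hs = (\<lambda>j. \<Sum>i\<in>{1..<length hs}. Q (expansion (take i hs)) (expansion (drop i hs)) j)"
  by (subst expansion.simps) simp

lemma expansion_mem: "expansion hs \<in> X"
proof (induction hs rule: length_induct)
  case (1 hs)
  show ?case
  proof (cases "length hs = 1")
    case True
    then show ?thesis by (subst expansion.simps) (simp add: L_mem)
  next
    case False
    show ?thesis unfolding expansion_rec[OF False]
      by (rule X_sum) (auto intro!: Q_mem 1[rule_format])
  qed
qed

lemma expansion_comb:
  "expansion (us @ (a *\<^sub>R x + b *\<^sub>R y) # vs)
     = (\<lambda>j. a *\<^sub>R expansion (us @ x # vs) j + b *\<^sub>R expansion (us @ y # vs) j)"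
proof (induction "length us + length vs" arbitrary: us vs rule: less_induct)
  case less
  show ?case
  proof (cases "us = [] \<and> vs = []")
    case True
    then show ?thesis by (simp add: expansion_single L_comb)
  next
    case False
    let ?z = "a *\<^sub>R x + b *\<^sub>R y"
    let ?t = "\<lambda>z i. Q (expansion (take i (us @ z # vs))) (expansion (drop i (us @ z # vs)))"
    let ?I = "{1..<Suc (length us + length vs)}"
    have rec: "expansion (us @ z # vs) = (\<lambda>j. \<Sum>i\<in>?I. ?t z i j)" for z
      using False by (subst expansion_rec) auto
    have split: "?t ?z i = (\<lambda>j. a *\<^sub>R ?t x i j + b *\<^sub>R ?t y i j)" if i: "i \<in> ?I" for i
    proof (cases "i \<le> length us")
      case True
      then have "length (drop i us) + length vs < length us + length vs" using i by auto
      from less[OF this] show ?thesis using True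
        by (simp add: Q_right expansion_mem)
    next
      case False
      then obtain j where j: "i = length us + Suc j" by (metis add_Suc_right less_iff_Suc_add not_le)
      then have "length us + length (take j vs) < length us + length vs" using i by auto
      from less[OF this] show ?thesis using j
        by (simp add: Q_left expansion_mem)
    qed
    show ?thesis
    proof
      fix j
      have "(\<Sum>i\<in>?I. ?t ?z i j) = (\<Sum>i\<in>?I. a *\<^sub>R ?t x i j + b *\<^sub>R ?t y i j)"
        by (rule sum.cong[OF refl]) (simp only: split)
      then show "expansion (us @ ?z # vs) j
          = a *\<^sub>R expansion (us @ x # vs) j + b *\<^sub>R expansion (us @ y # vs) j"
        unfolding rec by (simp only: sum.distrib scaleR_right.sum)
    qed
  qed
qed

text \<open>
  The scalar recursion satisfied by the norms of the coefficients: \<open>C\<^sup>n\<^sup>-\<^sup>1\<close> times the Catalan number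
  counting the bracketings of \<open>n \<ge> 1\<close> factors.
\<close>

function majorant :: "nat \<Rightarrow> real" where
  "majorant n = (if n = 1 then 1 else C * (\<Sum>i\<in>{1..<n}. majorant i * majorant (n - i)))"
  by auto
termination by (relation "Wellfounded.measure id") auto

declare majorant.simps [simp del]

lemma majorant_one: "majorant (Suc 0) = 1"
  by (subst majorant.simps) simp

lemma majorant_rec: "n \<noteq> 1 \<Longrightarrow> majorant n = C * (\<Sum>i\<in>{1..<n}. majorant i * majorant (n - i))"
  by (subst majorant.simps) simp

lemma majorant_nonneg: "0 \<le> majorant n"
proof (induction n rule: less_induct)
  case (less n)
  show ?case
    by (cases "n = 1") (use C_pos less in \<open>auto simp: majorant_one majorant_rec intro!: mult_nonneg_nonneg sum_nonneg\<close>)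
qed

lemma N_expansion_majorant: "N (expansion hs) \<le> majorant (length hs) * prod_list (map norm hs)"
proof (induction hs rule: length_induct)
  case (1 hs)
  show ?case
  proof (cases "length hs = 1")
    case True
    then obtain h where "hs = [h]" by (cases hs) auto
    then show ?thesis by (simp add: expansion_single N_L majorant_one)
  next
    case False
    let ?P = "\<lambda>xs. prod_list (map norm xs)"
    have "N (expansion hs) \<le> (\<Sum>i\<in>{1..<length hs}. N (Q (expansion (take i hs)) (expansion (drop i hs))))"
      unfolding expansion_rec[OF False] by (rule X_sum) (auto intro!: Q_mem expansion_mem)
    also have "\<dots> \<le> (\<Sum>i\<in>{1..<length hs}. C * (majorant i * majorant (length hs - i)) * ?P hs)"
    proof (rule sum_mono)
      fix i assume i: "i \<in> {1..<length hs}"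
      have "N (Q (expansion (take i hs)) (expansion (drop i hs)))
          \<le> C * N (expansion (take i hs)) * N (expansion (drop i hs))"
        by (rule N_Q) (rule expansion_mem)+
      also have "\<dots> \<le> C * (majorant (length (take i hs)) * ?P (take i hs))
          * (majorant (length (drop i hs)) * ?P (drop i hs))"
        using i C_pos 1[rule_format, of "take i hs"] 1[rule_format, of "drop i hs"]
        by (intro mult_mono mult_left_mono)
          (auto intro!: mult_nonneg_nonneg majorant_nonneg prod_list_norm_nonneg N_nonneg expansion_mem)
      also have "\<dots> = C * (majorant i * majorant (length hs - i)) * (?P (take i hs) * ?P (drop i hs))"
        using i by simp
      also have "?P (take i hs) * ?P (drop i hs) = ?P hs"
        by (metis append_take_drop_id map_append prod_list.append)
      finally show "N (Q (expansion (take i hs)) (expansion (drop i hs)))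
          \<le> C * (majorant i * majorant (length hs - i)) * ?P hs" .
    qed
    also have "\<dots> = majorant (length hs) * ?P hs"
      using majorant_rec[OF False] by (simp add: sum_distrib_left sum_distrib_right)
    finally show ?thesis .
  qed
qed

lemma splittings_eq_pairs:
  fixes f :: "nat \<Rightarrow> nat \<Rightarrow> 'c::comm_monoid_add"
  shows "(\<Sum>n\<le>m. \<Sum>i\<in>{1..<n}. f i (n - i)) = (\<Sum>(i, j)\<in>{(i, j). 1 \<le> i \<and> 1 \<le> j \<and> i + j \<le> m}. f i j)"
proof -
  have "(\<Sum>n\<le>m. \<Sum>i\<in>{1..<n}. f i (n - i)) = (\<Sum>(n, i)\<in>(SIGMA n:{..m}. {1..<n}). f i (n - i))"
    by (rule sum.Sigma) auto
  also have "\<dots> = (\<Sum>(i, j)\<in>{(i, j). 1 \<le> i \<and> 1 \<le> j \<and> i + j \<le> m}. f i j)"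
    by (rule sum.reindex_bij_witness[of _ "\<lambda>(i, j). (i + j, i)" "\<lambda>(n, i). (i, n - i)"]) auto
  finally show ?thesis .
qed

text \<open>
  The generating function \<open>b(t)\<close> of the majorants formally satisfies \<open>b = t + C b\<^sup>2\<close>. Its partial sums
  therefore obey \<open>b\<^sub>m\<^sub>+\<^sub>1 \<le> t + C b\<^sub>m\<^sup>2\<close>, and the bound \<open>2 t\<close> reproduces itself when \<open>4 C t \<le> 1\<close>.
  This gives geometric growth of the majorants without a formula for the Catalan numbers.
\<close>

lemma majorant_partial_sums:
  assumes t: "0 \<le> t" "4 * C * t \<le> 1"
  shows "(\<Sum>n\<le>m. majorant n * t ^ n) \<le> 2 * t"
proof (induction m)
  case 0
  then show ?case using t majorant_rec[of 0] by simp
next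
  case (Suc m)
  define b where "b = (\<lambda>n. majorant n * t ^ n)"
  have b0: "0 \<le> b n" for n unfolding b_def using t by (auto intro!: mult_nonneg_nonneg majorant_nonneg)
  have b_rec: "b n \<le> (if n = 1 then t else 0) + C * (\<Sum>i\<in>{1..<n}. b i * b (n - i))" for n
  proof (cases "n = 1")
    case True
    then show ?thesis by (simp add: b_def majorant_one)
  next
    case False
    have *: "(\<Sum>i\<in>{1..<n}. b i * b (n - i)) = (\<Sum>i\<in>{1..<n}. majorant i * majorant (n - i) * t ^ n)"
    proof (rule sum.cong)
      fix i assume "i \<in> {1..<n}"
      then have "t ^ n = t ^ i * t ^ (n - i)" by (simp flip: power_add)
      then show "b i * b (n - i) = majorant i * majorant (n - i) * t ^ n" by (simp add: b_def)
    qed simp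
    have "b n = C * (\<Sum>i\<in>{1..<n}. majorant i * majorant (n - i)) * t ^ n"
      unfolding b_def by (subst majorant_rec[OF False]) simp
    then show ?thesis using False unfolding *
      by (simp add: sum_distrib_right sum_distrib_left mult_ac)
  qed
  let ?I = "{(i, j). 1 \<le> i \<and> 1 \<le> j \<and> i + j \<le> Suc m}"
  have "(\<Sum>n\<le>Suc m. b n) \<le> (\<Sum>n\<le>Suc m. (if n = 1 then t else 0) + C * (\<Sum>i\<in>{1..<n}. b i * b (n - i)))"
    by (rule sum_mono) (rule b_rec)
  also have "\<dots> = t + C * (\<Sum>n\<le>Suc m. \<Sum>i\<in>{1..<n}. b i * b (n - i))"
    by (simp only: sum.distrib sum_distrib_left[symmetric]) simp
  also have "\<dots> = t + C * (\<Sum>(i, j)\<in>?I. b i * b j)"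
    using splittings_eq_pairs[of "\<lambda>i j. b i * b j"] by simp
  also have "\<dots> \<le> t + C * (\<Sum>(i, j)\<in>{..m} \<times> {..m}. b i * b j)"
    using b0 C_pos by (intro add_left_mono mult_left_mono sum_mono2) auto
  also have "\<dots> = t + C * (\<Sum>n\<le>m. b n)\<^sup>2"
    by (simp add: power2_eq_square sum_product sum.cartesian_product)
  also have "\<dots> \<le> t + C * (2 * t)\<^sup>2"
    using Suc b0 C_pos unfolding b_def[symmetric]
    by (intro add_left_mono mult_left_mono power_mono sum_nonneg) auto
  also have "\<dots> = t + (4 * C * t) * t" by (simp add: power2_eq_square)
  also have "\<dots> \<le> t + 1 * t" using t by (intro add_left_mono mult_right_mono) auto
  finally show ?case unfolding b_def by simp
qed

lemma majorant_geometric: "majorant n \<le> 1 / (8 * C) * (16 * C) ^ n"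
proof -
  \<comment> \<open>A quarter of the largest admissible \<open>t\<close>, so that the solutions are within the uniqueness radius
     \<open>1 / (4 * C)\<close>.\<close>
  let ?t = "1 / (16 * C)"
  have t: "0 \<le> ?t" "4 * C * ?t \<le> 1" "0 < ?t" using C_pos by auto
  have "majorant n * ?t ^ n \<le> (\<Sum>k\<le>n. majorant k * ?t ^ k)"
    using t by (intro member_le_sum) (auto intro!: mult_nonneg_nonneg majorant_nonneg)
  also have "\<dots> \<le> 2 * ?t" by (rule majorant_partial_sums[OF t(1,2)])
  finally have "majorant n * ?t ^ n * (16 * C) ^ n \<le> 2 * ?t * (16 * C) ^ n"
    using C_pos by (intro mult_right_mono) auto
  then have "majorant n * (?t * (16 * C)) ^ n \<le> 2 * ?t * (16 * C) ^ n"
    by (simp only: power_mult_distrib mult.assoc)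
  moreover have "?t * (16 * C) = 1" "2 * ?t = 1 / (8 * C)" using C_pos by simp_all
  ultimately show ?thesis by (simp only: power_one mult_1_right)
qed

lemma N_expansion: "N (expansion hs) \<le> 1 / (8 * C) * (16 * C) ^ length hs * prod_list (map norm hs)"
  by (rule order_trans[OF N_expansion_majorant mult_right_mono[OF majorant_geometric prod_list_norm_nonneg]])

lemma expansion_geometric_family:
  "geometric_family (1 / (8 * C)) (16 * C) (\<lambda>hs. expansion hs i)"
  unfolding geometric_family_def
proof (intro conjI allI)
  show "multilinear (\<lambda>hs. expansion hs i)"
    unfolding multilinear_def by (simp add: expansion_comb)
  show "norm (expansion hs i) \<le> 1 / (8 * C) * (16 * C) ^ length hs * prod_list (map norm hs)" for hs
    by (rule order_trans[OF norm_le_N[OF expansion_mem] N_expansion])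
qed (use C_pos in auto)

definition solution :: "'a \<Rightarrow> 'i \<Rightarrow> 'b" where
  "solution h = (\<lambda>i. power_sum (\<lambda>hs. expansion hs i) h)"

lemma N_expansion_power:
  assumes "norm h \<le> 1 / (32 * C)"
  shows "N (expansion (replicate n h)) \<le> 1 / (8 * C) * (1/2) ^ n"
proof -
  have "N (expansion (replicate n h)) \<le> 1 / (8 * C) * (16 * C) ^ n * norm h ^ n"
    using N_expansion[of "replicate n h"] by simp
  also have "\<dots> = 1 / (8 * C) * (16 * C * norm h) ^ n" by (simp add: power_mult_distrib)
  also have "\<dots> \<le> 1 / (8 * C) * (1/2) ^ n"
    using assms C_pos by (intro mult_left_mono power_mono) (auto simp: field_simps)
  finally show ?thesis .
qed

lemma geometric_half_sums: "(\<lambda>n. 1 / (8 * C) * (1/2) ^ (n + m)) sums (1 / (4 * C) * (1/2) ^ m)"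
proof -
  have "(\<lambda>n. (1/2::real) ^ n) sums 2" using geometric_sums[of "1/2::real"] by simp
  from sums_mult[OF this, of "1 / (8 * C) * (1/2) ^ m"]
  have "(\<lambda>n. 1 / (8 * C) * (1/2) ^ m * (1/2) ^ n) sums (1 / (8 * C) * (1/2) ^ m * 2)" .
  moreover have "1 / (8 * C) * (1/2) ^ m * (1/2) ^ n = 1 / (8 * C) * (1/2) ^ (n + m)" for n
    by (simp only: power_add mult.assoc mult.commute[of "(1/2) ^ m"])
  moreover have "1 / (8 * C) * y * 2 = 1 / (4 * C) * y" for y by simp
  ultimately show ?thesis by (simp only:)
qed

lemma solution_mem:
  assumes "norm h \<le> 1 / (32 * C)"
  shows "solution h \<in> X" "N (solution h) \<le> 1 / (4 * C)"
proof -
  have s: "(\<lambda>n. 1 / (8 * C) * (1/2) ^ n) sums (1 / (4 * C))"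
    using geometric_half_sums[of 0] by (simp only: add_0_right power_0 mult_1_right)
  have "(\<lambda>i. \<Sum>n. expansion (replicate n h) i) \<in> X
      \<and> N (\<lambda>i. \<Sum>n. expansion (replicate n h) i) \<le> (\<Sum>n. 1 / (8 * C) * (1/2) ^ n)"
  proof (rule X_complete)
    show "expansion (replicate n h) \<in> X" for n by (rule expansion_mem)
    show "N (expansion (replicate n h)) \<le> 1 / (8 * C) * (1/2) ^ n" for n
      by (rule N_expansion_power[OF assms])
  qed (rule sums_summable[OF s])
  then have "solution h \<in> X \<and> N (solution h) \<le> 1 / (4 * C)"
    unfolding solution_def power_sum_def sums_unique[OF s, symmetric] .
  then show "solution h \<in> X" "N (solution h) \<le> 1 / (4 * C)" by blast+
qed

text \<open>
  The partial sum \<open>s\<^sub>m\<close> of the series up to degree \<open>m\<close> fails to solve the equation only by the terms of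
  \<open>Q(s\<^sub>m, s\<^sub>m)\<close> of degree above \<open>m\<close>. These are at most \<open>(m + 1)\<^sup>2\<close> terms of geometrically small size, so
  the defect tends to zero, while \<open>s\<^sub>m\<close> tends to the solution and \<open>Q\<close> is continuous.
\<close>

lemma solution_fixed_point:
  assumes h: "norm h \<le> 1 / (32 * C)"
  shows "solution h = (\<lambda>i. L h i + Q (solution h) (solution h) i)"
proof (rule ext)
  fix i
  define E where "E n = expansion (replicate n h)" for n
  define s where "s m = (\<lambda>i. \<Sum>n\<le>m. E n i)" for m
  note sol = solution_mem[OF h]
  have E: "E n \<in> X" for n unfolding E_def by (rule expansion_mem)
  have s: "s m \<in> X" for m unfolding s_def by (rule X_sum) (auto simp: E)
  have N_E: "N (E n) \<le> 1 / (8 * C) * (1/2) ^ n" for n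
    unfolding E_def by (rule N_expansion_power[OF h])
  have summ: "summable (\<lambda>n. E n j)" for j
  proof (rule summable_comparison_test')
    show "summable (\<lambda>n. 1 / (8 * C) * (1/2) ^ n)"
      using sums_summable[OF geometric_half_sums[of 0]] by (simp only: add_0_right)
    show "norm (E n j) \<le> 1 / (8 * C) * (1/2) ^ n" for n
      by (rule order_trans[OF norm_le_N[OF E] N_E])
  qed
  have sol_eq: "solution h = (\<lambda>j. \<Sum>n. E n j)"
    unfolding solution_def power_sum_def E_def ..
  have tail: "N (\<lambda>j. solution h j - s m j) \<le> 1 / (4 * C) * (1/2) ^ Suc m" for m
  proof -
    have "solution h j - s m j = (\<Sum>n. E (n + Suc m) j)" for j
      unfolding sol_eq s_def using suminf_minus_initial_segment[OF summ[of j], of "Suc m"]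
      by (simp add: lessThan_Suc_atMost)
    then have "(\<lambda>j. solution h j - s m j) = (\<lambda>j. \<Sum>n. E (n + Suc m) j)" by (rule ext)
    moreover have "(\<lambda>j. \<Sum>n. E (n + Suc m) j) \<in> X
      \<and> N (\<lambda>j. \<Sum>n. E (n + Suc m) j) \<le> (\<Sum>n. 1 / (8 * C) * (1/2) ^ (n + Suc m))"
    proof (rule X_complete)
      show "E (n + Suc m) \<in> X" for n by (rule E)
      show "N (E (n + Suc m)) \<le> 1 / (8 * C) * (1/2) ^ (n + Suc m)" for n by (rule N_E)
    qed (rule sums_summable[OF geometric_half_sums])
    ultimately show ?thesis
      unfolding sums_unique[OF geometric_half_sums, symmetric] by (simp only:)
  qed
  have N_s: "N (s m) \<le> 1 / (2 * C)" for m
  proof -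
    have "s m = (\<lambda>j. solution h j + (- 1) *\<^sub>R (solution h j - s m j))" by simp
    moreover have "N \<dots> \<le> N (solution h) + N (\<lambda>j. (- 1) *\<^sub>R (solution h j - s m j))"
      using X_comb[OF X_diff[OF sol(1) s[of m]] X_zero, of "-1" 0]
      by (intro N_triangle sol) simp
    moreover have "N (\<lambda>j. (- 1) *\<^sub>R (solution h j - s m j)) \<le> N (\<lambda>j. solution h j - s m j)"
      using N_scale[OF X_diff[OF sol(1) s[of m]], of "-1"] by simp
    moreover have "1 / (4 * C) * (1/2) ^ Suc m \<le> 1 / (4 * C) * 1"
      using C_pos by (intro mult_left_mono power_le_one) auto
    ultimately show ?thesis using sol(2) tail[of m] by simp
  qed
  have residual: "norm (L h i + Q (s m) (s m) i - s m i)
      \<le> real ((Suc m)\<^sup>2) * (1 / (64 * C) * (1/2) ^ m)" if "0 < m" for m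
  proof -
    let ?I = "{(i, j). 1 \<le> i \<and> 1 \<le> j \<and> i + j \<le> m}" and ?S = "{..m} \<times> {..m}"
    have rec: "E n i = (if n = 1 then L h i else 0) + (\<Sum>k\<in>{1..<n}. Q (E k) (E (n - k)) i)" for n
    proof (cases "n = 1")
      case True
      then show ?thesis by (simp add: E_def expansion_single)
    next
      case False
      have "E n = (\<lambda>j. \<Sum>k\<in>{1..<n}. Q (E k) (E (n - k)) j)"
        unfolding E_def using False by (subst expansion_rec) (auto simp: min_def)
      then show ?thesis using False by simp
    qed
    \<comment> \<open>A product of two terms that does not occur in the expansion up to degree \<open>m\<close>: either a factor of
       degree zero, which vanishes, or total degree above \<open>m\<close>.\<close>
    have QE: "norm (Q (E k) (E l) i) \<le> 1 / (64 * C) * (1/2) ^ m" if kl: "(k, l) \<in> ?S - ?I" for k l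
    proof (cases "k = 0 \<or> l = 0")
      case True
      then have "Q (E k) (E l) i = 0"
        using Q_zero_left[OF E] Q_zero_right[OF E] by (auto simp: E_def expansion_Nil)
      then show ?thesis using C_pos by simp
    next
      case False
      have "norm (Q (E k) (E l) i) \<le> C * N (E k) * N (E l)"
        by (rule order_trans[OF norm_le_N[OF Q_mem[OF E E]] N_Q[OF E E]])
      also have "\<dots> \<le> C * (1 / (8 * C) * (1/2) ^ k) * (1 / (8 * C) * (1/2) ^ l)"
        using C_pos by (intro mult_mono mult_left_mono N_E) (auto intro!: N_nonneg E)
      also have "\<dots> = 1 / (64 * C) * (1/2) ^ (k + l)" using C_pos by (simp add: power_add)
      also have "\<dots> \<le> 1 / (64 * C) * (1/2) ^ m"
        using kl False C_pos by (intro mult_left_mono power_decreasing) auto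
      finally show ?thesis .
    qed
      have fin: "finite ?I" by (rule finite_subset[of _ "{..m} \<times> {..m}"]) auto
      have "s m i = L h i + (\<Sum>n\<le>m. \<Sum>k\<in>{1..<n}. Q (E k) (E (n - k)) i)"
        unfolding s_def using that by (subst rec) (simp add: sum.distrib)
      also have "\<dots> = L h i + (\<Sum>(k, l)\<in>?I. Q (E k) (E l) i)"
        using splittings_eq_pairs[of "\<lambda>k l. Q (E k) (E l) i"] by simp
      finally have 1: "s m i = L h i + (\<Sum>(k, l)\<in>?I. Q (E k) (E l) i)" .
      have "Q (s m) (s m) = (\<lambda>j. \<Sum>k\<le>m. Q (E k) (s m) j)"
        by (subst (1) s_def, subst Q_sum_left) (auto simp: E s)
      also have "\<dots> = (\<lambda>j. \<Sum>k\<le>m. \<Sum>l\<le>m. Q (E k) (E l) j)"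
        by (subst s_def, subst Q_sum_right) (auto simp: E)
      finally have "Q (s m) (s m) i = (\<Sum>(k, l)\<in>?S. Q (E k) (E l) i)"
        by (simp add: sum.cartesian_product)
      then have "L h i + Q (s m) (s m) i - s m i = (\<Sum>(k, l)\<in>?S - ?I. Q (E k) (E l) i)"
        unfolding 1 by (subst sum_diff) auto
      also have "norm \<dots> \<le> (\<Sum>(k, l)\<in>?S - ?I. 1 / (64 * C) * (1/2) ^ m)"
        by (rule sum_norm_le) (use QE in auto)
      also have "\<dots> \<le> (\<Sum>(k, l)\<in>?S. 1 / (64 * C) * (1/2) ^ m)"
        using C_pos by (intro sum_mono2) auto
      also have "\<dots> = real ((Suc m)\<^sup>2) * (1 / (64 * C) * (1/2) ^ m)"
        by (simp add: power2_eq_square)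
      finally show ?thesis .
  qed
  have lim_res: "(\<lambda>m. L h i + Q (s m) (s m) i - s m i) \<longlonglongrightarrow> 0"
  proof (rule Lim_null_comparison)
    show "\<forall>\<^sub>F m in sequentially. norm (L h i + Q (s m) (s m) i - s m i)
        \<le> real ((Suc m)\<^sup>2) * (1 / (64 * C) * (1/2) ^ m)"
      using residual by (auto simp: eventually_sequentially intro!: exI[of _ 1])
    have "(\<lambda>m. (1 / (64 * C)) * (real ((Suc m)\<^sup>2) * (1/2) ^ m)) \<longlonglongrightarrow> (1 / (64 * C)) * 0"
      by (intro tendsto_mult_left) real_asymp
    then show "(\<lambda>m. real ((Suc m)\<^sup>2) * (1 / (64 * C) * (1/2) ^ m)) \<longlonglongrightarrow> 0"
      by (simp add: mult_ac)
  qed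
  have half: "(\<lambda>m. c * (1/2) ^ Suc m) \<longlonglongrightarrow> 0" for c :: real by real_asymp
  have lim_s: "(\<lambda>m. s m i) \<longlonglongrightarrow> solution h i"
    using summ[of i] unfolding sol_eq s_def by (simp add: summable_LIMSEQ')
  have lim_Q: "(\<lambda>m. Q (s m) (s m) i) \<longlonglongrightarrow> Q (solution h) (solution h) i"
  proof (rule Lim_transform2[OF tendsto_const], rule Lim_null_comparison)
    show "\<forall>\<^sub>F m in sequentially. norm (Q (solution h) (solution h) i - Q (s m) (s m) i)
        \<le> C * (1 / (4 * C)) * (1 / (4 * C) + 1 / (2 * C)) * (1/2) ^ Suc m"
    proof (rule always_eventually, rule allI)
      fix m
      have "norm (Q (solution h) (solution h) i - Q (s m) (s m) i)
          \<le> N (\<lambda>i. Q (solution h) (solution h) i - Q (s m) (s m) i)"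
        by (rule norm_le_N[OF X_diff[OF Q_mem Q_mem]]) (rule sol s)+
      also have "\<dots> \<le> C * N (\<lambda>j. solution h j - s m j) * (N (solution h) + N (s m))"
        by (rule Q_square_diff[OF sol(1) s])
      also have "\<dots> \<le> C * (1 / (4 * C) * (1/2) ^ Suc m) * (1 / (4 * C) + 1 / (2 * C))"
        using C_pos N_nonneg[OF sol(1)] N_nonneg[OF s[of m]] tail[of m]
        by (intro mult_mono mult_left_mono add_mono sol N_s) auto
      finally show "norm (Q (solution h) (solution h) i - Q (s m) (s m) i)
        \<le> C * (1 / (4 * C)) * (1 / (4 * C) + 1 / (2 * C)) * (1/2) ^ Suc m" by (simp only: mult_ac)
    qed
  qed (rule half)
  have "(\<lambda>m. L h i + Q (s m) (s m) i - s m i)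
      \<longlonglongrightarrow> L h i + Q (solution h) (solution h) i - solution h i"
    by (intro tendsto_intros lim_s lim_Q)
  from LIMSEQ_unique[OF this lim_res]
  show "solution h i = L h i + Q (solution h) (solution h) i" by simp
qed

end

section \<open>Essential suprema and supports of square-integrable functions\<close>

lemma ennreal_power2_le_imp_le:
  fixes a b :: ennreal
  assumes "a\<^sup>2 \<le> b\<^sup>2"
  shows "a \<le> b"
proof (cases a b rule: ennreal2_cases)
  case (real_real r q)
  then show ?thesis using assms
    by (auto simp: ennreal_power power_mono_iff)
next
  case (top_real r)
  then show ?thesis using assms by (auto simp: ennreal_power top_power_ennreal top_unique)
qed auto

text \<open>
  The sets \<open>S\<^sup>2 \<ge> 1 / n\<close> have finite measure by Markov's inequality and exhaust the support of \<open>S\<close>.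
  Restricting the measure by a density keeps the sigma-algebra unchanged.
\<close>

lemma sigma_finite_support:
  fixes S :: "'l \<Rightarrow> real"
  assumes [measurable]: "S \<in> borel_measurable M" and fin: "(\<integral>\<^sup>+l. ennreal ((S l)\<^sup>2) \<partial>M) < \<infinity>"
  shows "sigma_finite_measure (density M (indicator {l\<in>space M. S l \<noteq> 0}))"
proof
  define Z where "Z = {l\<in>space M. S l = 0}"
  define B where "B = (\<lambda>n::nat. {l\<in>space M. 1 \<le> of_nat n * ennreal ((S l)\<^sup>2)})"
  let ?D = "density M (indicator {l\<in>space M. S l \<noteq> 0})"
  have [measurable]: "Z \<in> sets M" "\<And>n. B n \<in> sets M" unfolding Z_def B_def by measurable
  have "emeasure ?D (B n) \<noteq> \<infinity>" for n
  proof -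
    have "emeasure ?D (B n) \<le> (\<integral>\<^sup>+ l. indicator (B n) l \<partial>M)"
      by (subst emeasure_density, measurable) (rule nn_integral_mono, simp add: indicator_def)
    also have "\<dots> \<le> (\<integral>\<^sup>+ l. of_nat n * ennreal ((S l)\<^sup>2) \<partial>M)"
      by (intro nn_integral_mono) (auto simp: B_def indicator_def)
    also have "\<dots> = of_nat n * (\<integral>\<^sup>+ l. ennreal ((S l)\<^sup>2) \<partial>M)"
      by (rule nn_integral_cmult) measurable
    also have "\<dots> < \<infinity>" using fin by (simp add: ennreal_mult_less_top of_nat_less_top)
    finally show ?thesis by simp
  qed
  moreover have "emeasure ?D Z \<noteq> \<infinity>"
  proof -
    have "emeasure ?D Z = (\<integral>\<^sup>+ l. 0 \<partial>M)"
      by (subst emeasure_density, measurable) (rule nn_integral_cong, simp add: indicator_def Z_def)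
    then show ?thesis by simp
  qed
  moreover have "space M \<subseteq> Z \<union> (\<Union>n. B n)"
  proof
    fix l assume l: "l \<in> space M"
    show "l \<in> Z \<union> (\<Union>n. B n)"
    proof (cases "S l = 0")
      case False
      obtain n :: nat where "1 / (S l)\<^sup>2 \<le> real n" using real_arch_simple by blast
      then have "1 \<le> real n * (S l)\<^sup>2" using False by (simp add: divide_le_eq)
      then have "ennreal 1 \<le> ennreal (real n * (S l)\<^sup>2)" by (rule ennreal_leI)
      then have "l \<in> B n" using l by (simp add: B_def ennreal_mult ennreal_of_nat_eq_real_of_nat)
      then show ?thesis by auto
    qed (use l in \<open>auto simp: Z_def\<close>)
  qed
  ultimately show "\<exists>A. countable A \<and> A \<subseteq> sets ?D \<and> \<Union> A = space ?D \<and> (\<forall>a\<in>A. emeasure ?D a \<noteq> \<infinity>)"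
    by (intro exI[of _ "insert Z (range B)"]) (auto simp: Z_def B_def)
qed

lemma AE_le_of_maximal_nn_integral:
  fixes f g :: "'l \<Rightarrow> ennreal"
  assumes [measurable]: "f \<in> borel_measurable M" "g \<in> borel_measurable M"
    and le: "\<And>l. g l \<le> f l" and int: "integral\<^sup>N M f \<le> integral\<^sup>N M g" and fin: "integral\<^sup>N M g < \<infinity>"
  shows "AE l in M. f l \<le> g l"
proof -
  have "(\<integral>\<^sup>+ l. f l - g l \<partial>M) = integral\<^sup>N M f - integral\<^sup>N M g"
    using fin le by (intro nn_integral_diff) auto
  also have "\<dots> = 0" using int fin by (intro diff_eq_0_ennreal) (auto simp: less_top)
  finally have "AE l in M. f l - g l = 0" by (subst (asm) nn_integral_0_iff_AE) auto
  then show ?thesis by eventually_elim (simp add: diff_eq_0_iff_ennreal)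
qed

text \<open>
  Among the countable subsets of \<open>I\<close>, choose one, \<open>A\<close>, for which the integral of the squared supremum
  is maximal; the union of a maximizing sequence does it. Adding any further \<open>x\<close> to \<open>A\<close> cannot increase
  the integral, which is finite, hence does not increase the supremum except on a null set.
\<close>

lemma countable_essential_supremum:
  fixes U :: "real \<Rightarrow> 'l \<Rightarrow> ennreal"
  assumes U: "\<And>x. x \<in> I \<Longrightarrow> U x \<in> borel_measurable M"
    and dom: "\<And>A. countable A \<Longrightarrow> A \<subseteq> I \<Longrightarrow> (\<integral>\<^sup>+l. (SUP x\<in>A. U x l)\<^sup>2 \<partial>M) \<le> c" and c: "c < \<infinity>"
  obtains A where "countable A" "A \<subseteq> I" "\<And>x. x \<in> I \<Longrightarrow> AE l in M. U x l \<le> (SUP y\<in>A. U y l)"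
proof -
  let ?G = "\<lambda>A l. (SUP x\<in>A. U x l)\<^sup>2"
  let ?\<Phi> = "\<lambda>A. \<integral>\<^sup>+l. ?G A l \<partial>M"
  let ?\<A> = "{A. countable A \<and> A \<subseteq> I}"
  have meas: "?G A \<in> borel_measurable M" if "A \<in> ?\<A>" for A
  proof -
    have [measurable]: "(\<lambda>l. SUP x\<in>A. U x l) \<in> borel_measurable M"
      using that U by (intro borel_measurable_SUP) auto
    show ?thesis by measurable
  qed
  have "?\<A> \<noteq> {}" by auto
  then obtain f :: "nat \<Rightarrow> ennreal" where f: "range f \<subseteq> ?\<Phi> ` ?\<A>" "Sup (?\<Phi> ` ?\<A>) = Sup (range f)"
    using ennreal_SUP_countable_SUP[of ?\<A> ?\<Phi>] by blast
  have "\<forall>n. \<exists>A. A \<in> ?\<A> \<and> f n = ?\<Phi> A"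
  proof
    fix n
    have "f n \<in> ?\<Phi> ` ?\<A>" using f(1) by (rule subsetD) (rule rangeI)
    then show "\<exists>A. A \<in> ?\<A> \<and> f n = ?\<Phi> A" by (elim imageE) (intro exI conjI)
  qed
  from choice[OF this] obtain A where "\<forall>n. A n \<in> ?\<A> \<and> f n = ?\<Phi> (A n)" by (elim exE)
  then have A: "\<And>n. A n \<in> ?\<A>" "\<And>n. f n = ?\<Phi> (A n)" by (simp_all only:)
  let ?T = "\<Union>n. A n"
  have T: "?T \<in> ?\<A>" using A(1) by auto
  have mono: "?G B l \<le> ?G B' l" if "B \<subseteq> B'" for B B' l
    using that by (intro power_mono SUP_subset_mono) auto
  have max: "?\<Phi> B \<le> ?\<Phi> ?T" if "B \<in> ?\<A>" for B
  proof -
    have "?\<Phi> B \<le> Sup (?\<Phi> ` ?\<A>)" using that by (rule SUP_upper)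
    also have "\<dots> \<le> ?\<Phi> ?T" unfolding f(2) using A(2)
      by (intro SUP_least) (auto intro!: nn_integral_mono mono)
    finally show ?thesis .
  qed
  show thesis
  proof
    show "countable ?T" "?T \<subseteq> I" using T by auto
    fix x assume x: "x \<in> I"
    have xT: "insert x ?T \<in> ?\<A>" using x T by auto
    have "AE l in M. ?G (insert x ?T) l \<le> ?G ?T l"
      using order_le_less_trans[OF dom c] T
      by (intro AE_le_of_maximal_nn_integral meas xT T max mono) auto
    then show "AE l in M. U x l \<le> (SUP y\<in>?T. U y l)"
    proof eventually_elim
      case (elim l)
      then have "(SUP y\<in>insert x ?T. U y l) \<le> (SUP y\<in>?T. U y l)" by (rule ennreal_power2_le_imp_le)
      then show ?case by (auto intro: order_trans SUP_upper)
    qed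
  qed
qed

text \<open>
  The coordinates and the multiplier of a spectral representation, without the operator that they
  represent.
\<close>

section \<open>Spectral coordinates\<close>

locale spectral_space =
  fixes M :: "'l measure" and co :: "'h::{real_inner,banach} \<Rightarrow> 'l \<Rightarrow> real" and \<gamma> :: "'l \<Rightarrow> real"
  assumes \<gamma>_meas [measurable]: "\<gamma> \<in> borel_measurable M"
    and co_meas [measurable]: "\<And>u. co u \<in> borel_measurable M"
    and co_integrable: "\<And>u. integrable M (\<lambda>l. (co u l)\<^sup>2)"
    and norm_co: "\<And>u. (norm u)\<^sup>2 = (\<integral>l. (co u l)\<^sup>2 \<partial>M)"
    and co_add: "\<And>u v. AE l in M. co (u + v) l = co u l + co v l"
    and co_scale: "\<And>c u. AE l in M. co (c *\<^sub>R u) l = c * co u l"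
    and co_surj: "\<And>f. f \<in> borel_measurable M \<Longrightarrow> integrable M (\<lambda>l. (f l)\<^sup>2) \<Longrightarrow>
                    \<exists>u. AE l in M. co u l = f l"

lemma spectral_spaceI:
  assumes "spectral_representation M co \<gamma> \<Gamma>"
  shows "spectral_space M co \<gamma>"
  using assms unfolding spectral_representation_def spectral_space_def by blast

context spectral_space
begin

lemma co_comb: "AE l in M. co (a *\<^sub>R u + b *\<^sub>R v) l = a * co u l + b * co v l"
  using co_add[of "a *\<^sub>R u" "b *\<^sub>R v"] co_scale[of a u] co_scale[of b v]
  by eventually_elim simp

lemma co_diff: "AE l in M. co (u - v) l = co u l - co v l"
  using co_comb[of 1 u "-1" v] by simp

lemma nn_integral_co: "(\<integral>\<^sup>+l. ennreal ((co u l)\<^sup>2) \<partial>M) = ennreal ((norm u)\<^sup>2)"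
  using nn_integral_eq_integral[OF co_integrable, of u] norm_co[of u] by simp

lemma nn_integral_eq_norm:
  assumes "AE l in M. co u l = f l"
  shows "(\<integral>\<^sup>+l. ennreal ((f l)\<^sup>2) \<partial>M) = ennreal ((norm u)\<^sup>2)"
proof -
  have "(\<integral>\<^sup>+l. ennreal ((f l)\<^sup>2) \<partial>M) = (\<integral>\<^sup>+l. ennreal ((co u l)\<^sup>2) \<partial>M)"
    using assms by (intro nn_integral_cong_AE) (auto elim: eventually_mono)
  then show ?thesis by (simp add: nn_integral_co)
qed

lemma norm_le_of_AE:
  assumes "AE l in M. co u l = f l" "(\<integral>\<^sup>+l. ennreal ((f l)\<^sup>2) \<partial>M) \<le> ennreal (c\<^sup>2)" "0 \<le> c"
  shows "norm u \<le> c"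
proof -
  have "ennreal ((norm u)\<^sup>2) \<le> ennreal (c\<^sup>2)" using assms(2) nn_integral_eq_norm[OF assms(1)] by simp
  then have "(norm u)\<^sup>2 \<le> c\<^sup>2" by (simp add: ennreal_le_iff)
  then show ?thesis using assms(3) by (rule power2_le_imp_le)
qed

lemma ex_element:
  assumes [measurable]: "f \<in> borel_measurable M" and le: "(\<integral>\<^sup>+l. ennreal ((f l)\<^sup>2) \<partial>M) \<le> ennreal (c\<^sup>2)" "0 \<le> c"
  obtains u where "AE l in M. co u l = f l" "norm u \<le> c"
proof -
  have "integrable M (\<lambda>l. (f l)\<^sup>2)"
    using le by (intro integrableI_nonneg) (auto intro: le_less_trans)
  then obtain u where "AE l in M. co u l = f l" using co_surj[of f] by auto
  then show thesis using norm_le_of_AE[OF _ le] that by blast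
qed

lemma co_inj:
  assumes "AE l in M. co u l = co v l"
  shows "u = v"
proof -
  have "AE l in M. co (u - v) l = 0"
    using assms co_diff[of u v] by eventually_elim simp
  then have "norm (u - v) \<le> 0" by (rule norm_le_of_AE) auto
  then show ?thesis by simp
qed

lemma of_coords_eq:
  assumes "AE l in M. co h l = f l"
  shows "of_coords M co f = h"
  unfolding of_coords_def
proof (rule the_equality)
  show "AE l in M. co h l = f l" by (rule assms)
next
  fix h' assume "AE l in M. co h' l = f l"
  then have "AE l in M. co h' l = co h l" using assms by eventually_elim simp
  then show "h' = h" by (rule co_inj)
qed

text \<open>
  Polarization: where one of the two coordinates vanishes, \<open>(a + b)\<^sup>2 = (a - b)\<^sup>2\<close>, so
  \<open>u + v\<close> and \<open>u - v\<close> have the same norm.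
\<close>

lemma inner_eq_0:
  assumes "AE l in M. co u l * co v l = 0"
  shows "inner u v = 0"
proof -
  have "AE l in M. (co (u + v) l)\<^sup>2 = (co (u - v) l)\<^sup>2"
    using assms co_add[of u v] co_diff[of u v]
  proof eventually_elim
    case (elim l)
    have "(co u l + co v l)\<^sup>2 = (co u l - co v l)\<^sup>2 + 4 * (co u l * co v l)"
      by (simp add: power2_eq_square algebra_simps)
    then show ?case using elim by simp
  qed
  then have "(\<integral>\<^sup>+l. ennreal ((co (u + v) l)\<^sup>2) \<partial>M) = (\<integral>\<^sup>+l. ennreal ((co (u - v) l)\<^sup>2) \<partial>M)"
    by (intro nn_integral_cong_AE) (auto elim: eventually_mono)
  then have "ennreal ((norm (u + v))\<^sup>2) = ennreal ((norm (u - v))\<^sup>2)"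
    by (simp only: nn_integral_co)
  then have "(norm (u + v))\<^sup>2 = (norm (u - v))\<^sup>2" by simp
  then show ?thesis by (simp add: power2_norm_eq_inner inner_add inner_diff inner_commute algebra_simps)
qed

text \<open>
  A jointly measurable choice \<open>U\<close> of the coordinates of \<open>u\<close> together with a square-integrable bound \<open>S\<close>,
  of norm at most \<open>c\<close>, that holds for all \<open>x \<ge> 0\<close> simultaneously. In contrast to the
  versions in the definition of the reverse norm, the supremum of \<open>U\<close> over \<open>x\<close> is not required
  to be measurable. This makes the notion stable under sums, translations and integration, while
  it still determines the reverse norm: \<open>majorized_imp_reverse_space\<close> and \<open>reverse_space_majorized\<close>.
\<close>

definition majorized :: "(real \<Rightarrow> 'h) \<Rightarrow> (real \<Rightarrow> 'l \<Rightarrow> real) \<Rightarrow> ('l \<Rightarrow> real) \<Rightarrow> real \<Rightarrow> bool" where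
  "majorized u U S c \<longleftrightarrow> 0 \<le> c \<and> S \<in> borel_measurable M \<and>
     (\<integral>\<^sup>+l. ennreal ((S l)\<^sup>2) \<partial>M) \<le> ennreal (c\<^sup>2) \<and>
     (\<lambda>(x, l). U x l) \<in> borel_measurable (borel \<Otimes>\<^sub>M M) \<and>
     (\<forall>x\<ge>0. \<forall>l\<in>space M. \<bar>U x l\<bar> \<le> S l) \<and>
     (\<forall>x\<ge>0. AE l in M. U x l = co (u x) l)"

lemma majorizedD:
  assumes "majorized u U S c"
  shows "0 \<le> c" "S \<in> borel_measurable M" "(\<integral>\<^sup>+l. ennreal ((S l)\<^sup>2) \<partial>M) \<le> ennreal (c\<^sup>2)"
    "(\<lambda>(x, l). U x l) \<in> borel_measurable (borel \<Otimes>\<^sub>M M)"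
    "\<And>x l. 0 \<le> x \<Longrightarrow> l \<in> space M \<Longrightarrow> \<bar>U x l\<bar> \<le> S l"
    "\<And>x. 0 \<le> x \<Longrightarrow> AE l in M. U x l = co (u x) l"
    "\<And>l. l \<in> space M \<Longrightarrow> 0 \<le> S l"
proof -
  show *: "\<And>x l. 0 \<le> x \<Longrightarrow> l \<in> space M \<Longrightarrow> \<bar>U x l\<bar> \<le> S l"
    using assms unfolding majorized_def by blast
  show "\<And>l. l \<in> space M \<Longrightarrow> 0 \<le> S l" using *[of 0] abs_ge_zero order_trans by blast
qed (use assms in \<open>auto simp: majorized_def\<close>)

text \<open>
  Let \<open>G\<close> be the supremum of \<open>\<bar>U x\<bar>\<close> over a countable set of \<open>x\<close> that is an essential supremum over all
  \<open>x \<ge> 0\<close>. Replacing \<open>U x l\<close> by zero where its modulus exceeds \<open>G l\<close> changes it, for each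
  single \<open>x\<close>, only on a null set. The supremum over all \<open>x\<close> of the new function is exactly \<open>G\<close>,
  which is measurable as a countable supremum.
\<close>

lemma majorized_imp_reverse_norm_sq_le:
  assumes "majorized u U S c"
  shows "reverse_norm_sq M co u \<le> ennreal (c\<^sup>2)"
proof -
  note m = majorizedD[OF assms]
  note [measurable] = m(2,4)
  have Ux: "U x \<in> borel_measurable M" for x by measurable
  have dom: "(\<integral>\<^sup>+l. (SUP x\<in>A. ennreal \<bar>U x l\<bar>)\<^sup>2 \<partial>M) \<le> ennreal (c\<^sup>2)" if "A \<subseteq> {0..}" for A
  proof -
    have "(SUP x\<in>A. ennreal \<bar>U x l\<bar>) \<le> ennreal (S l)" if "l \<in> space M" for l
      using m(5) \<open>A \<subseteq> {0..}\<close> that by (intro SUP_least ennreal_leI) auto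
    then have "(\<integral>\<^sup>+l. (SUP x\<in>A. ennreal \<bar>U x l\<bar>)\<^sup>2 \<partial>M) \<le> (\<integral>\<^sup>+l. (ennreal (S l))\<^sup>2 \<partial>M)"
      by (intro nn_integral_mono power_mono) auto
    also have "\<dots> = (\<integral>\<^sup>+l. ennreal ((S l)\<^sup>2) \<partial>M)"
      using m(7) by (intro nn_integral_cong) (simp add: ennreal_power)
    finally show ?thesis using m(3) by simp
  qed
  obtain A where A: "countable A" "A \<subseteq> {0..}"
    "\<And>x. x \<in> {0..} \<Longrightarrow> AE l in M. ennreal \<bar>U x l\<bar> \<le> (SUP y\<in>A. ennreal \<bar>U y l\<bar>)"
    by (rule countable_essential_supremum[of "{0..}" "\<lambda>x l. ennreal \<bar>U x l\<bar>" M "ennreal (c\<^sup>2)"])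
       (use dom in auto)
  define G where "G l = (SUP y\<in>A. ennreal \<bar>U y l\<bar>)" for l
  have [measurable]: "G \<in> borel_measurable M"
    unfolding G_def using A(1) by (intro borel_measurable_SUP) auto
  define W where "W x l = (if ennreal \<bar>U x l\<bar> \<le> G l then U x l else 0)" for x l
  have W_meas [measurable]: "(\<lambda>(x, l). W x l) \<in> borel_measurable (borel \<Otimes>\<^sub>M M)"
    unfolding W_def by measurable
  have sup: "(SUP x\<in>{0..}. ennreal \<bar>W x l\<bar>) = G l" for l
  proof (rule antisym)
    show "(SUP x\<in>{0..}. ennreal \<bar>W x l\<bar>) \<le> G l"
      by (intro SUP_least) (auto simp: W_def)
    show "G l \<le> (SUP x\<in>{0..}. ennreal \<bar>W x l\<bar>)"
      unfolding G_def
    proof (rule SUP_least)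
      fix x assume x: "x \<in> A"
      then have "ennreal \<bar>U x l\<bar> \<le> G l" unfolding G_def by (rule SUP_upper)
      then have "ennreal \<bar>U x l\<bar> = ennreal \<bar>W x l\<bar>" by (simp add: W_def)
      also have "\<dots> \<le> (SUP x\<in>{0..}. ennreal \<bar>W x l\<bar>)" using x A(2) by (intro SUP_upper) auto
      finally show "ennreal \<bar>U x l\<bar> \<le> (SUP x\<in>{0..}. ennreal \<bar>W x l\<bar>)" .
    qed
  qed
  have "W \<in> coord_versions M co u"
    unfolding coord_versions_def
  proof (intro CollectI conjI allI impI)
    have "(\<lambda>x. x) \<in> restrict_space borel {0..} \<rightarrow>\<^sub>M (borel :: real measure)"
      by (intro measurable_restrict_space1) simp
    then have "(\<lambda>p. (fst p, snd p)) \<in> restrict_space borel {0..} \<Otimes>\<^sub>M M \<rightarrow>\<^sub>M (borel :: real measure) \<Otimes>\<^sub>M M"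
      by (intro measurable_Pair measurable_compose[OF measurable_fst] measurable_snd)
    then have "(\<lambda>p. case (fst p, snd p) of (x, l) \<Rightarrow> W x l) \<in> borel_measurable (restrict_space borel {0..} \<Otimes>\<^sub>M M)"
      by (rule measurable_compose) (rule W_meas)
    then show "(\<lambda>(x, l). W x l) \<in> borel_measurable (restrict_space borel {0..} \<Otimes>\<^sub>M M)"
      by (simp only: prod.collapse)
    show "(\<lambda>l. SUP x\<in>{0..}. ennreal \<bar>W x l\<bar>) \<in> borel_measurable M" unfolding sup by measurable
    fix x :: real assume x: "0 \<le> x"
    have "x \<in> {0..}" using x by simp
    from A(3)[OF this] m(6)[OF x] show "AE l in M. W x l = co (u x) l"
      by eventually_elim (simp add: W_def G_def)
  qed
  moreover have "sup_square_integral M W \<le> ennreal (c\<^sup>2)"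
    unfolding sup_square_integral_def sup unfolding G_def by (rule dom[OF A(2)])
  ultimately show ?thesis unfolding reverse_norm_sq_def by (rule INF_lower2[of W])
qed

lemma majorized_imp_reverse_space:
  assumes "majorized u U S c"
  shows "u \<in> reverse_space M co" "reverse_norm M co u \<le> c"
proof -
  note le = majorized_imp_reverse_norm_sq_le[OF assms]
  show "u \<in> reverse_space M co"
    using le unfolding reverse_space_def by (auto intro: le_less_trans)
  have "enn2real (reverse_norm_sq M co u) \<le> c\<^sup>2"
    using enn2real_mono[OF le] by simp
  then show "reverse_norm M co u \<le> c"
    unfolding reverse_norm_def using majorizedD(1)[OF assms] by (simp add: real_le_lsqrt)
qed

lemma reverse_norm_nonneg: "0 \<le> reverse_norm M co u"
  unfolding reverse_norm_def by simp

lemma reverse_norm_sq_eq: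
  assumes "u \<in> reverse_space M co"
  shows "reverse_norm_sq M co u = ennreal ((reverse_norm M co u)\<^sup>2)"
  using assms unfolding reverse_norm_def reverse_space_def by simp

text \<open>
  The supremum over \<open>x\<close> may be infinite on a null set of \<open>l\<close>, where both the version and its bound are
  set to zero. Reading \<open>U\<close> at \<open>max x 0\<close> extends it measurably to negative \<open>x\<close>.
\<close>

lemma majorized_of_version:
  assumes U: "U \<in> coord_versions M co u" and fin: "sup_square_integral M U \<le> ennreal (c\<^sup>2)" and c: "0 \<le> c"
  shows "\<exists>V S. majorized u V S c \<and> (AE l in M. \<forall>x\<ge>0. U x l = V x l)"
proof -
  define G where "G l = (SUP x\<in>{0..}. ennreal \<bar>U x l\<bar>)" for l
  have Um: "(\<lambda>(x, l). U x l) \<in> borel_measurable (restrict_space borel {0..} \<Otimes>\<^sub>M M)"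
    and Gm [measurable]: "G \<in> borel_measurable M"
    and Uco: "\<And>x. 0 \<le> x \<Longrightarrow> AE l in M. U x l = co (u x) l"
    using U unfolding coord_versions_def G_def by auto
  have intG: "(\<integral>\<^sup>+l. (G l)\<^sup>2 \<partial>M) \<le> ennreal (c\<^sup>2)"
    using fin unfolding sup_square_integral_def G_def .
  then have "(\<integral>\<^sup>+l. (G l)\<^sup>2 \<partial>M) \<noteq> \<infinity>" by (auto simp: top_unique)
  then have "AE l in M. (G l)\<^sup>2 \<noteq> \<infinity>" by (intro nn_integral_PInf_AE) auto
  then have fin: "AE l in M. G l < \<infinity>"
    by eventually_elim (auto simp: less_top[symmetric] power2_eq_square ennreal_mult_eq_top_iff)
  define S where "S l = (if G l < \<infinity> then enn2real (G l) else 0)" for l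
  define V where "V x l = (if G l < \<infinity> then U (max x 0) l else 0)" for x l
  have "(\<lambda>p. (max (fst p) 0, snd p)) \<in> (borel :: real measure) \<Otimes>\<^sub>M M \<rightarrow>\<^sub>M restrict_space borel {0..} \<Otimes>\<^sub>M M"
    by (intro measurable_Pair measurable_restrict_space2) auto
  then have "(\<lambda>p. case (max (fst p) 0, snd p) of (x, l) \<Rightarrow> U x l) \<in> borel_measurable ((borel :: real measure) \<Otimes>\<^sub>M M)"
    by (rule measurable_compose) (rule Um)
  then have [measurable]: "(\<lambda>(x, l). U (max x 0) l) \<in> borel_measurable (borel \<Otimes>\<^sub>M M)"
    by (simp only: fst_conv snd_conv case_prod_unfold)
  have "majorized u V S c"
    unfolding majorized_def
  proof (intro conjI allI impI ballI)
    show "S \<in> borel_measurable M" unfolding S_def by measurable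
    have "(\<integral>\<^sup>+l. ennreal ((S l)\<^sup>2) \<partial>M) = (\<integral>\<^sup>+l. (G l)\<^sup>2 \<partial>M)"
      using fin by (intro nn_integral_cong_AE) (auto elim!: eventually_mono simp: S_def simp flip: ennreal_power)
    then show "(\<integral>\<^sup>+l. ennreal ((S l)\<^sup>2) \<partial>M) \<le> ennreal (c\<^sup>2)" using intG by simp
    show "(\<lambda>(x, l). V x l) \<in> borel_measurable (borel \<Otimes>\<^sub>M M)" unfolding V_def by measurable
    show "\<bar>V x l\<bar> \<le> S l" if "0 \<le> x" "l \<in> space M" for x l
    proof (cases "G l < \<infinity>")
      case True
      have "ennreal \<bar>U x l\<bar> \<le> G l" unfolding G_def using that by (intro SUP_upper) auto
      then have "enn2real (ennreal \<bar>U x l\<bar>) \<le> enn2real (G l)" using True by (intro enn2real_mono) auto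
      then show ?thesis using True that by (simp add: V_def S_def)
    qed (simp add: V_def S_def)
    show "AE l in M. V x l = co (u x) l" if "0 \<le> x" for x
      using Uco[OF that] fin by eventually_elim (use that in \<open>simp add: V_def\<close>)
  qed (rule c)
  moreover have "AE l in M. \<forall>x\<ge>0. U x l = V x l"
    using fin by eventually_elim (simp add: V_def)
  ultimately show ?thesis by blast
qed

lemma reverse_space_majorized:
  assumes u: "u \<in> reverse_space M co" and c: "reverse_norm M co u < c"
  shows "\<exists>U S. majorized u U S c"
proof -
  have "(reverse_norm M co u)\<^sup>2 < c\<^sup>2"
    using c reverse_norm_nonneg[of u] by (intro power_strict_mono) auto
  then have "reverse_norm_sq M co u < ennreal (c\<^sup>2)"
    unfolding reverse_norm_sq_eq[OF u] by (intro ennreal_lessI) (auto intro: le_less_trans[OF zero_le_power2])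
  then obtain U where U: "U \<in> coord_versions M co u" "sup_square_integral M U < ennreal (c\<^sup>2)"
    unfolding reverse_norm_sq_def INF_less_iff by blast
  have "0 \<le> c" using c reverse_norm_nonneg[of u] by linarith
  from majorized_of_version[OF U(1) less_imp_le[OF U(2)] this] show ?thesis by blast
qed

end

section \<open>The reverse norm is a complete seminorm\<close>

context spectral_space
begin

lemma norm_mono_AE:
  assumes "AE l in M. \<bar>co u l\<bar> \<le> \<bar>co v l\<bar>"
  shows "norm u \<le> norm v"
proof (rule norm_le_of_AE[of u "co u"])
  have "(\<integral>\<^sup>+l. ennreal ((co u l)\<^sup>2) \<partial>M) \<le> (\<integral>\<^sup>+l. ennreal ((co v l)\<^sup>2) \<partial>M)"
    using assms by (intro nn_integral_mono_AE) (auto elim!: eventually_mono intro!: ennreal_leI simp: abs_le_square_iff)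
  then show "(\<integral>\<^sup>+l. ennreal ((co u l)\<^sup>2) \<partial>M) \<le> ennreal ((norm v)\<^sup>2)"
    by (simp only: nn_integral_co)
qed auto

lemma ex_dominated_element:
  assumes [measurable]: "f \<in> borel_measurable M" and le: "AE l in M. \<bar>f l\<bar> \<le> \<bar>co v l\<bar>"
  obtains u where "AE l in M. co u l = f l" "norm u \<le> norm v"
proof (rule ex_element[of f "norm v"])
  have "(\<integral>\<^sup>+l. ennreal ((f l)\<^sup>2) \<partial>M) \<le> (\<integral>\<^sup>+l. ennreal ((co v l)\<^sup>2) \<partial>M)"
    using le by (intro nn_integral_mono_AE) (auto elim!: eventually_mono intro!: ennreal_leI simp: abs_le_square_iff)
  then show "(\<integral>\<^sup>+l. ennreal ((f l)\<^sup>2) \<partial>M) \<le> ennreal ((norm v)\<^sup>2)"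
    by (simp only: nn_integral_co)
qed (use that in auto)

lemma co_sum: "finite I \<Longrightarrow> AE l in M. co (\<Sum>n\<in>I. u n) l = (\<Sum>n\<in>I. co (u n) l)"
proof (induction I rule: finite_induct)
  case empty
  then show ?case using co_scale[of 0 0] by simp
next
  case (insert n I)
  have "AE l in M. co (u n + (\<Sum>n\<in>I. u n)) l = co (u n) l + (\<Sum>n\<in>I. co (u n) l)"
    using insert(3) co_add[of "u n" "\<Sum>n\<in>I. u n"] by eventually_elim simp
  then show ?case using insert(1,2) by simp
qed

text \<open>
  The nonnegative cone is closed: the negative part of the limit \<open>y\<close> is bounded by \<open>\<bar>y - x\<^sub>n\<bar>\<close> almost
  everywhere.
\<close>

lemma co_nonneg_limit:
  assumes "\<And>n. AE l in M. 0 \<le> co (x n) l" and lim: "x \<longlonglongrightarrow> y"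
  shows "AE l in M. 0 \<le> co y l"
proof -
  have m: "(\<lambda>l. min (co y l) 0) \<in> borel_measurable M" by measurable
  have "AE l in M. \<bar>min (co y l) 0\<bar> \<le> \<bar>co y l\<bar>" by auto
  then obtain z where z: "AE l in M. co z l = min (co y l) 0"
    using ex_dominated_element[OF m] by blast
  have "norm z \<le> norm (y - x n)" for n
  proof (rule norm_mono_AE)
    show "AE l in M. \<bar>co z l\<bar> \<le> \<bar>co (y - x n) l\<bar>"
      using assms(1)[of n] z co_diff[of y "x n"] by eventually_elim (auto simp: min_def)
  qed
  moreover have "(\<lambda>n. norm (y - x n)) \<longlonglongrightarrow> norm (y - y)"
    by (intro tendsto_intros lim)
  ultimately have "norm z \<le> 0" by (intro LIMSEQ_le_const) auto
  then have "z = 0" by simp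
  then have "AE l in M. co z l = 0" using co_scale[of 0 0] by simp
  then show ?thesis using z by eventually_elim (auto simp: min_def split: if_splits)
qed

lemma majorized_add:
  assumes u: "majorized u U S c" and v: "majorized v V T d"
  shows "majorized (\<lambda>x. u x + v x) (\<lambda>x l. U x l + V x l) (\<lambda>l. S l + T l) (c + d)"
  unfolding majorized_def
proof (intro conjI allI impI ballI)
  note u = majorizedD[OF u] and v = majorizedD[OF v]
  note [measurable] = u(2,4) v(2,4)
  show "0 \<le> c + d" using u(1) v(1) by simp
  show "(\<lambda>l. S l + T l) \<in> borel_measurable M" by measurable
  show "(\<lambda>(x, l). U x l + V x l) \<in> borel_measurable (borel \<Otimes>\<^sub>M M)" by measurable
  obtain s where s: "AE l in M. co s l = S l" "norm s \<le> c" using ex_element[OF u(2,3,1)] .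
  obtain t where t: "AE l in M. co t l = T l" "norm t \<le> d" using ex_element[OF v(2,3,1)] .
  have "AE l in M. co (s + t) l = S l + T l" using s(1) t(1) co_add[of s t] by eventually_elim simp
  from nn_integral_eq_norm[OF this]
  show "(\<integral>\<^sup>+ l. ennreal ((S l + T l)\<^sup>2) \<partial>M) \<le> ennreal ((c + d)\<^sup>2)"
    using norm_triangle_mono[OF s(2) t(2)] by (auto intro!: ennreal_leI power_mono)
  show "\<bar>U x l + V x l\<bar> \<le> S l + T l" if "0 \<le> x" "l \<in> space M" for x l
    using u(5)[OF that] v(5)[OF that] by linarith
  show "AE l in M. U x l + V x l = co (u x + v x) l" if "0 \<le> x" for x
    using u(6)[OF that] v(6)[OF that] co_add[of "u x" "v x"] by eventually_elim simp
qed

lemma majorized_scale: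
  assumes u: "majorized u U S c"
  shows "majorized (\<lambda>x. a *\<^sub>R u x) (\<lambda>x l. a * U x l) (\<lambda>l. \<bar>a\<bar> * S l) (\<bar>a\<bar> * c)"
  unfolding majorized_def
proof (intro conjI allI impI ballI)
  note u = majorizedD[OF u]
  note [measurable] = u(2,4)
  show "0 \<le> \<bar>a\<bar> * c" using u(1) by simp
  show "(\<lambda>l. \<bar>a\<bar> * S l) \<in> borel_measurable M" by measurable
  show "(\<lambda>(x, l). a * U x l) \<in> borel_measurable (borel \<Otimes>\<^sub>M M)" by measurable
  have "(\<integral>\<^sup>+ l. ennreal ((\<bar>a\<bar> * S l)\<^sup>2) \<partial>M) = ennreal (a\<^sup>2) * (\<integral>\<^sup>+ l. ennreal ((S l)\<^sup>2) \<partial>M)"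
    by (subst nn_integral_cmult[symmetric]) (auto simp: power_mult_distrib ennreal_mult)
  also have "\<dots> \<le> ennreal (a\<^sup>2) * ennreal (c\<^sup>2)" by (intro mult_left_mono u(3)) simp
  also have "\<dots> = ennreal ((\<bar>a\<bar> * c)\<^sup>2)" by (simp add: ennreal_mult power_mult_distrib)
  finally show "(\<integral>\<^sup>+ l. ennreal ((\<bar>a\<bar> * S l)\<^sup>2) \<partial>M) \<le> ennreal ((\<bar>a\<bar> * c)\<^sup>2)" .
  show "\<bar>a * U x l\<bar> \<le> \<bar>a\<bar> * S l" if "0 \<le> x" "l \<in> space M" for x l
    using u(5)[OF that] by (simp add: abs_mult mult_left_mono)
  show "AE l in M. a * U x l = co (a *\<^sub>R u x) l" if "0 \<le> x" for x
    using u(6)[OF that] co_scale[of a "u x"] by eventually_elim simp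
qed

lemma majorized_norm_le:
  assumes "majorized u U S c" "0 \<le> x"
  shows "norm (u x) \<le> c"
proof -
  note u = majorizedD[OF assms(1)]
  obtain s where s: "AE l in M. co s l = S l" "norm s \<le> c" using ex_element[OF u(2,3,1)] .
  have "norm (u x) \<le> norm s"
  proof (rule norm_mono_AE)
    show "AE l in M. \<bar>co (u x) l\<bar> \<le> \<bar>co s l\<bar>"
      using s(1) u(6)[OF assms(2)] AE_space
    proof eventually_elim
      case (elim l)
      then show ?case using u(5)[OF assms(2), of l] by simp
    qed
  qed
  then show ?thesis using s(2) by simp
qed

lemma norm_le_reverse_norm:
  assumes "u \<in> reverse_space M co" "0 \<le> x"
  shows "norm (u x) \<le> reverse_norm M co u"
proof (rule field_le_epsilon)
  fix e :: real assume "0 < e"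
  then obtain U S where "majorized u U S (reverse_norm M co u + e)"
    using reverse_space_majorized[OF assms(1)] less_add_same_cancel1 by blast
  from majorized_norm_le[OF this assms(2)] show "norm (u x) \<le> reverse_norm M co u + e" .
qed

lemma reverse_norm_leI:
  assumes "\<And>e. 0 < e \<Longrightarrow> \<exists>U S. majorized u U S (c + e)"
  shows "u \<in> reverse_space M co" "reverse_norm M co u \<le> c"
proof -
  show "u \<in> reverse_space M co"
    using assms[OF zero_less_one] majorized_imp_reverse_space(1) by blast
  show "reverse_norm M co u \<le> c"
    by (rule field_le_epsilon) (use assms majorized_imp_reverse_space(2) in blast)
qed

lemma reverse_space_add:
  assumes u: "u \<in> reverse_space M co" and v: "v \<in> reverse_space M co"
  shows "(\<lambda>x. u x + v x) \<in> reverse_space M co"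
    "reverse_norm M co (\<lambda>x. u x + v x) \<le> reverse_norm M co u + reverse_norm M co v"
proof -
  have *: "\<exists>U S. majorized (\<lambda>x. u x + v x) U S (reverse_norm M co u + reverse_norm M co v + e)"
    if e: "0 < e" for e
  proof -
    obtain U S V T where "majorized u U S (reverse_norm M co u + e/2)" "majorized v V T (reverse_norm M co v + e/2)"
      using reverse_space_majorized[OF u, of "reverse_norm M co u + e/2"]
        reverse_space_majorized[OF v, of "reverse_norm M co v + e/2"] e by auto
    from majorized_add[OF this] show ?thesis by (auto simp: algebra_simps)
  qed
  show "(\<lambda>x. u x + v x) \<in> reverse_space M co"
    "reverse_norm M co (\<lambda>x. u x + v x) \<le> reverse_norm M co u + reverse_norm M co v"
    by (rule reverse_norm_leI, erule *)+
qed

lemma reverse_space_scale: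
  assumes u: "u \<in> reverse_space M co"
  shows "(\<lambda>x. a *\<^sub>R u x) \<in> reverse_space M co"
    "reverse_norm M co (\<lambda>x. a *\<^sub>R u x) \<le> \<bar>a\<bar> * reverse_norm M co u"
proof -
  have scaled: "\<exists>U S. majorized (\<lambda>x. a *\<^sub>R u x) U S (\<bar>a\<bar> * (reverse_norm M co u + d))" if d: "0 < d" for d
  proof -
    obtain U S where "majorized u U S (reverse_norm M co u + d)"
      using reverse_space_majorized[OF u, of "reverse_norm M co u + d"] d by auto
    from majorized_scale[OF this, of a] show ?thesis by blast
  qed
  show "(\<lambda>x. a *\<^sub>R u x) \<in> reverse_space M co"
    using scaled[OF zero_less_one] majorized_imp_reverse_space(1) by blast
  have "reverse_norm M co (\<lambda>x. a *\<^sub>R u x) \<le> \<bar>a\<bar> * (reverse_norm M co u + d)" if "0 < d" for d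
    using scaled[OF that] majorized_imp_reverse_space(2) by blast
  then have "\<forall>n. reverse_norm M co (\<lambda>x. a *\<^sub>R u x) \<le> \<bar>a\<bar> * (reverse_norm M co u + inverse (real (Suc n)))"
    by (simp del: of_nat_Suc)
  moreover have "(\<lambda>n. \<bar>a\<bar> * (reverse_norm M co u + inverse (real (Suc n)))) \<longlonglongrightarrow> \<bar>a\<bar> * (reverse_norm M co u + 0)"
    by (intro tendsto_intros LIMSEQ_inverse_real_of_nat)
  ultimately show "reverse_norm M co (\<lambda>x. a *\<^sub>R u x) \<le> \<bar>a\<bar> * reverse_norm M co u"
    by (intro LIMSEQ_le_const) auto
qed

text \<open>
  Completeness. The bounds \<open>S n\<close> are the coordinates of elements \<open>s n\<close> of the Hilbert space whose sum
  \<open>p\<close> converges in norm. Since the cone of nonnegative elements is closed, the coordinates of \<open>p\<close>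
  dominate all partial sums \<open>\<Sum>n<N. S n\<close> outside a null set, and there the series of the \<open>U n\<close>
  converges absolutely, uniformly in \<open>x\<close>. The error after \<open>N\<close> terms is dominated by the coordinates of \<open>p - \<Sum>n<N. s n\<close>,
  whose norm tends to zero; this identifies the pointwise sum with the sum in the Hilbert space.
\<close>

lemma majorized_suminf:
  fixes u :: "nat \<Rightarrow> real \<Rightarrow> 'h"
  assumes maj: "\<And>n. majorized (u n) (U n) (S n) (c n)" and sm: "summable c"
  shows "\<exists>V T. majorized (\<lambda>x. \<Sum>n. u n x) V T (suminf c)"
proof -
  note m = majorizedD[OF maj]
  note [measurable] = m(2,4)
  have "\<forall>n. \<exists>s. (AE l in M. co s l = S n l) \<and> norm s \<le> c n"
    using ex_element[OF m(2,3,1)] by blast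
  from choice[OF this] obtain s where s: "\<And>n. AE l in M. co (s n) l = S n l" "\<And>n. norm (s n) \<le> c n"
    by blast
  have sum_s: "summable s" by (rule summable_comparison_test'[OF sm s(2)])
  define p where "p = suminf s"
  define P where "P N = (\<Sum>n<N. s n)" for N
  have norm_p: "norm p \<le> suminf c" unfolding p_def by (rule norm_suminf_le[OF s(2) sm])
  have P_lim: "P \<longlonglongrightarrow> p" unfolding P_def p_def by (rule summable_LIMSEQ[OF sum_s])
  have P_co: "AE l in M. co (P N) l = (\<Sum>n<N. S n l)" for N
  proof -
    have "AE l in M. \<forall>n. co (s n) l = S n l" using s(1) by (simp add: AE_all_countable)
    then show ?thesis
      using co_sum[of "{..<N}" s, OF finite_lessThan] unfolding P_def by eventually_elim simp
  qed
  have partial: "AE l in M. (\<Sum>n<N. S n l) \<le> co p l" for N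
  proof -
    have "AE l in M. 0 \<le> co (P (N + k) - P N) l" for k
      using P_co[of "N + k"] P_co[of N] co_diff[of "P (N + k)" "P N"] AE_space
    proof eventually_elim
      case (elim l)
      have "(\<Sum>n<N. S n l) \<le> (\<Sum>n<N + k. S n l)"
        using m(7)[OF elim(4)] by (intro sum_mono2) auto
      then show ?case using elim by simp
    qed
    moreover have "(\<lambda>k. P (N + k) - P N) \<longlonglongrightarrow> p - P N"
      using LIMSEQ_ignore_initial_segment[OF P_lim, of N] by (intro tendsto_diff) (simp_all add: add.commute)
    ultimately have "AE l in M. 0 \<le> co (p - P N) l" by (rule co_nonneg_limit)
    then show ?thesis using P_co[of N] co_diff[of p "P N"] by eventually_elim simp
  qed
  \<comment> \<open>Off this set of full measure, \<open>V\<close> and \<open>T\<close> are set to zero, so that the bounds hold at every point.\<close>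
  define good where "good l \<longleftrightarrow> (\<forall>N. (\<Sum>n<N. S n l) \<le> co p l)" for l
  have [measurable]: "Measurable.pred M good" unfolding good_def by measurable
  have good_AE: "AE l in M. good l" unfolding good_def using partial by (simp add: AE_all_countable)
  define T where "T l = (if good l then co p l else 0)" for l
  define V where "V x l = (if good l then (\<Sum>n. U n x l) else 0)" for x l
  have sum_S: "summable (\<lambda>n. S n l)" "suminf (\<lambda>n. S n l) \<le> co p l" if "good l" "l \<in> space M" for l
  proof -
    show "summable (\<lambda>n. S n l)"
      using that m(7) unfolding good_def by (intro summableI_nonneg_bounded[of _ "co p l"]) auto
    then show "suminf (\<lambda>n. S n l) \<le> co p l"
      using that unfolding good_def by (intro suminf_le_const) auto
  qed
  have tail: "summable (\<lambda>n. U n x l)"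
     "\<bar>(\<Sum>n. U n x l) - (\<Sum>n<N. U n x l)\<bar> \<le> co p l - (\<Sum>n<N. S n l)"
    if "good l" "l \<in> space M" "0 \<le> x" for l x N
  proof -
    have b: "norm (U n x l) \<le> S n l" for n using m(5)[OF that(3,2)] by simp
    show sU: "summable (\<lambda>n. U n x l)"
      by (rule summable_comparison_test'[OF sum_S(1)[OF that(1,2)] b])
    have "(\<Sum>n. U n x l) - (\<Sum>n<N. U n x l) = (\<Sum>n. U (n + N) x l)"
      using suminf_minus_initial_segment[OF sU, of N] by simp
    also have "\<bar>\<dots>\<bar> \<le> (\<Sum>n. S (n + N) l)"
      using norm_suminf_le[of "\<lambda>n. U (n + N) x l" "\<lambda>n. S (n + N) l"] b
        summable_ignore_initial_segment[OF sum_S(1)[OF that(1,2)], of N] by simp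
    also have "\<dots> = suminf (\<lambda>n. S n l) - (\<Sum>n<N. S n l)"
      using suminf_minus_initial_segment[OF sum_S(1)[OF that(1,2)], of N] by simp
    finally show "\<bar>(\<Sum>n. U n x l) - (\<Sum>n<N. U n x l)\<bar> \<le> co p l - (\<Sum>n<N. S n l)"
      using sum_S(2)[OF that(1,2)] by linarith
  qed
  have Vm [measurable]: "(\<lambda>(x, l). V x l) \<in> borel_measurable (borel \<Otimes>\<^sub>M M)" unfolding V_def by measurable
  have bound: "\<bar>V x l\<bar> \<le> T l" if "0 \<le> x" "l \<in> space M" for x l
    using tail(2)[of l x 0] that by (cases "good l") (auto simp: V_def T_def)
  have T_co: "AE l in M. T l = co p l" using good_AE by eventually_elim (simp add: T_def)
  have "majorized (\<lambda>x. \<Sum>n. u n x) V T (suminf c)"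
    unfolding majorized_def
  proof (intro conjI allI impI ballI Vm bound)
    show "0 \<le> suminf c" using m(1) sm by (intro suminf_nonneg)
    show "T \<in> borel_measurable M" unfolding T_def by measurable
    have "AE l in M. co p l = T l" using T_co by eventually_elim simp
    from nn_integral_eq_norm[OF this] show "(\<integral>\<^sup>+ l. ennreal ((T l)\<^sup>2) \<partial>M) \<le> ennreal ((suminf c)\<^sup>2)"
      using norm_p by (auto intro!: ennreal_leI power_mono)
    fix x :: real assume x: "0 \<le> x"
    have "V x \<in> borel_measurable M" by measurable
    moreover have "AE l in M. \<bar>V x l\<bar> \<le> \<bar>co p l\<bar>"
      using T_co AE_space
    proof eventually_elim
      case (elim l)
      then show ?case using bound[OF x, of l] by simp
    qed
    ultimately obtain w where w: "AE l in M. co w l = V x l"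
      using ex_dominated_element by blast
    have close: "norm ((\<Sum>n<N. u n x) - w) \<le> norm (p - P N)" for N
    proof (rule norm_mono_AE)
      have "AE l in M. \<forall>n. U n x l = co (u n x) l"
        using m(6)[OF x] by (simp add: AE_all_countable)
      then show "AE l in M. \<bar>co ((\<Sum>n<N. u n x) - w) l\<bar> \<le> \<bar>co (p - P N) l\<bar>"
        using good_AE w co_diff[of "\<Sum>n<N. u n x" w] co_diff[of p "P N"] P_co[of N]
          co_sum[of "{..<N}" "\<lambda>n. u n x", OF finite_lessThan] AE_space
      proof eventually_elim
        case (elim l)
        then show ?case using tail(2)[OF elim(2) elim(8) x, of N] by (simp add: V_def abs_minus_commute)
      qed
    qed
    have "(\<lambda>N. (\<Sum>n<N. u n x) - w) \<longlonglongrightarrow> 0"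
    proof (rule Lim_null_comparison)
      show "\<forall>\<^sub>F N in sequentially. norm ((\<Sum>n<N. u n x) - w) \<le> norm (p - P N)" using close by simp
      have "(\<lambda>N. norm (p - P N)) \<longlonglongrightarrow> norm (p - p)" by (intro tendsto_intros P_lim)
      then show "(\<lambda>N. norm (p - P N)) \<longlonglongrightarrow> 0" by simp
    qed
    then have "(\<lambda>n. u n x) sums w" unfolding sums_def by (simp add: LIM_zero_iff)
    then have "(\<Sum>n. u n x) = w" by (simp add: sums_iff)
    then show "AE l in M. V x l = co (\<Sum>n. u n x) l" using w by (auto elim!: eventually_mono)
  qed
  then show ?thesis by blast
qed

lemma reverse_space_suminf:
  fixes u :: "nat \<Rightarrow> real \<Rightarrow> 'h"
  assumes u: "\<And>n. u n \<in> reverse_space M co" and le: "\<And>n. reverse_norm M co (u n) \<le> a n" and a: "summable a"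
  shows "(\<lambda>x. \<Sum>n. u n x) \<in> reverse_space M co" "reverse_norm M co (\<lambda>x. \<Sum>n. u n x) \<le> suminf a"
proof -
  have *: "\<exists>V T. majorized (\<lambda>x. \<Sum>n. u n x) V T (suminf a + e)" if e: "0 < e" for e
  proof -
    have se: "(\<lambda>n. e * (1/2) ^ Suc n) sums (e * 1)" by (intro sums_mult power_half_series)
    define c where "c n = a n + e * (1/2) ^ Suc n" for n
    have c: "c sums (suminf a + e)" unfolding c_def using sums_add[OF summable_sums[OF a] se] by simp
    have "\<forall>n. \<exists>US. majorized (u n) (fst US) (snd US) (c n)"
    proof
      fix n
      have "0 < e * (1/2) ^ Suc n" using e by simp
      then have "reverse_norm M co (u n) < c n" using le[of n] unfolding c_def by linarith
      from reverse_space_majorized[OF u this] show "\<exists>US. majorized (u n) (fst US) (snd US) (c n)" by simp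
    qed
    from choice[OF this] obtain US where "\<And>n. majorized (u n) (fst (US n)) (snd (US n)) (c n)" by blast
    from majorized_suminf[OF this sums_summable[OF c]] show ?thesis using sums_unique[OF c] by simp
  qed
  show "(\<lambda>x. \<Sum>n. u n x) \<in> reverse_space M co" "reverse_norm M co (\<lambda>x. \<Sum>n. u n x) \<le> suminf a"
    by (rule reverse_norm_leI, erule *)+
qed

end

section \<open>The solution operator on the half line\<close>

lemma nn_integral_exponential_density:
  fixes a :: real
  assumes a: "0 < a"
  shows "(\<integral>\<^sup>+y. ennreal (exp (- y / a) / a) * indicator {0..} y \<partial>lborel) = 1"
proof -
  have "((\<lambda>y. - exp (- y / a)) \<longlongrightarrow> - 0) at_top"
  proof (intro tendsto_minus filterlim_compose[OF exp_at_bot])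
    have "filterlim (\<lambda>y. y / a) at_top at_top"
      using a by (intro filterlim_at_top_mult_tendsto_pos[of "\<lambda>_. 1/a" "1/a" at_top "\<lambda>y. y", simplified] filterlim_ident) auto
    then show "filterlim (\<lambda>y. - y / a) at_bot at_top"
      using filterlim_uminus_at_bot by (simp add: filterlim_uminus_at_bot)
  qed
  then have lim: "((\<lambda>y. - exp (- y / a)) \<longlongrightarrow> 0) at_top" by simp
  have "(\<integral>\<^sup>+y. ennreal (exp (- y / a) / a) * indicator {0..} y \<partial>lborel) = ennreal (0 - (- exp (- 0 / a)))"
  proof (rule nn_integral_FTC_atLeast[OF _ _ _ lim])
    show "DERIV (\<lambda>y. - exp (- y / a)) y :> exp (- y / a) / a" for y
      using a by (auto intro!: derivative_eq_intros)
    show "0 \<le> exp (- y / a) / a" for y using a by simp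
  qed measurable
  then show ?thesis by simp
qed

lemma resolvent_kernel_measurable [measurable]:
  "(\<lambda>z. resolvent_kernel \<gamma> z l) \<in> borel_measurable borel"
  unfolding resolvent_kernel_def by measurable

text \<open>
  After reflection, if necessary, the kernel is the exponential probability density of scale
  \<open>\<bar>\<gamma> l\<bar>\<close>. The bound does not depend on \<open>l\<close>, although \<open>\<gamma> l\<close> may be arbitrarily close to zero.
\<close>

lemma nn_integral_resolvent_kernel:
  "(\<integral>\<^sup>+y. ennreal \<bar>resolvent_kernel \<gamma> (x - y) l\<bar> \<partial>lborel) \<le> 1"
proof (cases "\<gamma> l = 0")
  case True
  then show ?thesis by (simp add: resolvent_kernel_def)
next
  case False
  define a where "a = \<bar>\<gamma> l\<bar>"
  \<comment> \<open>The substitution \<open>y \<mapsto> x + s * y\<close> moves the half line supporting the kernel to \<open>[0, \<infinity>)\<close>.\<close>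
  define s where "s = (if \<gamma> l > 0 then - 1 else 1 :: real)"
  have a: "0 < a" using False unfolding a_def by simp
  have "(\<integral>\<^sup>+y. ennreal \<bar>resolvent_kernel \<gamma> (x - y) l\<bar> \<partial>lborel)
      = \<bar>s\<bar> * (\<integral>\<^sup>+y. ennreal \<bar>resolvent_kernel \<gamma> (x - (x + s * y)) l\<bar> \<partial>lborel)"
    by (rule nn_integral_real_affine) (auto simp: s_def)
  also have "\<dots> = (\<integral>\<^sup>+y. ennreal \<bar>resolvent_kernel \<gamma> (- s * y) l\<bar> \<partial>lborel)"
    by (simp add: s_def)
  also have "\<dots> \<le> (\<integral>\<^sup>+y. ennreal (exp (- y / a) / a) * indicator {0..} y \<partial>lborel)"
    using False by (intro nn_integral_mono)
      (auto simp: resolvent_kernel_def s_def a_def indicator_def abs_mult field_simps intro!: ennreal_leI)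
  also have "\<dots> = 1" by (rule nn_integral_exponential_density[OF a])
  finally show ?thesis .
qed

context spectral_space
begin

definition K_coords :: "(real \<Rightarrow> 'l \<Rightarrow> real) \<Rightarrow> real \<Rightarrow> 'l \<Rightarrow> real" where
  "K_coords F x l =
     (\<integral>y. resolvent_kernel \<gamma> (x - y) l * (indicator {0..} y * F y l) \<partial>lborel)"

lemma K_plus_eq: "K_plus M co \<gamma> f x = of_coords M co (K_coords (coord_version M co f) x)"
  unfolding K_plus_def K_coords_def ..

text \<open>
  The basic estimate: convolution with a kernel of mass at most one does not increase the
  supremum over \<open>x\<close> at a fixed \<open>l\<close>.
\<close>

lemma K_integrand:
  assumes F: "majorized f F S c" and l: "l \<in> space M"
  shows "integrable lborel (\<lambda>y. resolvent_kernel \<gamma> (x - y) l * (indicator {0..} y * F y l))"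
    "\<bar>K_coords F x l\<bar> \<le> S l"
proof -
  note F = majorizedD[OF F]
  note [measurable] = F(2,4) l
  let ?h = "\<lambda>y. resolvent_kernel \<gamma> (x - y) l * (indicator {0..} y * F y l)"
  have [measurable]: "?h \<in> borel_measurable lborel" by measurable
  have "norm (?h y) \<le> S l * \<bar>resolvent_kernel \<gamma> (x - y) l\<bar>" for y
    using F(5)[OF _ l, of y] F(7)[OF l]
    by (auto simp: indicator_def abs_mult mult.commute intro!: mult_right_mono)
  then have "(\<integral>\<^sup>+y. norm (?h y) \<partial>lborel) \<le> (\<integral>\<^sup>+y. ennreal (S l) * ennreal \<bar>resolvent_kernel \<gamma> (x - y) l\<bar> \<partial>lborel)"
    using F(7)[OF l] by (intro nn_integral_mono) (auto simp flip: ennreal_mult intro!: ennreal_leI)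
  also have "\<dots> = ennreal (S l) * (\<integral>\<^sup>+y. ennreal \<bar>resolvent_kernel \<gamma> (x - y) l\<bar> \<partial>lborel)"
    by (rule nn_integral_cmult) measurable
  also have "\<dots> \<le> ennreal (S l) * 1"
    by (intro mult_left_mono nn_integral_resolvent_kernel) simp
  finally have le: "(\<integral>\<^sup>+y. norm (?h y) \<partial>lborel) \<le> ennreal (S l)" by simp
  show int: "integrable lborel ?h"
    using le by (intro integrableI_bounded) (auto intro: le_less_trans)
  have "ennreal (norm (K_coords F x l)) \<le> ennreal (S l)"
    using integral_norm_bound_ennreal[OF int] le unfolding K_coords_def by (rule order_trans)
  then show "\<bar>K_coords F x l\<bar> \<le> S l" using F(7)[OF l] by (simp add: ennreal_le_iff)
qed

lemma K_coords_measurable: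
  assumes [measurable]: "(\<lambda>(x, l). F x l) \<in> borel_measurable (borel \<Otimes>\<^sub>M M)"
  shows "(\<lambda>(x, l). K_coords F x l) \<in> borel_measurable (borel \<Otimes>\<^sub>M M)"
proof -
  have [measurable]: "(\<lambda>(p, y). resolvent_kernel \<gamma> (fst p - y) (snd p) * (indicator {0..} y * F y (snd p)))
      \<in> borel_measurable ((borel \<Otimes>\<^sub>M M) \<Otimes>\<^sub>M lborel)"
    unfolding resolvent_kernel_def by measurable
  have "(\<lambda>p. \<integral>y. resolvent_kernel \<gamma> (fst p - y) (snd p) * (indicator {0..} y * F y (snd p)) \<partial>lborel)
      \<in> borel_measurable (borel \<Otimes>\<^sub>M M)"
    by (rule lborel.borel_measurable_lebesgue_integral) measurable
  then show ?thesis unfolding K_coords_def by (simp add: case_prod_beta')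
qed

text \<open>
  For each \<open>y\<close> the two versions agree for almost every \<open>l\<close>. Exchanging the order of the quantifiers is
  Fubini's theorem, which is applicable on the support of \<open>S + T\<close>; outside it both versions vanish.
\<close>

lemma majorized_versions_eq:
  assumes F: "majorized f F S c" and G: "majorized f G T d"
  shows "AE l in M. AE y in lborel. 0 \<le> y \<longrightarrow> F y l = G y l"
proof -
  note F = majorizedD[OF F] and G = majorizedD[OF G]
  note [measurable] = F(2,4) G(2,4)
  define R where "R l = S l + T l" for l
  have [measurable]: "R \<in> borel_measurable M" unfolding R_def by measurable
  define A where "A = {l\<in>space M. R l \<noteq> 0}"
  have [measurable]: "A \<in> sets M" unfolding A_def by measurable
  obtain s where s: "AE l in M. co s l = S l" using ex_element[OF F(2,3,1)] .
  obtain t where t: "AE l in M. co t l = T l" using ex_element[OF G(2,3,1)] .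
  have "AE l in M. co (s + t) l = R l"
    using s t co_add[of s t] unfolding R_def by eventually_elim simp
  from nn_integral_eq_norm[OF this] have "(\<integral>\<^sup>+l. ennreal ((R l)\<^sup>2) \<partial>M) < \<infinity>" by simp
  then interpret A: sigma_finite_measure "density M (indicator A)"
    unfolding A_def by (rule sigma_finite_support[rotated]) measurable
  interpret P: pair_sigma_finite lborel "density M (indicator A)" ..
  have "AE y in lborel. AE l in density M (indicator A). 0 \<le> y \<longrightarrow> F y l = G y l"
  proof (rule AE_I2)
    fix y :: real
    show "AE l in density M (indicator A). 0 \<le> y \<longrightarrow> F y l = G y l"
    proof (cases "0 \<le> y")
      case True
      have "AE l in M. F y l = G y l" using F(6)[OF True] G(6)[OF True] by eventually_elim simp
      then show ?thesis by (subst AE_density) (auto elim: eventually_mono)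
    qed simp
  qed
  moreover have "{p\<in>space (lborel \<Otimes>\<^sub>M density M (indicator A)). 0 \<le> fst p \<longrightarrow> F (fst p) (snd p) = G (fst p) (snd p)}
      \<in> sets (lborel \<Otimes>\<^sub>M density M (indicator A))"
    by measurable
  ultimately have "AE l in density M (indicator A). AE y in lborel. 0 \<le> y \<longrightarrow> F y l = G y l"
    using P.AE_commute[of "\<lambda>y l. 0 \<le> y \<longrightarrow> F y l = G y l"] by simp
  then have "AE l in M. 0 < (indicator A l :: ennreal) \<longrightarrow> (AE y in lborel. 0 \<le> y \<longrightarrow> F y l = G y l)"
    by (subst (asm) AE_density) auto
  then show ?thesis
    using AE_space
  proof eventually_elim
    case (elim l)
    show ?case
    proof (cases "l \<in> A")
      case True
      then show ?thesis using elim by simp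
    next
      case False
      then have "S l + T l = 0" using elim(2) unfolding A_def R_def by auto
      then have "S l = 0" "T l = 0" using F(7)[OF elim(2)] G(7)[OF elim(2)] by auto
      then have "F y l = G y l" if "0 \<le> y" for y
        using F(5)[OF that elim(2)] G(5)[OF that elim(2)] by simp
      then show ?thesis by simp
    qed
  qed
qed

lemma K_coords_unique:
  assumes F: "majorized f F S c" and G: "majorized f G T d"
  shows "AE l in M. K_coords F x l = K_coords G x l"
  using majorized_versions_eq[OF assms] AE_space
proof eventually_elim
  case (elim l)
  note [measurable] = majorizedD(4)[OF F] majorizedD(4)[OF G] elim(2)
  have [measurable]: "(\<lambda>y. F y l) \<in> borel_measurable borel" "(\<lambda>y. G y l) \<in> borel_measurable borel"
    by measurable
  show ?case unfolding K_coords_def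
    using elim(1) by (intro integral_cong_AE) (auto elim!: eventually_mono simp: indicator_def)
qed

text \<open>
  The version chosen inside \<open>K_plus\<close> may be exchanged for any majorized one, by uniqueness. The same
  function \<open>S\<close> bounds \<open>f\<close> and its image, so the reverse norm does not increase.
\<close>

lemma K_plus_majorized:
  assumes F: "majorized f F S c"
  shows "majorized (K_plus M co \<gamma> f) (K_coords F) S c"
  unfolding majorized_def
proof (intro conjI allI impI ballI)
  note m = majorizedD[OF F]
  show "\<bar>K_coords F x l\<bar> \<le> S l" if "l \<in> space M" for x l
    by (rule K_integrand(2)[OF F that])
  have Km [measurable]: "(\<lambda>(x, l). K_coords F x l) \<in> borel_measurable (borel \<Otimes>\<^sub>M M)"
    by (rule K_coords_measurable[OF m(4)])
  then show "(\<lambda>(x, l). K_coords F x l) \<in> borel_measurable (borel \<Otimes>\<^sub>M M)" .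
  fix x :: real
  have "reverse_norm_sq M co f < \<infinity>"
    using majorized_imp_reverse_norm_sq_le[OF F] by (auto intro: le_less_trans)
  then have "\<exists>V. V \<in> coord_versions M co f \<and> sup_square_integral M V < \<infinity>"
    unfolding reverse_norm_sq_def INF_less_iff by blast
  then have V: "coord_version M co f \<in> coord_versions M co f"
    "sup_square_integral M (coord_version M co f) < \<infinity>"
    unfolding coord_version_def by (rule someI2_ex, blast)+
  define d where "d = sqrt (enn2real (sup_square_integral M (coord_version M co f)))"
  have "sup_square_integral M (coord_version M co f) \<le> ennreal (d\<^sup>2)" "0 \<le> d"
    using V(2) unfolding d_def by auto
  from majorized_of_version[OF V(1) this] obtain G T where G: "majorized f G T d"
    "AE l in M. \<forall>x\<ge>0. coord_version M co f x l = G x l" by blast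
  have "AE l in M. K_coords (coord_version M co f) x l = K_coords G x l"
    using G(2) unfolding K_coords_def
    by eventually_elim (rule Bochner_Integration.integral_cong, auto simp: indicator_def)
  then have eq: "AE l in M. K_coords (coord_version M co f) x l = K_coords F x l"
    using K_coords_unique[OF F G(1), of x] by eventually_elim simp
  have "(\<integral>\<^sup>+l. ennreal ((K_coords F x l)\<^sup>2) \<partial>M) \<le> (\<integral>\<^sup>+l. ennreal ((S l)\<^sup>2) \<partial>M)"
    using K_integrand(2)[OF F] m(7) by (intro nn_integral_mono ennreal_leI) (auto intro!: power2_le_iff_abs_le[THEN iffD2])
  then have "(\<integral>\<^sup>+l. ennreal ((K_coords F x l)\<^sup>2) \<partial>M) \<le> ennreal (c\<^sup>2)" using m(3) by simp
  moreover have "K_coords F x \<in> borel_measurable M" by measurable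
  ultimately obtain w where w: "AE l in M. co w l = K_coords F x l"
    using ex_element[OF _ _ m(1)] by blast
  have "K_plus M co \<gamma> f x = w"
    unfolding K_plus_eq
  proof (rule of_coords_eq)
    show "AE l in M. co w l = K_coords (coord_version M co f) x l"
      using w eq by eventually_elim simp
  qed
  then show "AE l in M. K_coords F x l = co (K_plus M co \<gamma> f x) l" using w by (auto elim!: eventually_mono)
qed (use majorizedD[OF F] in auto)

lemma co_K_plus:
  assumes "majorized f F S c" "0 \<le> x"
  shows "AE l in M. co (K_plus M co \<gamma> f x) l = K_coords F x l"
  using majorizedD(6)[OF K_plus_majorized[OF assms(1)] assms(2)] by eventually_elim simp

lemma reverse_norm_K_plus:
  assumes f: "f \<in> reverse_space M co"
  shows "K_plus M co \<gamma> f \<in> reverse_space M co" "reverse_norm M co (K_plus M co \<gamma> f) \<le> reverse_norm M co f"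
proof -
  have *: "\<exists>U S. majorized (K_plus M co \<gamma> f) U S (reverse_norm M co f + e)" if e: "0 < e" for e
  proof -
    obtain F S where "majorized f F S (reverse_norm M co f + e)"
      using reverse_space_majorized[OF f, of "reverse_norm M co f + e"] e by auto
    from K_plus_majorized[OF this] show ?thesis by blast
  qed
  show "K_plus M co \<gamma> f \<in> reverse_space M co" "reverse_norm M co (K_plus M co \<gamma> f) \<le> reverse_norm M co f"
    by (rule reverse_norm_leI, erule *)+
qed

lemma K_plus_comb:
  assumes f: "f \<in> reverse_space M co" and g: "g \<in> reverse_space M co" and x: "0 \<le> x"
  shows "K_plus M co \<gamma> (\<lambda>x. a *\<^sub>R f x + b *\<^sub>R g x) x = a *\<^sub>R K_plus M co \<gamma> f x + b *\<^sub>R K_plus M co \<gamma> g x"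
proof (rule co_inj)
  obtain F S where F: "majorized f F S (reverse_norm M co f + 1)"
    using reverse_space_majorized[OF f, of "reverse_norm M co f + 1"] by auto
  obtain G T where G: "majorized g G T (reverse_norm M co g + 1)"
    using reverse_space_majorized[OF g, of "reverse_norm M co g + 1"] by auto
  note FG = majorized_add[OF majorized_scale[OF F, of a] majorized_scale[OF G, of b]]
  show "AE l in M. co (K_plus M co \<gamma> (\<lambda>x. a *\<^sub>R f x + b *\<^sub>R g x) x) l
      = co (a *\<^sub>R K_plus M co \<gamma> f x + b *\<^sub>R K_plus M co \<gamma> g x) l"
    using co_K_plus[OF FG x] co_K_plus[OF F x] co_K_plus[OF G x]
      co_comb[of a "K_plus M co \<gamma> f x" b "K_plus M co \<gamma> g x"] AE_space
  proof eventually_elim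
    case (elim l)
    have "K_coords (\<lambda>x l. a * F x l + b * G x l) x l = a * K_coords F x l + b * K_coords G x l"
      unfolding K_coords_def
      using K_integrand(1)[OF F elim(5), of x] K_integrand(1)[OF G elim(5), of x]
      by (simp add: distrib_left mult.left_commute[of _ a] mult.left_commute[of _ b])
    then show ?case using elim by simp
  qed
qed

lemma K_plus_cong:
  assumes f: "f \<in> reverse_space M co" and eq: "\<And>x. 0 \<le> x \<Longrightarrow> f x = g x" and x: "0 \<le> x"
  shows "K_plus M co \<gamma> f x = K_plus M co \<gamma> g x"
proof (rule co_inj)
  obtain F S where F: "majorized f F S (reverse_norm M co f + 1)"
    using reverse_space_majorized[OF f, of "reverse_norm M co f + 1"] by auto
  then have G: "majorized g F S (reverse_norm M co f + 1)"
    using eq unfolding majorized_def by simp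
  show "AE l in M. co (K_plus M co \<gamma> f x) l = co (K_plus M co \<gamma> g x) l"
    using co_K_plus[OF F x] co_K_plus[OF G x] by eventually_elim simp
qed

lemma reverse_norm_cong:
  assumes "\<And>x. 0 \<le> x \<Longrightarrow> f x = g x"
  shows "reverse_norm M co f = reverse_norm M co g" "f \<in> reverse_space M co \<longleftrightarrow> g \<in> reverse_space M co"
proof -
  have "coord_versions M co f = coord_versions M co g"
    using assms unfolding coord_versions_def by auto
  then show "reverse_norm M co f = reverse_norm M co g" "f \<in> reverse_space M co \<longleftrightarrow> g \<in> reverse_space M co"
    unfolding reverse_norm_def reverse_space_def reverse_norm_sq_def by auto
qed

end

section \<open>Bilinear maps with a kernel\<close>

text \<open>
  The restriction of \<open>M\<close> to the support of \<open>S\<close>, as a density, so that measurability for \<open>M\<close> and for the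
  restriction coincide; it is sigma-finite when \<open>S\<close> is square-integrable.
\<close>

definition support_measure :: "'l measure \<Rightarrow> ('l \<Rightarrow> real) \<Rightarrow> 'l measure" where
  "support_measure M S = density M (indicator {l\<in>space M. S l \<noteq> 0})"

lemma sets_support_measure [simp, measurable_cong]: "sets (support_measure M S) = sets M"
  and space_support_measure [simp]: "space (support_measure M S) = space M"
  unfolding support_measure_def by simp_all

lemma nn_integral_support_le:
  assumes [measurable]: "S \<in> borel_measurable M" "f \<in> borel_measurable M"
  shows "(\<integral>\<^sup>+l. f l \<partial>support_measure M S) \<le> (\<integral>\<^sup>+l. f l \<partial>M)"
  unfolding support_measure_def
  by (subst nn_integral_density) (auto intro!: nn_integral_mono simp: indicator_def)

lemma integral_support_eq:
  fixes f :: "'l \<Rightarrow> real"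
  assumes [measurable]: "S \<in> borel_measurable M" "f \<in> borel_measurable M"
    and zero: "\<And>l. l \<in> space M \<Longrightarrow> S l = 0 \<Longrightarrow> f l = 0"
  shows "(\<integral>l. f l \<partial>support_measure M S) = (\<integral>l. f l \<partial>M)"
proof -
  have "support_measure M S = density M (\<lambda>l. ennreal (indicator {l\<in>space M. S l \<noteq> 0} l))"
    unfolding support_measure_def by (simp add: ennreal_indicator)
  then have "(\<integral>l. f l \<partial>support_measure M S) = (\<integral>l. indicator {l\<in>space M. S l \<noteq> 0} l *\<^sub>R f l \<partial>M)"
    by (simp add: integral_density)
  also have "\<dots> = (\<integral>l. f l \<partial>M)"
    by (rule Bochner_Integration.integral_cong) (auto simp: indicator_def zero)
  finally show ?thesis .
qed

lemma integral_support_measurable: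
  fixes f :: "'p \<Rightarrow> 'l \<Rightarrow> real"
  assumes "S \<in> borel_measurable M" "(\<integral>\<^sup>+l. ennreal ((S l)\<^sup>2) \<partial>M) < \<infinity>"
    and f: "(\<lambda>q. f (fst q) (snd q)) \<in> borel_measurable (P \<Otimes>\<^sub>M M)"
  shows "(\<lambda>p. \<integral>n. f p n \<partial>support_measure M S) \<in> borel_measurable P"
proof -
  interpret sigma_finite_measure "support_measure M S"
    unfolding support_measure_def by (rule sigma_finite_support) fact+
  have "(\<lambda>(p, n). f p n) \<in> borel_measurable (P \<Otimes>\<^sub>M support_measure M S)"
    using f by (simp add: case_prod_beta' cong: measurable_cong_sets)
  then show ?thesis by (rule borel_measurable_lebesgue_integral)
qed

lemma nn_integral_support_measurable:
  fixes f :: "'p \<Rightarrow> 'l \<Rightarrow> ennreal"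
  assumes "S \<in> borel_measurable M" "(\<integral>\<^sup>+l. ennreal ((S l)\<^sup>2) \<partial>M) < \<infinity>"
    and f: "(\<lambda>q. f (fst q) (snd q)) \<in> borel_measurable (P \<Otimes>\<^sub>M M)"
  shows "(\<lambda>p. \<integral>\<^sup>+n. f p n \<partial>support_measure M S) \<in> borel_measurable P"
proof -
  interpret sigma_finite_measure "support_measure M S"
    unfolding support_measure_def by (rule sigma_finite_support) fact+
  have "(\<lambda>(p, n). f p n) \<in> borel_measurable (P \<Otimes>\<^sub>M support_measure M S)"
    using f by (simp add: case_prod_beta' cong: measurable_cong_sets)
  then show ?thesis by (rule borel_measurable_nn_integral)
qed

lemma ennreal_abs_integral_le:
  fixes f :: "'l \<Rightarrow> real"
  shows "ennreal \<bar>\<integral>l. f l \<partial>M\<bar> \<le> (\<integral>\<^sup>+l. ennreal \<bar>f l\<bar> \<partial>M)"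
  using integral_norm_bound_ennreal[of M f] by (cases "integrable M f") (auto simp: not_integrable_integral_eq)

lemma kernel_measurable:
  assumes \<kappa>: "(\<lambda>(l, n, s). \<kappa> l n s) \<in> borel_measurable (M \<Otimes>\<^sub>M (M \<Otimes>\<^sub>M M))"
    and [measurable]: "f \<in> P \<rightarrow>\<^sub>M M" "g \<in> P \<rightarrow>\<^sub>M M" "h \<in> P \<rightarrow>\<^sub>M M"
  shows "(\<lambda>p. \<kappa> (f p) (g p) (h p) :: real) \<in> borel_measurable P"
proof -
  have "(\<lambda>p. (f p, g p, h p)) \<in> P \<rightarrow>\<^sub>M (M \<Otimes>\<^sub>M (M \<Otimes>\<^sub>M M))" by measurable
  from measurable_compose[OF this \<kappa>] show ?thesis by simp
qed

text \<open>
  If \<open>S\<close> dominates the coordinates of a function \<open>v\<close> for all \<open>x\<close>, this function of \<open>l\<close> dominates those of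
  \<open>D(v x, v x)\<close>. The integrals run over the support of \<open>S\<close>, where iterated integrals are measurable if \<open>S\<close> is
  square-integrable.
\<close>

definition kernel_majorant :: "'l measure \<Rightarrow> ('l \<Rightarrow> 'l \<Rightarrow> 'l \<Rightarrow> real) \<Rightarrow> ('l \<Rightarrow> real) \<Rightarrow> 'l \<Rightarrow> ennreal" where
  "kernel_majorant M \<kappa> S l =
     (\<integral>\<^sup>+n. (\<integral>\<^sup>+s. ennreal (\<bar>\<kappa> l n s\<bar> * S n * S s) \<partial>support_measure M S) \<partial>support_measure M S)"

lemma kernel_majorant_measurable:
  assumes \<kappa>: "(\<lambda>(l, n, s). \<kappa> l n s) \<in> borel_measurable (M \<Otimes>\<^sub>M (M \<Otimes>\<^sub>M M))"
    and S [measurable]: "S \<in> borel_measurable M" and fin: "(\<integral>\<^sup>+l. ennreal ((S l)\<^sup>2) \<partial>M) < \<infinity>"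
  shows "kernel_majorant M \<kappa> S \<in> borel_measurable M"
proof -
  note [measurable] = kernel_measurable[OF \<kappa>]
  have "(\<lambda>l. kernel_majorant M \<kappa> S l) \<in> borel_measurable M"
    unfolding kernel_majorant_def
    by (intro nn_integral_support_measurable[OF S fin]) measurable
  then show ?thesis by simp
qed

text \<open>
  The Cauchy-Schwarz inequality in \<open>n\<close> and then in \<open>s\<close>. All integrals are first taken over the support
  of \<open>S\<close>, where the inner ones are measurable functions of the outer variables; only the last step
  enlarges them to integrals over \<open>M\<close>, by monotonicity.
\<close>

lemma kernel_square_bound:
  assumes \<kappa>: "(\<lambda>(l, n, s). \<kappa> l n s) \<in> borel_measurable (M \<Otimes>\<^sub>M (M \<Otimes>\<^sub>M M))"
    and S [measurable]: "S \<in> borel_measurable M" and S0: "\<And>l. l \<in> space M \<Longrightarrow> 0 \<le> S l"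
    and le: "(\<integral>\<^sup>+l. ennreal ((S l)\<^sup>2) \<partial>M) \<le> c" and c: "c < \<infinity>"
  shows "(\<integral>\<^sup>+l. (kernel_majorant M \<kappa> S l)\<^sup>2 \<partial>M)
    \<le> c\<^sup>2 * (\<integral>\<^sup>+ l. (\<integral>\<^sup>+ n. (\<integral>\<^sup>+ s. ennreal (\<bar>\<kappa> l n s\<bar>\<^sup>2) \<partial>M) \<partial>M) \<partial>M)"
proof -
  note [measurable] = kernel_measurable[OF \<kappa>]
  let ?N = "support_measure M S"
  have fin: "(\<integral>\<^sup>+l. ennreal ((S l)\<^sup>2) \<partial>M) < \<infinity>" using le c by (rule le_less_trans)
  define H where "H l n = (\<integral>\<^sup>+s. ennreal (\<bar>\<kappa> l n s\<bar>\<^sup>2) \<partial>?N)" for l n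
  define I where "I l n = (\<integral>\<^sup>+s. ennreal \<bar>\<kappa> l n s\<bar> * ennreal (S s) \<partial>?N)" for l n
  have H2: "(\<lambda>q. H (fst q) (snd q)) \<in> borel_measurable (M \<Otimes>\<^sub>M M)"
    unfolding H_def by (rule nn_integral_support_measurable[OF S fin]) measurable
  have I2: "(\<lambda>q. I (fst q) (snd q)) \<in> borel_measurable (M \<Otimes>\<^sub>M M)"
    unfolding I_def by (rule nn_integral_support_measurable[OF S fin]) measurable
  have S_N: "(\<integral>\<^sup>+s. (ennreal (S s))\<^sup>2 \<partial>?N) \<le> c"
  proof -
    have "(\<integral>\<^sup>+s. (ennreal (S s))\<^sup>2 \<partial>?N) = (\<integral>\<^sup>+s. ennreal ((S s)\<^sup>2) \<partial>?N)"
      using S0 by (intro nn_integral_cong) (simp add: ennreal_power)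
    also have "\<dots> \<le> (\<integral>\<^sup>+s. ennreal ((S s)\<^sup>2) \<partial>M)" by (rule nn_integral_support_le) measurable
    finally show ?thesis using le by simp
  qed
  have pointwise: "(kernel_majorant M \<kappa> S l)\<^sup>2 \<le> c\<^sup>2 * (\<integral>\<^sup>+n. H l n \<partial>?N)" if l [measurable]: "l \<in> space M" for l
  proof -
    have [measurable]: "(\<lambda>n. H l n) \<in> borel_measurable M" "(\<lambda>n. I l n) \<in> borel_measurable M"
      using measurable_compose[OF _ H2, of "\<lambda>n. (l, n)" M] measurable_compose[OF _ I2, of "\<lambda>n. (l, n)" M] by simp_all
    have "kernel_majorant M \<kappa> S l = (\<integral>\<^sup>+n. (\<integral>\<^sup>+s. ennreal (S n) * (ennreal \<bar>\<kappa> l n s\<bar> * ennreal (S s)) \<partial>?N) \<partial>?N)"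
      unfolding kernel_majorant_def using S0
      by (intro nn_integral_cong) (simp add: ennreal_mult mult_ac)
    also have "\<dots> = (\<integral>\<^sup>+n. ennreal (S n) * I l n \<partial>?N)"
      unfolding I_def by (intro nn_integral_cong nn_integral_cmult) simp
    finally have "(kernel_majorant M \<kappa> S l)\<^sup>2 = (\<integral>\<^sup>+n. ennreal (S n) * I l n \<partial>?N)\<^sup>2" by simp
    also have "\<dots> \<le> (\<integral>\<^sup>+n. (ennreal (S n))\<^sup>2 \<partial>?N) * (\<integral>\<^sup>+n. (I l n)\<^sup>2 \<partial>?N)"
      by (rule Cauchy_Schwarz_nn_integral) measurable
    also have "\<dots> \<le> c * (\<integral>\<^sup>+n. H l n * c \<partial>?N)"
    proof (intro mult_mono S_N nn_integral_mono)
      fix n assume "n \<in> space ?N"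
      then have [measurable]: "n \<in> space M" by simp
      have "(I l n)\<^sup>2 \<le> (\<integral>\<^sup>+s. (ennreal \<bar>\<kappa> l n s\<bar>)\<^sup>2 \<partial>?N) * (\<integral>\<^sup>+s. (ennreal (S s))\<^sup>2 \<partial>?N)"
        unfolding I_def by (rule Cauchy_Schwarz_nn_integral) measurable
      also have "\<dots> \<le> H l n * c"
        unfolding H_def by (intro mult_mono S_N) (auto simp: ennreal_power)
      finally show "(I l n)\<^sup>2 \<le> H l n * c" .
    qed auto
    also have "\<dots> = c\<^sup>2 * (\<integral>\<^sup>+n. H l n \<partial>?N)"
      by (subst nn_integral_multc) (auto simp: power2_eq_square mult_ac)
    finally show ?thesis .
  qed
  have [measurable]: "(\<lambda>l. \<integral>\<^sup>+n. H l n \<partial>?N) \<in> borel_measurable M"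
    by (rule nn_integral_support_measurable[OF S fin H2])
  have "(\<integral>\<^sup>+l. (kernel_majorant M \<kappa> S l)\<^sup>2 \<partial>M) \<le> (\<integral>\<^sup>+l. c\<^sup>2 * (\<integral>\<^sup>+n. H l n \<partial>?N) \<partial>M)"
    by (intro nn_integral_mono pointwise)
  also have "\<dots> = c\<^sup>2 * (\<integral>\<^sup>+l. (\<integral>\<^sup>+n. H l n \<partial>?N) \<partial>M)"
    by (rule nn_integral_cmult) measurable
  also have "\<dots> \<le> c\<^sup>2 * (\<integral>\<^sup>+ l. (\<integral>\<^sup>+ n. (\<integral>\<^sup>+ s. ennreal (\<bar>\<kappa> l n s\<bar>\<^sup>2) \<partial>M) \<partial>M) \<partial>M)"
  proof (intro mult_left_mono nn_integral_mono)
    fix l assume l [measurable]: "l \<in> space M"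
    have [measurable]: "(\<lambda>n. H l n) \<in> borel_measurable M"
      using measurable_compose[OF _ H2, of "\<lambda>n. (l, n)" M] by simp
    have "(\<integral>\<^sup>+n. H l n \<partial>?N) \<le> (\<integral>\<^sup>+n. H l n \<partial>M)" by (rule nn_integral_support_le) measurable
    also have "\<dots> \<le> (\<integral>\<^sup>+ n. (\<integral>\<^sup>+ s. ennreal (\<bar>\<kappa> l n s\<bar>\<^sup>2) \<partial>M) \<partial>M)"
      unfolding H_def
    proof (intro nn_integral_mono nn_integral_support_le)
      fix n assume [measurable]: "n \<in> space M"
      show "(\<lambda>s. ennreal (\<bar>\<kappa> l n s\<bar>\<^sup>2)) \<in> borel_measurable M" by measurable
    qed measurable
    finally show "(\<integral>\<^sup>+n. H l n \<partial>?N) \<le> (\<integral>\<^sup>+ n. (\<integral>\<^sup>+ s. ennreal (\<bar>\<kappa> l n s\<bar>\<^sup>2) \<partial>M) \<partial>M)" .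
  qed simp
  finally show ?thesis .
qed

text \<open>
  The coordinates of \<open>D\<close> are iterated integrals over \<open>M\<close>, which need not depend measurably on
  parameters. Since \<open>f\<close> vanishes off the support of \<open>S\<close>, they may be replaced by integrals over the
  support; the equality holds at every point \<open>l\<close> of the space.
\<close>

lemma kernel_integral_support:
  fixes \<kappa> :: "'l \<Rightarrow> 'l \<Rightarrow> 'l \<Rightarrow> real" and S f g :: "'l \<Rightarrow> real"
  assumes \<kappa>: "(\<lambda>(l, n, s). \<kappa> l n s) \<in> borel_measurable (M \<Otimes>\<^sub>M (M \<Otimes>\<^sub>M M))"
    and S [measurable]: "S \<in> borel_measurable M" and fin: "(\<integral>\<^sup>+l. ennreal ((S l)\<^sup>2) \<partial>M) < \<infinity>"
    and [measurable]: "g \<in> borel_measurable M" "f \<in> borel_measurable M" and eq: "AE l in M. g l = f l"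
    and zero: "\<And>l. l \<in> space M \<Longrightarrow> S l = 0 \<Longrightarrow> f l = 0" and l [measurable]: "l \<in> space M"
  shows "(\<integral>n. (\<integral>s. \<kappa> l n s * g n * g s \<partial>M) \<partial>M)
    = (\<integral>n. (\<integral>s. \<kappa> l n s * f n * f s \<partial>support_measure M S) \<partial>support_measure M S)"
proof -
  note [measurable] = kernel_measurable[OF \<kappa>]
  let ?N = "support_measure M S"
  define I where "I n = (\<integral>s. \<kappa> l n s * f s \<partial>?N)" for n
  have [measurable]: "(\<lambda>n. I n) \<in> borel_measurable M"
    unfolding I_def by (rule integral_support_measurable[OF S fin]) measurable
  have inner: "(\<integral>s. \<kappa> l n s * g n * g s \<partial>M) = g n * I n" if [measurable]: "n \<in> space M" for n
  proof -
    have "(\<integral>s. \<kappa> l n s * g n * g s \<partial>M) = (\<integral>s. g n * (\<kappa> l n s * g s) \<partial>M)" by (simp add: mult_ac)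
    also have "\<dots> = g n * (\<integral>s. \<kappa> l n s * g s \<partial>M)" by (rule integral_mult_right_zero)
    also have "(\<integral>s. \<kappa> l n s * g s \<partial>M) = (\<integral>s. \<kappa> l n s * f s \<partial>M)"
      using eq by (intro integral_cong_AE) (auto elim: eventually_mono)
    also have "\<dots> = I n"
      unfolding I_def by (rule integral_support_eq[symmetric]) (auto simp: zero)
    finally show ?thesis .
  qed
  have "(\<integral>n. (\<integral>s. \<kappa> l n s * g n * g s \<partial>M) \<partial>M) = (\<integral>n. g n * I n \<partial>M)"
    by (rule Bochner_Integration.integral_cong) (auto simp: inner)
  also have "\<dots> = (\<integral>n. f n * I n \<partial>M)"
    using eq by (intro integral_cong_AE) (auto elim: eventually_mono)
  also have "\<dots> = (\<integral>n. f n * I n \<partial>?N)"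
    by (rule integral_support_eq[symmetric]) (auto simp: zero)
  also have "\<dots> = (\<integral>n. (\<integral>s. \<kappa> l n s * f n * f s \<partial>?N) \<partial>?N)"
  proof (rule Bochner_Integration.integral_cong)
    fix n
    have "f n * I n = (\<integral>s. f n * (\<kappa> l n s * f s) \<partial>?N)"
      unfolding I_def by (rule integral_mult_right_zero[symmetric])
    then show "f n * I n = (\<integral>s. \<kappa> l n s * f n * f s \<partial>?N)" by (simp add: mult_ac)
  qed simp
  finally show ?thesis .
qed

context spectral_space
begin

text \<open>
  Off a null set of \<open>l\<close>, where the kernel majorant is infinite and everything is set to zero, the iterated
  integrals are a jointly measurable version of \<open>D(v x, v x)\<close> that is bounded by the kernel majorant.
\<close>

lemma has_kernel_majorized:
  assumes ker: "has_kernel M co D \<kappa>" and v: "majorized v F S c"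
    and G: "(\<integral>\<^sup>+l. (kernel_majorant M \<kappa> S l)\<^sup>2 \<partial>M) \<le> ennreal (d\<^sup>2)" and d: "0 \<le> d"
  shows "\<exists>W T. majorized (D_star D v v) W T d"
proof -
  have \<kappa>: "(\<lambda>(l, n, s). \<kappa> l n s) \<in> borel_measurable (M \<Otimes>\<^sub>M (M \<Otimes>\<^sub>M M))"
    using ker unfolding has_kernel_def by blast
  note v = majorizedD[OF v]
  note [measurable] = kernel_measurable[OF \<kappa>] v(2,4)
  have fin: "(\<integral>\<^sup>+l. ennreal ((S l)\<^sup>2) \<partial>M) < \<infinity>" using v(3) by (auto intro: le_less_trans)
  let ?N = "support_measure M S" and ?G = "kernel_majorant M \<kappa> S"
  have [measurable]: "?G \<in> borel_measurable M" by (rule kernel_majorant_measurable[OF \<kappa> v(2) fin])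
  have "(\<integral>\<^sup>+l. (?G l)\<^sup>2 \<partial>M) \<noteq> \<infinity>" using G by (auto simp: top_unique)
  then have "AE l in M. (?G l)\<^sup>2 \<noteq> \<infinity>" by (intro nn_integral_PInf_AE) auto
  then have G_fin: "AE l in M. ?G l < \<infinity>"
    by eventually_elim (auto simp: power2_eq_square ennreal_mult_eq_top_iff less_top)
  define I where "I x l = (\<integral>n. (\<integral>s. \<kappa> l n s * F x n * F x s \<partial>?N) \<partial>?N)" for x l
  have "(\<lambda>p. \<integral>n. (\<integral>s. \<kappa> (snd p) n s * F (fst p) n * F (fst p) s \<partial>?N) \<partial>?N) \<in> borel_measurable (borel \<Otimes>\<^sub>M M)"
    by (intro integral_support_measurable[OF v(2) fin]) measurable
  then have [measurable]: "(\<lambda>(x, l). I x l) \<in> borel_measurable (borel \<Otimes>\<^sub>M M)"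
    unfolding I_def by (simp add: case_prod_beta')
  have I_le: "ennreal \<bar>I x l\<bar> \<le> ?G l" if x: "0 \<le> x" for x l
  proof -
    have "ennreal \<bar>I x l\<bar> \<le> (\<integral>\<^sup>+n. ennreal \<bar>\<integral>s. \<kappa> l n s * F x n * F x s \<partial>?N\<bar> \<partial>?N)"
      unfolding I_def by (rule ennreal_abs_integral_le)
    also have "\<dots> \<le> (\<integral>\<^sup>+n. (\<integral>\<^sup>+s. ennreal \<bar>\<kappa> l n s * F x n * F x s\<bar> \<partial>?N) \<partial>?N)"
      by (intro nn_integral_mono ennreal_abs_integral_le)
    also have "\<dots> \<le> ?G l"
      unfolding kernel_majorant_def
    proof (intro nn_integral_mono ennreal_leI)
      fix n s assume "n \<in> space ?N" "s \<in> space ?N"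
      then have ns: "n \<in> space M" "s \<in> space M" by simp_all
      show "\<bar>\<kappa> l n s * F x n * F x s\<bar> \<le> \<bar>\<kappa> l n s\<bar> * S n * S s"
        unfolding abs_mult
        using v(5)[OF x ns(1)] v(5)[OF x ns(2)] v(7)[OF ns(1)] by (intro mult_mono) auto
    qed
    finally show ?thesis .
  qed
  have I_co: "AE l in M. I x l = co (D_star D v v x) l" if x: "0 \<le> x" for x
  proof -
    have "AE l in M. co (D (v x) (v x)) l = (\<integral>n. (\<integral>s. \<kappa> l n s * co (v x) n * co (v x) s \<partial>M) \<partial>M)"
      using ker unfolding has_kernel_def by (auto elim: eventually_mono)
    then show ?thesis
      using AE_space
    proof eventually_elim
      case (elim l)
      have eq: "AE n in M. co (v x) n = F x n" using v(6)[OF x] by eventually_elim simp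
      have zero: "F x n = 0" if "n \<in> space M" "S n = 0" for n
        using v(5)[OF x that(1)] that(2) by simp
      have "F x \<in> borel_measurable M" by measurable
      from kernel_integral_support[OF \<kappa> v(2) fin co_meas this eq zero elim(2)] elim(1)
      show ?case unfolding I_def D_star_def by simp
    qed
  qed
  define T where "T l = enn2real (?G l)" for l
  define W where "W x l = (if ?G l < \<infinity> then I x l else 0)" for x l
  have "majorized (D_star D v v) W T d"
    unfolding majorized_def
  proof (intro conjI allI impI ballI d)
    show "T \<in> borel_measurable M" unfolding T_def by measurable
    have "(\<integral>\<^sup>+l. ennreal ((T l)\<^sup>2) \<partial>M) = (\<integral>\<^sup>+l. (?G l)\<^sup>2 \<partial>M)"
      using G_fin by (intro nn_integral_cong_AE) (auto elim!: eventually_mono simp: T_def simp flip: ennreal_power)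
    then show "(\<integral>\<^sup>+l. ennreal ((T l)\<^sup>2) \<partial>M) \<le> ennreal (d\<^sup>2)" using G by simp
    show "(\<lambda>(x, l). W x l) \<in> borel_measurable (borel \<Otimes>\<^sub>M M)" unfolding W_def by measurable
    show "\<bar>W x l\<bar> \<le> T l" if "0 \<le> x" for x l
    proof (cases "?G l < \<infinity>")
      case True
      then have "enn2real (ennreal \<bar>I x l\<bar>) \<le> enn2real (?G l)" using I_le[OF that] by (intro enn2real_mono) auto
      then show ?thesis using True by (simp add: W_def T_def)
    qed (simp add: W_def T_def)
    show "AE l in M. W x l = co (D_star D v v x) l" if "0 \<le> x" for x
      using I_co[OF that] G_fin by eventually_elim (simp add: W_def)
  qed
  then show ?thesis by blast
qed

text \<open>
  The reverse norm is the infimum of the constants \<open>c\<close> for which \<open>v\<close> is majorized, so the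
  quadratic bound passes to the limit.
\<close>

lemma closed_under_D_star_if_majorized:
  assumes K: "0 \<le> K" and maj: "\<And>v F S c. majorized v F S c \<Longrightarrow> \<exists>W T. majorized (D_star D v v) W T (K * c\<^sup>2)"
  shows "closed_under_D_star M co D"
proof -
  have *: "D_star D v v \<in> reverse_space M co \<and> reverse_norm M co (D_star D v v) \<le> K * (reverse_norm M co v + e)\<^sup>2"
    if "v \<in> reverse_space M co" "0 < e" for v e
  proof -
    obtain F S where "majorized v F S (reverse_norm M co v + e)"
      using reverse_space_majorized[OF \<open>v \<in> _\<close>, of "reverse_norm M co v + e"] \<open>0 < e\<close> by auto
    from maj[OF this] obtain W T where "majorized (D_star D v v) W T (K * (reverse_norm M co v + e)\<^sup>2)" by blast
    from majorized_imp_reverse_space[OF this] show ?thesis by simp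
  qed
  have "reverse_norm M co (D_star D v v) \<le> K * (reverse_norm M co v)\<^sup>2" if "v \<in> reverse_space M co" for v
  proof (rule LIMSEQ_le_const)
    have "(\<lambda>n. K * (reverse_norm M co v + inverse (real (Suc n)))\<^sup>2) \<longlonglongrightarrow> K * (reverse_norm M co v + 0)\<^sup>2"
      by (intro tendsto_intros LIMSEQ_inverse_real_of_nat)
    then show "(\<lambda>n. K * (reverse_norm M co v + inverse (real (Suc n)))\<^sup>2) \<longlonglongrightarrow> K * (reverse_norm M co v)\<^sup>2" by simp
    show "\<exists>N. \<forall>n\<ge>N. reverse_norm M co (D_star D v v) \<le> K * (reverse_norm M co v + inverse (real (Suc n)))\<^sup>2"
      using *[OF that] by (intro exI allI impI) (auto simp del: of_nat_Suc)
  qed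
  moreover have "D_star D v v \<in> reverse_space M co" if "v \<in> reverse_space M co" for v
    using *[OF that zero_less_one] by blast
  ultimately show ?thesis unfolding closed_under_D_star_def by blast
qed

lemma closed_if_kernel_square_integrable:
  assumes ker: "has_kernel M co D \<kappa>" and sq: "kernel_square_integrable M \<kappa>"
  shows "closed_under_D_star M co D"
proof -
  have \<kappa>: "(\<lambda>(l, n, s). \<kappa> l n s) \<in> borel_measurable (M \<Otimes>\<^sub>M (M \<Otimes>\<^sub>M M))"
    using ker unfolding has_kernel_def by blast
  let ?Q = "\<integral>\<^sup>+ l. (\<integral>\<^sup>+ n. (\<integral>\<^sup>+ s. ennreal (\<bar>\<kappa> l n s\<bar>\<^sup>2) \<partial>M) \<partial>M) \<partial>M"
  define K where "K = sqrt (enn2real ?Q)"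
  have K: "0 \<le> K" "?Q = ennreal (K\<^sup>2)"
    using sq unfolding kernel_square_integrable_def K_def by simp_all
  show ?thesis
  proof (rule closed_under_D_star_if_majorized[OF K(1)])
    fix v F S c assume v: "majorized v F S c"
    note m = majorizedD[OF v]
    have "(\<integral>\<^sup>+l. (kernel_majorant M \<kappa> S l)\<^sup>2 \<partial>M) \<le> (ennreal (c\<^sup>2))\<^sup>2 * ?Q"
      by (rule kernel_square_bound[OF \<kappa> m(2,7,3)]) auto
    also have "\<dots> = ennreal ((K * c\<^sup>2)\<^sup>2)"
      unfolding K(2) by (simp add: ennreal_power ennreal_mult power_mult_distrib mult.commute)
    finally show "\<exists>W T. majorized (D_star D v v) W T (K * c\<^sup>2)"
      using K(1) by (intro has_kernel_majorized[OF ker v]) auto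
  qed
qed

text \<open>
  Let \<open>h\<close> be the element with coordinates \<open>S\<close>. The kernel majorant of \<open>S\<close> is then the
  coordinate function of \<open>D' h h\<close>, where \<open>D'\<close> has kernel \<open>\<bar>\<kappa>\<bar>\<close>: both are the same iterated integral of a
  nonnegative function, once as a Lebesgue integral with values in \<open>[0, \<infinity>]\<close> and once as an absolutely convergent one.
\<close>

lemma kernel_majorant_eq_co:
  assumes ker: "has_kernel M co D' (\<lambda>l n s. \<bar>\<kappa> l n s\<bar>)"
    and \<kappa>: "(\<lambda>(l, n, s). \<kappa> l n s) \<in> borel_measurable (M \<Otimes>\<^sub>M (M \<Otimes>\<^sub>M M))"
    and S [measurable]: "S \<in> borel_measurable M" and S0: "\<And>l. l \<in> space M \<Longrightarrow> 0 \<le> S l"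
    and h: "AE l in M. co h l = S l"
  shows "AE l in M. kernel_majorant M \<kappa> S l = ennreal (co (D' h h) l) \<and> 0 \<le> co (D' h h) l"
proof -
  note [measurable] = kernel_measurable[OF \<kappa>]
  have fin: "(\<integral>\<^sup>+l. ennreal ((S l)\<^sup>2) \<partial>M) < \<infinity>" using nn_integral_eq_norm[OF h] by simp
  let ?N = "support_measure M S"
  have \<kappa>': "(\<lambda>(l, n, s). \<bar>\<kappa> l n s\<bar>) \<in> borel_measurable (M \<Otimes>\<^sub>M (M \<Otimes>\<^sub>M M))"
    using ker unfolding has_kernel_def by blast
  have "AE l in M. (\<integral>\<^sup>+ n. (\<integral>\<^sup>+ s. ennreal \<bar>\<bar>\<kappa> l n s\<bar> * co h n * co h s\<bar> \<partial>M) \<partial>M) < \<infinity> \<and>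
        co (D' h h) l = (\<integral>n. (\<integral>s. \<bar>\<kappa> l n s\<bar> * co h n * co h s \<partial>M) \<partial>M)"
    using ker unfolding has_kernel_def by blast
  then show ?thesis
    using AE_space
  proof eventually_elim
    case (elim l)
    note l [measurable] = elim(2)
    define J where "J n = (\<integral>\<^sup>+s. ennreal (\<bar>\<kappa> l n s\<bar> * S n * S s) \<partial>?N)" for n
    have Jm [measurable]: "(\<lambda>n. J n) \<in> borel_measurable M"
      unfolding J_def by (rule nn_integral_support_measurable[OF S fin]) measurable
    have J_int: "kernel_majorant M \<kappa> S l = (\<integral>\<^sup>+n. J n \<partial>?N)"
      unfolding kernel_majorant_def J_def ..
    have "kernel_majorant M \<kappa> S l \<le> (\<integral>\<^sup>+n. J n \<partial>M)"
      unfolding J_int by (rule nn_integral_support_le) measurable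
    also have "\<dots> \<le> (\<integral>\<^sup>+n. (\<integral>\<^sup>+s. ennreal (\<bar>\<kappa> l n s\<bar> * S n * S s) \<partial>M) \<partial>M)"
      unfolding J_def
    proof (intro nn_integral_mono nn_integral_support_le)
      fix n assume [measurable]: "n \<in> space M"
      show "(\<lambda>s. ennreal (\<bar>\<kappa> l n s\<bar> * S n * S s)) \<in> borel_measurable M" by measurable
    qed measurable
    also have "\<dots> = (\<integral>\<^sup>+ n. (\<integral>\<^sup>+ s. ennreal \<bar>\<bar>\<kappa> l n s\<bar> * co h n * co h s\<bar> \<partial>M) \<partial>M)"
    proof (rule nn_integral_cong_AE)
      show "AE n in M. (\<integral>\<^sup>+s. ennreal (\<bar>\<kappa> l n s\<bar> * S n * S s) \<partial>M)
          = (\<integral>\<^sup>+ s. ennreal \<bar>\<bar>\<kappa> l n s\<bar> * co h n * co h s\<bar> \<partial>M)"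
        using h AE_space
      proof eventually_elim
        case n: (elim n)
        show ?case
        proof (rule nn_integral_cong_AE)
          show "AE s in M. ennreal (\<bar>\<kappa> l n s\<bar> * S n * S s) = ennreal \<bar>\<bar>\<kappa> l n s\<bar> * co h n * co h s\<bar>"
            using h AE_space by eventually_elim (simp add: n(1) abs_mult S0 n(2))
        qed
      qed
    qed
    also have "\<dots> < \<infinity>" using elim(1) by blast
    finally have G: "kernel_majorant M \<kappa> S l < \<infinity>" .
    have "AE n in ?N. J n \<noteq> \<infinity>"
      using G unfolding J_int by (intro nn_integral_PInf_AE) auto
    then have J_fin: "AE n in ?N. ennreal (enn2real (J n)) = J n"
      by eventually_elim (simp add: less_top)
    have "co (D' h h) l = (\<integral>n. (\<integral>s. \<bar>\<kappa> l n s\<bar> * S n * S s \<partial>?N) \<partial>?N)"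
      using kernel_integral_support[OF \<kappa>' S fin co_meas S h _ l] elim(1) by simp
    also have "\<dots> = (\<integral>n. enn2real (J n) \<partial>?N)"
    proof (rule Bochner_Integration.integral_cong)
      fix n assume "n \<in> space ?N"
      then have n [measurable]: "n \<in> space M" by simp
      show "(\<integral>s. \<bar>\<kappa> l n s\<bar> * S n * S s \<partial>?N) = enn2real (J n)"
        unfolding J_def
      proof (rule integral_eq_nn_integral)
        show "AE s in ?N. 0 \<le> \<bar>\<kappa> l n s\<bar> * S n * S s"
          using n S0 by (intro AE_I2) auto
      qed measurable
    qed simp
    also have "\<dots> = enn2real (\<integral>\<^sup>+n. ennreal (enn2real (J n)) \<partial>?N)"
      by (rule integral_eq_nn_integral) auto
    also have "(\<integral>\<^sup>+n. ennreal (enn2real (J n)) \<partial>?N) = kernel_majorant M \<kappa> S l"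
      unfolding J_int using J_fin by (rule nn_integral_cong_AE)
    finally show ?case using G by simp
  qed
qed

lemma closed_if_abs_kernel_bounded:
  assumes ker: "has_kernel M co D \<kappa>" and bd: "abs_kernel_bounded M co \<kappa>"
  shows "closed_under_D_star M co D"
proof -
  have \<kappa>: "(\<lambda>(l, n, s). \<kappa> l n s) \<in> borel_measurable (M \<Otimes>\<^sub>M (M \<Otimes>\<^sub>M M))"
    using ker unfolding has_kernel_def by blast
  obtain D' where D': "bounded_bilinear D'" "has_kernel M co D' (\<lambda>l n s. \<bar>\<kappa> l n s\<bar>)"
    using bd unfolding abs_kernel_bounded_def by blast
  obtain K where K: "0 \<le> K" "\<And>a b. norm (D' a b) \<le> norm a * norm b * K"
    using bounded_bilinear.nonneg_bounded[OF D'(1)] by blast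
  show ?thesis
  proof (rule closed_under_D_star_if_majorized[OF K(1)])
    fix v F S c assume v: "majorized v F S c"
    note m = majorizedD[OF v]
    obtain h where h: "AE l in M. co h l = S l" "norm h \<le> c" using ex_element[OF m(2,3,1)] .
    have "(\<integral>\<^sup>+l. (kernel_majorant M \<kappa> S l)\<^sup>2 \<partial>M) = (\<integral>\<^sup>+l. ennreal ((co (D' h h) l)\<^sup>2) \<partial>M)"
    proof (rule nn_integral_cong_AE)
      have "AE l in M. kernel_majorant M \<kappa> S l = ennreal (co (D' h h) l) \<and> 0 \<le> co (D' h h) l"
        by (rule kernel_majorant_eq_co[OF D'(2) \<kappa> m(2) _ h(1)]) (rule m(7))
      then show "AE l in M. (kernel_majorant M \<kappa> S l)\<^sup>2 = ennreal ((co (D' h h) l)\<^sup>2)"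
        by eventually_elim (simp add: ennreal_power)
    qed
    also have "\<dots> = ennreal ((norm (D' h h))\<^sup>2)" by (rule nn_integral_co)
    also have "\<dots> \<le> ennreal ((K * c\<^sup>2)\<^sup>2)"
    proof (intro ennreal_leI power_mono)
      have "norm (D' h h) \<le> norm h * norm h * K" by (rule K(2))
      also have "\<dots> \<le> c * c * K" using h(2) m(1) K(1) by (intro mult_mono mult_nonneg_nonneg) auto
      finally show "norm (D' h h) \<le> K * c\<^sup>2" by (simp add: power2_eq_square mult_ac)
    qed simp
    finally show "\<exists>W T. majorized (D_star D v v) W T (K * c\<^sup>2)"
      using K(1) by (intro has_kernel_majorized[OF ker v]) auto
  qed
qed

end

section \<open>Stable semigroup, stable projection and translations\<close>

context spectral_space
begin

lemma majorized_shift: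
  assumes u: "majorized u U S c" and x0: "0 \<le> x0"
  shows "majorized (\<lambda>x. u (x0 + x)) (\<lambda>x. U (x0 + x)) S c"
proof -
  note m = majorizedD[OF u]
  note [measurable] = m(4)
  have "(\<lambda>(x, l). U (x0 + x) l) \<in> borel_measurable (borel \<Otimes>\<^sub>M M)" by measurable
  then show ?thesis using u x0 unfolding majorized_def by auto
qed

lemma reverse_norm_shift:
  assumes u: "u \<in> reverse_space M co" and x0: "0 \<le> x0"
  shows "(\<lambda>x. u (x0 + x)) \<in> reverse_space M co" "reverse_norm M co (\<lambda>x. u (x0 + x)) \<le> reverse_norm M co u"
proof -
  have *: "\<exists>U S. majorized (\<lambda>x. u (x0 + x)) U S (reverse_norm M co u + e)" if e: "0 < e" for e
  proof -
    obtain U S where "majorized u U S (reverse_norm M co u + e)"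
      using reverse_space_majorized[OF u, of "reverse_norm M co u + e"] e by auto
    from majorized_shift[OF this x0] show ?thesis by blast
  qed
  show "(\<lambda>x. u (x0 + x)) \<in> reverse_space M co" "reverse_norm M co (\<lambda>x. u (x0 + x)) \<le> reverse_norm M co u"
    by (rule reverse_norm_leI, erule *)+
qed

text \<open>
  The projection is multiplication of the coordinates by the indicator of \<open>\<gamma> > 0\<close>.
\<close>

lemma stable_proj_props:
  "stable_proj M co \<gamma> h \<in> stable_subspace M co \<gamma> \<and>
   (AE l in M. co (stable_proj M co \<gamma> h) l = (if 0 < \<gamma> l then co h l else 0))"
proof -
  have "(\<lambda>l. if 0 < \<gamma> l then co h l else 0) \<in> borel_measurable M" by measurable
  moreover have "AE l in M. \<bar>if 0 < \<gamma> l then co h l else 0\<bar> \<le> \<bar>co h l\<bar>" by simp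
  ultimately obtain p where p: "AE l in M. co p l = (if 0 < \<gamma> l then co h l else 0)"
    using ex_dominated_element by blast
  have pV: "p \<in> stable_subspace M co \<gamma>"
    unfolding stable_subspace_def using p by (auto elim!: eventually_mono)
  have orth: "inner (h - p) v = 0" if "v \<in> stable_subspace M co \<gamma>" for v
  proof (rule inner_eq_0)
    have "AE l in M. \<not> 0 < \<gamma> l \<longrightarrow> co v l = 0" using that unfolding stable_subspace_def by simp
    then show "AE l in M. co (h - p) l * co v l = 0"
      using p co_diff[of h p] by eventually_elim (auto split: if_splits)
  qed
  have "stable_proj M co \<gamma> h = p"
    unfolding orth_proj_def
  proof (rule the_equality)
    show "p \<in> stable_subspace M co \<gamma> \<and> (\<forall>v\<in>stable_subspace M co \<gamma>. inner (h - p) v = 0)"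
      using pV orth by blast
    fix q assume q: "q \<in> stable_subspace M co \<gamma> \<and> (\<forall>v\<in>stable_subspace M co \<gamma>. inner (h - q) v = 0)"
    have "AE l in M. \<not> 0 < \<gamma> l \<longrightarrow> co q l = 0" using q unfolding stable_subspace_def by simp
    then have "AE l in M. \<not> 0 < \<gamma> l \<longrightarrow> co (p - q) l = 0"
      using p co_diff[of p q] by eventually_elim simp
    then have d: "p - q \<in> stable_subspace M co \<gamma>" unfolding stable_subspace_def by simp
    have "inner (h - q) (p - q) = 0" using q d by blast
    moreover have "inner (h - p) (p - q) = 0" by (rule orth[OF d])
    moreover have "inner (p - q) (p - q) = inner (h - q) (p - q) - inner (h - p) (p - q)"
      by (simp flip: inner_diff_left)
    ultimately have "inner (p - q) (p - q) = 0" by simp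
    then show "q = p" by simp
  qed
  then show ?thesis using p pV by simp
qed

lemmas stable_proj_mem = stable_proj_props[THEN conjunct1]
  and co_stable_proj = stable_proj_props[THEN conjunct2]

lemma stable_proj_id:
  assumes "h \<in> stable_subspace M co \<gamma>"
  shows "stable_proj M co \<gamma> h = h"
proof (rule co_inj)
  have "AE l in M. \<not> 0 < \<gamma> l \<longrightarrow> co h l = 0" using assms unfolding stable_subspace_def by simp
  then show "AE l in M. co (stable_proj M co \<gamma> h) l = co h l"
    using co_stable_proj[of h] by eventually_elim auto
qed

definition semigroup_coords :: "'h \<Rightarrow> real \<Rightarrow> 'l \<Rightarrow> real" where
  "semigroup_coords h x l = (if 0 < \<gamma> l \<and> 0 \<le> x then exp (- x / \<gamma> l) * co h l else 0)"

lemma semigroup_majorized: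
  "majorized (\<lambda>x. stable_semigroup M co \<gamma> x (stable_proj M co \<gamma> h)) (semigroup_coords h)
     (\<lambda>l. \<bar>co h l\<bar>) (norm h)"
  unfolding majorized_def
proof (intro conjI allI impI ballI)
  show "(\<integral>\<^sup>+ l. ennreal (\<bar>co h l\<bar>\<^sup>2) \<partial>M) \<le> ennreal ((norm h)\<^sup>2)"
    using nn_integral_co[of h] by simp
  have [measurable]: "(\<lambda>(x, l). semigroup_coords h x l) \<in> borel_measurable (borel \<Otimes>\<^sub>M M)"
    unfolding semigroup_coords_def by measurable
  then show "(\<lambda>(x, l). semigroup_coords h x l) \<in> borel_measurable (borel \<Otimes>\<^sub>M M)" .
  show le: "\<bar>semigroup_coords h x l\<bar> \<le> \<bar>co h l\<bar>" for x l
    by (auto simp: semigroup_coords_def abs_mult intro!: mult_left_le_one_le)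
  fix x :: real assume x: "0 \<le> x"
  have "semigroup_coords h x \<in> borel_measurable M" by measurable
  moreover have "AE l in M. \<bar>semigroup_coords h x l\<bar> \<le> \<bar>co h l\<bar>" using le by simp
  ultimately obtain w where w: "AE l in M. co w l = semigroup_coords h x l"
    using ex_dominated_element by blast
  have "stable_semigroup M co \<gamma> x (stable_proj M co \<gamma> h) = w"
    unfolding stable_semigroup_def
  proof (rule of_coords_eq)
    show "AE l in M. co w l = exp (- x / \<gamma> l) * co (stable_proj M co \<gamma> h) l"
      using w co_stable_proj[of h] by eventually_elim (simp add: semigroup_coords_def x)
  qed
  then show "AE l in M. semigroup_coords h x l = co (stable_semigroup M co \<gamma> x (stable_proj M co \<gamma> h)) l"
    using w by (auto elim!: eventually_mono)
qed auto

lemmas co_semigroup = majorizedD(6)[OF semigroup_majorized]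

lemma semigroup_comb:
  assumes x: "0 \<le> x"
  shows "stable_semigroup M co \<gamma> x (stable_proj M co \<gamma> (a *\<^sub>R g + b *\<^sub>R h)) =
    a *\<^sub>R stable_semigroup M co \<gamma> x (stable_proj M co \<gamma> g)
    + b *\<^sub>R stable_semigroup M co \<gamma> x (stable_proj M co \<gamma> h)" (is "?l = a *\<^sub>R ?g + b *\<^sub>R ?h")
proof (rule co_inj)
  show "AE l in M. co ?l l = co (a *\<^sub>R ?g + b *\<^sub>R ?h) l"
    using co_semigroup[OF x, of "a *\<^sub>R g + b *\<^sub>R h"] co_semigroup[OF x, of g] co_semigroup[OF x, of h]
      co_comb[of a g b h] co_comb[of a ?g b ?h]
  proof eventually_elim
    case (elim l)
    show ?case
      unfolding elim(5) elim(1)[symmetric] elim(2)[symmetric] elim(3)[symmetric]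
      by (simp add: semigroup_coords_def elim(4) algebra_simps)
  qed
qed

lemma semigroup_zero:
  assumes "h \<in> stable_subspace M co \<gamma>"
  shows "stable_semigroup M co \<gamma> 0 (stable_proj M co \<gamma> h) = h"
proof (rule co_inj)
  have "AE l in M. \<not> 0 < \<gamma> l \<longrightarrow> co h l = 0" using assms unfolding stable_subspace_def by simp
  then show "AE l in M. co (stable_semigroup M co \<gamma> 0 (stable_proj M co \<gamma> h)) l = co h l"
    using co_semigroup[OF order_refl, of h]
  proof eventually_elim
    case (elim l)
    show ?case
      unfolding elim(2)[symmetric] using elim(1) by (simp add: semigroup_coords_def)
  qed
qed

text \<open>
  At \<open>x = 0\<close> only \<open>y \<ge> 0\<close> contributes, where \<open>0 - y\<close> is not positive; so only the branch of the kernel for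
  \<open>\<gamma> < 0\<close> is left.
\<close>

lemma K_plus_zero_unstable:
  assumes f: "f \<in> reverse_space M co"
  shows "K_plus M co \<gamma> f 0 \<in> unstable_subspace M co \<gamma>"
proof -
  obtain F S where F: "majorized f F S (reverse_norm M co f + 1)"
    using reverse_space_majorized[OF f, of "reverse_norm M co f + 1"] by auto
  have zero: "K_coords F 0 l = 0" if "\<not> \<gamma> l < 0" for l
  proof -
    have "(\<lambda>y. resolvent_kernel \<gamma> (0 - y) l * (indicator {0..} y * F y l)) = (\<lambda>y. 0)"
      using that by (auto simp: resolvent_kernel_def indicator_def)
    then show ?thesis unfolding K_coords_def by simp
  qed
  then have "AE l in M. \<not> \<gamma> l < 0 \<longrightarrow> co (K_plus M co \<gamma> f 0) l = 0"
    using co_K_plus[OF F order_refl] by eventually_elim (simp add: zero)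
  then show ?thesis unfolding unstable_subspace_def by simp
qed

lemma stable_proj_graph:
  assumes h: "h \<in> stable_subspace M co \<gamma>" and k: "k \<in> unstable_subspace M co \<gamma>"
  shows "stable_proj M co \<gamma> (h + k) = h"
proof (rule co_inj)
  have "AE l in M. \<not> 0 < \<gamma> l \<longrightarrow> co h l = 0" using h unfolding stable_subspace_def by simp
  moreover have "AE l in M. \<not> \<gamma> l < 0 \<longrightarrow> co k l = 0" using k unfolding unstable_subspace_def by simp
  ultimately show "AE l in M. co (stable_proj M co \<gamma> (h + k)) l = co h l"
    using co_stable_proj[of "h + k"] co_add[of h k] by eventually_elim auto
qed

text \<open>
  Splitting the integral over \<open>[0, \<infinity>)\<close> at \<open>x0\<close>. Where \<open>\<gamma> > 0\<close> the kernel is multiplicative,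
  \<open>k(x + z) = exp(-x / \<gamma>) k(z)\<close> for \<open>z > 0\<close>, so the part over \<open>[0, x0)\<close> is the value at \<open>x0\<close> transported by
  the semigroup. Where \<open>\<gamma> < 0\<close> the kernel only looks forward and this part does not contribute.
\<close>

lemma K_coords_shift:
  assumes F: "majorized f F S c" and l: "l \<in> space M" and x0: "0 \<le> x0" and x: "0 \<le> x"
  shows "K_coords F (x0 + x) l =
    (if 0 < \<gamma> l then exp (- x / \<gamma> l) * K_coords F x0 l else 0) + K_coords (\<lambda>y. F (x0 + y)) x l"
proof -
  have affine: "K_coords F z l =
      (\<integral>y. resolvent_kernel \<gamma> (z - (x0 + y)) l * (indicator {0..} (x0 + y) * F (x0 + y) l) \<partial>lborel)" for z
    using lborel_integral_real_affine[of 1 "\<lambda>y. resolvent_kernel \<gamma> (z - y) l * (indicator {0..} y * F y l)" x0]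
    unfolding K_coords_def by simp
  show ?thesis
  proof (cases "0 < \<gamma> l")
    case False
    have "K_coords F (x0 + x) l = K_coords (\<lambda>y. F (x0 + y)) x l"
      unfolding affine unfolding K_coords_def
      using False x0 x by (intro Bochner_Integration.integral_cong) (auto simp: resolvent_kernel_def indicator_def)
    then show ?thesis using False by simp
  next
    case True
    let ?p = "\<lambda>y. resolvent_kernel \<gamma> (x0 - (x0 + y)) l * (indicator {0..} (x0 + y) * F (x0 + y) l)"
    let ?q = "\<lambda>y. resolvent_kernel \<gamma> (x - y) l * (indicator {0..} y * F (x0 + y) l)"
    have p: "integrable lborel ?p"
      using lborel_integrable_real_affine[OF K_integrand(1)[OF F l, of x0], of 1 x0] by simp
    have q: "integrable lborel ?q"
      by (rule K_integrand(1)[OF majorized_shift[OF F x0] l])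
    have "exp (- x / \<gamma> l) * K_coords F x0 l + K_coords (\<lambda>y. F (x0 + y)) x l
        = (\<integral>y. exp (- x / \<gamma> l) * ?p y + ?q y \<partial>lborel)"
      using p q unfolding affine[of x0] unfolding K_coords_def by simp
    also have "\<dots> = K_coords F (x0 + x) l"
      unfolding affine[of "x0 + x"]
    proof (intro Bochner_Integration.integral_cong refl)
      fix y
      have shift: "x0 + x - (x0 + y) = x - y" "x0 - (x0 + y) = - y" by simp_all
      show "exp (- x / \<gamma> l) * ?p y + ?q y
          = resolvent_kernel \<gamma> (x0 + x - (x0 + y)) l * (indicator {0..} (x0 + y) * F (x0 + y) l)"
      proof (cases "y < 0")
        case y: True
        have "- x / \<gamma> l + - (- y) / \<gamma> l = - (x - y) / \<gamma> l"
          unfolding add_divide_distrib[symmetric] by simp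
        then have "exp (- x / \<gamma> l) * (exp (- (- y) / \<gamma> l) / \<gamma> l) = exp (- (x - y) / \<gamma> l) / \<gamma> l"
          by (simp only: times_divide_eq_right exp_add[symmetric])
        moreover have "0 < x - y" "0 < - y" using x y by auto
        ultimately have "resolvent_kernel \<gamma> (x - y) l = exp (- x / \<gamma> l) * resolvent_kernel \<gamma> (- y) l"
          using True unfolding resolvent_kernel_def by (simp only: if_True simp_thms)
        moreover have "indicator {0..} y = (0::real)" using y by simp
        ultimately show ?thesis unfolding shift by (simp only: mult.assoc mult_zero_left mult_zero_right add_0_right)
      next
        case y: False
        then have "resolvent_kernel \<gamma> (- y) l = 0" using True by (simp add: resolvent_kernel_def)
        moreover have "indicator {0..} y = (1::real)" "indicator {0..} (x0 + y) = (1::real)" using y x0 by simp_all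
        ultimately show ?thesis unfolding shift by (simp only: mult_zero_left mult_zero_right add_0_left)
      qed
    qed
    finally show ?thesis using True by simp
  qed
qed

text \<open>
  The variation-of-constants formula may be restarted at \<open>x0\<close>. Here \<open>g\<close> stands for \<open>D\<^sub>*(u, u)\<close>.
\<close>

lemma shifted_mild_solution:
  assumes g: "g \<in> reverse_space M co" and x0: "0 \<le> x0" and x: "0 \<le> x"
    and u: "\<And>x. 0 \<le> x \<Longrightarrow> u x = stable_semigroup M co \<gamma> x (stable_proj M co \<gamma> h) + K_plus M co \<gamma> g x"
  shows "u (x0 + x) = stable_semigroup M co \<gamma> x (stable_proj M co \<gamma> (u x0)) + K_plus M co \<gamma> (\<lambda>y. g (x0 + y)) x"
    (is "_ = ?T + ?K")
proof (rule co_inj)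
  obtain G S where G: "majorized g G S (reverse_norm M co g + 1)"
    using reverse_space_majorized[OF g, of "reverse_norm M co g + 1"] by auto
  have co_u: "AE l in M. co (u y) l = semigroup_coords h y l + K_coords G y l" if "0 \<le> y" for y
    using co_add[of "stable_semigroup M co \<gamma> y (stable_proj M co \<gamma> h)" "K_plus M co \<gamma> g y"]
      co_semigroup[OF that, of h] co_K_plus[OF G that]
    by eventually_elim (simp add: u[OF that])
  have "0 \<le> x0 + x" using x0 x by simp
  from co_u[OF this] co_u[OF x0] co_add[of ?T ?K] co_semigroup[OF x, of "u x0"]
    co_K_plus[OF majorized_shift[OF G x0] x] AE_space
  show "AE l in M. co (u (x0 + x)) l = co (?T + ?K) l"
  proof eventually_elim
    case (elim l)
    have "semigroup_coords (u x0) x l = (if 0 < \<gamma> l then exp (- x / \<gamma> l) * co (u x0) l else 0)"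
      using x by (simp add: semigroup_coords_def)
    moreover have "exp (- (x0 + x) / \<gamma> l) = exp (- x / \<gamma> l) * exp (- x0 / \<gamma> l)"
      unfolding exp_add[symmetric] add_divide_distrib[symmetric] by simp
    then have "semigroup_coords h (x0 + x) l
        = (if 0 < \<gamma> l then exp (- x / \<gamma> l) * semigroup_coords h x0 l else 0)"
      using x x0 by (simp add: semigroup_coords_def)
    ultimately show ?case
      using elim K_coords_shift[OF G elim(6) x0 x] by (simp add: distrib_left)
  qed
qed

end

locale spectral_equation = spectral_space M co \<gamma>
  for M :: "'l measure" and co :: "'h::{real_inner,banach} \<Rightarrow> 'l \<Rightarrow> real" and \<gamma> +
  fixes D :: "'h \<Rightarrow> 'h \<Rightarrow> 'h"
  assumes D_bilinear: "bounded_bilinear D"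
    and D_closed: "closed_under_D_star M co D"
begin

sublocale D: bounded_bilinear D by (rule D_bilinear)

text \<open>
  Closedness under \<open>D\<^sub>*\<close> bounds only the quadratic map \<open>D\<^sub>*(v, v)\<close>, which determines \<open>D\<close> up to its
  antisymmetric part; so the symmetric part is used in place of \<open>D\<close>.
\<close>

definition symmetrized :: "(real \<Rightarrow> 'h) \<Rightarrow> (real \<Rightarrow> 'h) \<Rightarrow> real \<Rightarrow> 'h" where
  "symmetrized u v x = (1/2) *\<^sub>R (D (u x) (v x) + D (v x) (u x))"

lemma symmetrized_self: "symmetrized u u = D_star D u u"
  unfolding symmetrized_def D_star_def by (simp add: fun_eq_iff flip: scaleR_2)

lemma symmetrized_commute: "symmetrized u v = symmetrized v u"
  unfolding symmetrized_def by (simp add: fun_eq_iff add.commute)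

lemma symmetrized_comb: "symmetrized (\<lambda>x. a *\<^sub>R u x + b *\<^sub>R v x) w = (\<lambda>x. a *\<^sub>R symmetrized u w x + b *\<^sub>R symmetrized v w x)"
  unfolding symmetrized_def
  by (simp add: fun_eq_iff D.add_left D.add_right D.scaleR_left D.scaleR_right scaleR_right_distrib algebra_simps)

lemma symmetrized_polarization:
  "symmetrized u v = (\<lambda>x. (1/4) *\<^sub>R D_star D (\<lambda>x. u x + v x) (\<lambda>x. u x + v x) x
     + (- 1/4) *\<^sub>R D_star D (\<lambda>x. u x + (- 1) *\<^sub>R v x) (\<lambda>x. u x + (- 1) *\<^sub>R v x) x)"
proof
  fix x
  have "D (u x + v x) (u x + v x) - D (u x + (- 1) *\<^sub>R v x) (u x + (- 1) *\<^sub>R v x)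
      = 2 *\<^sub>R (D (u x) (v x) + D (v x) (u x))"
    by (simp add: D.add_left D.add_right D.minus_left D.minus_right D.diff_left D.diff_right scaleR_2)
  then have "(1/4) *\<^sub>R (D (u x + v x) (u x + v x) - D (u x + (- 1) *\<^sub>R v x) (u x + (- 1) *\<^sub>R v x))
      = symmetrized u v x" unfolding symmetrized_def by simp
  then show "symmetrized u v x = (1/4) *\<^sub>R D_star D (\<lambda>x. u x + v x) (\<lambda>x. u x + v x) x
     + (- 1/4) *\<^sub>R D_star D (\<lambda>x. u x + (- 1) *\<^sub>R v x) (\<lambda>x. u x + (- 1) *\<^sub>R v x) x"
    unfolding D_star_def by (simp add: scaleR_diff_right)
qed

text \<open>
  Polarization bounds the symmetric part by a multiple of \<open>(\<parallel>u\<parallel> + \<parallel>v\<parallel>)\<^sup>2\<close>, and normalizing \<open>u\<close> and \<open>v\<close>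
  turns this into a multiple of \<open>\<parallel>u\<parallel> \<parallel>v\<parallel>\<close>. If one of the norms is zero that function vanishes on the
  half line, and so does the product.
\<close>

lemma symmetrized_bound:
  "\<exists>C>0. \<forall>u\<in>reverse_space M co. \<forall>v\<in>reverse_space M co. symmetrized u v \<in> reverse_space M co \<and>
     reverse_norm M co (symmetrized u v) \<le> C * reverse_norm M co u * reverse_norm M co v"
proof -
  let ?H = "reverse_space M co" and ?N = "reverse_norm M co"
  obtain C0 where C0: "\<And>v. v \<in> ?H \<Longrightarrow> ?N (D_star D v v) \<le> C0 * (?N v)\<^sup>2"
    and mem: "\<And>v. v \<in> ?H \<Longrightarrow> D_star D v v \<in> ?H"
    using D_closed unfolding closed_under_D_star_def by blast
  define C where "C = \<bar>C0\<bar> + 1"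
  have C: "0 < C" unfolding C_def by simp
  have quad: "?N (D_star D v v) \<le> C * (?N v)\<^sup>2" if "v \<in> ?H" for v
    using C0[OF that] mult_right_mono[of C0 C "(?N v)\<^sup>2"] unfolding C_def by force
  have symmetrized_mem: "symmetrized u v \<in> ?H" and symmetrized_le: "?N (symmetrized u v) \<le> C / 2 * (?N u + ?N v)\<^sup>2"
    if u: "u \<in> ?H" and v: "v \<in> ?H" for u v
  proof -
    let ?p = "\<lambda>x. u x + v x" and ?m = "\<lambda>x. u x + (- 1) *\<^sub>R v x"
    have p: "?p \<in> ?H" "?N ?p \<le> ?N u + ?N v" by (rule reverse_space_add[OF u v])+
    have v': "(\<lambda>x. (- 1) *\<^sub>R v x) \<in> ?H" "?N (\<lambda>x. (- 1) *\<^sub>R v x) \<le> ?N v"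
      using reverse_space_scale[OF v, of "-1"] by simp_all
    have m: "?m \<in> ?H" "?N ?m \<le> ?N u + ?N v"
      using reverse_space_add[OF u v'(1)] v'(2) by auto
    note a = reverse_space_scale[OF mem[OF p(1)], of "1/4"]
    note b = reverse_space_scale[OF mem[OF m(1)], of "-1/4"]
    show "symmetrized u v \<in> ?H" unfolding symmetrized_polarization by (rule reverse_space_add(1)[OF a(1) b(1)])
    have "?N (symmetrized u v) \<le> 1/4 * ?N (D_star D ?p ?p) + 1/4 * ?N (D_star D ?m ?m)"
      unfolding symmetrized_polarization using reverse_space_add(2)[OF a(1) b(1)] a(2) b(2) by simp
    also have "\<dots> \<le> 1/4 * (C * (?N u + ?N v)\<^sup>2) + 1/4 * (C * (?N u + ?N v)\<^sup>2)"
    proof (intro add_mono mult_left_mono)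
      show "?N (D_star D ?p ?p) \<le> C * (?N u + ?N v)\<^sup>2"
        using quad[OF p(1)] C p(2) reverse_norm_nonneg[of ?p]
        by (elim order_trans) (intro mult_left_mono power_mono, auto)
      show "?N (D_star D ?m ?m) \<le> C * (?N u + ?N v)\<^sup>2"
        using quad[OF m(1)] C m(2) reverse_norm_nonneg[of ?m]
        by (elim order_trans) (intro mult_left_mono power_mono, auto)
    qed auto
    finally show "?N (symmetrized u v) \<le> C / 2 * (?N u + ?N v)\<^sup>2" by simp
  qed
  have zero: "?N (symmetrized u v) \<le> 0" if u: "u \<in> ?H" and "?N u = 0" for u v
  proof -
    have "u x = 0" if "0 \<le> x" for x using norm_le_reverse_norm[OF u that] \<open>?N u = 0\<close> by simp
    then have "symmetrized u v x = 0 *\<^sub>R u x" if "0 \<le> x" for x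
      using that by (simp add: symmetrized_def D.zero_left D.zero_right)
    from reverse_norm_cong(1)[OF this] reverse_space_scale(2)[OF u, of 0] show ?thesis by simp
  qed
  have "?N (symmetrized u v) \<le> 2 * C * ?N u * ?N v" if u: "u \<in> ?H" and v: "v \<in> ?H" for u v
  proof (cases "?N u = 0 \<or> ?N v = 0")
    case True
    then have "?N (symmetrized u v) \<le> 0"
    proof
      assume "?N v = 0"
      from zero[OF v this] show ?thesis by (subst symmetrized_commute)
    qed (rule zero[OF u])
    then show ?thesis using True by auto
  next
    case False
    then have pos: "0 < ?N u" "0 < ?N v" using reverse_norm_nonneg[of u] reverse_norm_nonneg[of v] by auto
    let ?u = "\<lambda>x. (1 / ?N u) *\<^sub>R u x" and ?v = "\<lambda>x. (1 / ?N v) *\<^sub>R v x"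
    have u': "?u \<in> ?H" "?N ?u \<le> 1" using reverse_space_scale[OF u, of "1 / ?N u"] pos by auto
    have v': "?v \<in> ?H" "?N ?v \<le> 1" using reverse_space_scale[OF v, of "1 / ?N v"] pos by auto
    have "symmetrized u v = (\<lambda>x. (?N u * ?N v) *\<^sub>R symmetrized ?u ?v x)"
      using pos by (auto simp: fun_eq_iff symmetrized_def D.scaleR_left D.scaleR_right scaleR_right_distrib)
    then have "?N (symmetrized u v) \<le> (?N u * ?N v) * ?N (symmetrized ?u ?v)"
      using reverse_space_scale(2)[OF symmetrized_mem[OF u'(1) v'(1)], of "?N u * ?N v"] pos by simp
    also have "\<dots> \<le> (?N u * ?N v) * (C / 2 * (1 + 1)\<^sup>2)"
    proof (intro mult_left_mono order_trans[OF symmetrized_le[OF u'(1) v'(1)]] power_mono add_mono u'(2) v'(2))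
    qed (use pos C reverse_norm_nonneg in \<open>auto intro!: add_nonneg_nonneg\<close>)
    finally show ?thesis by (simp add: mult_ac)
  qed
  then show ?thesis using C symmetrized_mem by (intro exI[of _ "2 * C"]) auto
qed

definition flow :: "'h \<Rightarrow> real \<Rightarrow> 'h" where
  "flow h x = (if x < 0 then 0 else stable_semigroup M co \<gamma> x (stable_proj M co \<gamma> h))"

definition duhamel :: "(real \<Rightarrow> 'h) \<Rightarrow> (real \<Rightarrow> 'h) \<Rightarrow> real \<Rightarrow> 'h" where
  "duhamel u v x = (if x < 0 then 0 else K_plus M co \<gamma> (symmetrized u v) x)"

text \<open>
  Only values on \<open>[0, \<infinity>)\<close> are relevant. Fixing the values on the negative half line to be zero makes the
  reverse norm a norm on a set of functions, and makes \<open>flow\<close> and \<open>duhamel\<close> exactly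
  linear as maps into functions on the whole line.
\<close>

definition half_line_space :: "(real \<Rightarrow> 'h) set" where
  "half_line_space = {u \<in> reverse_space M co. \<forall>x<0. u x = 0}"

lemma ex_quadratic_equation:
  "\<exists>C. quadratic_equation half_line_space (reverse_norm M co) flow duhamel C"
proof -
  let ?H = "reverse_space M co" and ?N = "reverse_norm M co"
  obtain C where C: "0 < C" and symmetrized_mem: "\<And>u v. u \<in> ?H \<Longrightarrow> v \<in> ?H \<Longrightarrow> symmetrized u v \<in> ?H"
    and symmetrized_le: "\<And>u v. u \<in> ?H \<Longrightarrow> v \<in> ?H \<Longrightarrow> ?N (symmetrized u v) \<le> C * ?N u * ?N v"
    using symmetrized_bound by blast
  have cut: "(\<lambda>x. if x < 0 then 0 else f x) \<in> half_line_space"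
    "?N (\<lambda>x. if x < 0 then 0 else f x) = ?N f" if "f \<in> ?H" for f
    using reverse_norm_cong[of "\<lambda>x. if x < 0 then 0 else f x" f] that
    unfolding half_line_space_def by auto
  have flow_eq: "flow h = (\<lambda>x. if x < 0 then 0 else stable_semigroup M co \<gamma> x (stable_proj M co \<gamma> h))" for h
    by (simp add: flow_def fun_eq_iff)
  have duhamel_eq: "duhamel u v = (\<lambda>x. if x < 0 then 0 else K_plus M co \<gamma> (symmetrized u v) x)" for u v
    by (simp add: duhamel_def fun_eq_iff)
  have H: "u \<in> ?H" if "u \<in> half_line_space" for u using that unfolding half_line_space_def by simp
  have left: "duhamel (\<lambda>i. a *\<^sub>R u i + b *\<^sub>R v i) w = (\<lambda>i. a *\<^sub>R duhamel u w i + b *\<^sub>R duhamel v w i)"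
    if "u \<in> half_line_space" "v \<in> half_line_space" "w \<in> half_line_space" for u v w a b
    unfolding duhamel_def symmetrized_comb
    using K_plus_comb[OF symmetrized_mem[OF H[OF that(1)] H[OF that(3)]] symmetrized_mem[OF H[OF that(2)] H[OF that(3)]]]
    by (auto simp: fun_eq_iff)
  have comm: "duhamel u v = duhamel v u" for u v
    unfolding duhamel_eq by (subst symmetrized_commute) (rule refl)
  have "quadratic_equation half_line_space ?N flow duhamel C"
  proof
    fix u v :: "real \<Rightarrow> 'h" and a b :: real
    assume u: "u \<in> half_line_space" and v: "v \<in> half_line_space"
    show "(\<lambda>i. a *\<^sub>R u i + b *\<^sub>R v i) \<in> half_line_space"
      using reverse_space_add(1)[OF reverse_space_scale(1)[OF H[OF u], of a] reverse_space_scale(1)[OF H[OF v], of b]] u v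
      unfolding half_line_space_def by simp
    show "?N (\<lambda>i. u i + v i) \<le> ?N u + ?N v" by (rule reverse_space_add(2)[OF H[OF u] H[OF v]])
    note s = symmetrized_mem[OF H[OF u] H[OF v]]
    show "duhamel u v \<in> half_line_space"
      unfolding duhamel_eq by (rule cut(1)[OF reverse_norm_K_plus(1)[OF s]])
    show "?N (duhamel u v) \<le> C * ?N u * ?N v"
      unfolding duhamel_eq cut(2)[OF reverse_norm_K_plus(1)[OF s]]
      by (rule order_trans[OF reverse_norm_K_plus(2)[OF s] symmetrized_le[OF H[OF u] H[OF v]]])
    fix w assume w: "w \<in> half_line_space"
    show "duhamel (\<lambda>i. a *\<^sub>R u i + b *\<^sub>R v i) w = (\<lambda>i. a *\<^sub>R duhamel u w i + b *\<^sub>R duhamel v w i)"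
      by (rule left[OF u v w])
    show "duhamel w (\<lambda>i. a *\<^sub>R u i + b *\<^sub>R v i) = (\<lambda>i. a *\<^sub>R duhamel w u i + b *\<^sub>R duhamel w v i)"
      unfolding comm[of w] by (rule left[OF u v w])
  next
    fix u :: "real \<Rightarrow> 'h" and a :: real assume u: "u \<in> half_line_space"
    show "?N (\<lambda>i. a *\<^sub>R u i) \<le> \<bar>a\<bar> * ?N u" by (rule reverse_space_scale(2)[OF H[OF u]])
    show "norm (u i) \<le> ?N u" for i
      using norm_le_reverse_norm[OF H[OF u], of i] u reverse_norm_nonneg[of u]
      by (cases "i < 0") (auto simp: half_line_space_def)
  next
    fix u :: "nat \<Rightarrow> real \<Rightarrow> 'h" and a :: "nat \<Rightarrow> real"
    assume u: "\<And>n. u n \<in> half_line_space" and le: "\<And>n. ?N (u n) \<le> a n" and a: "summable a"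
    note r = reverse_space_suminf[OF H[OF u] le a]
    have "(\<Sum>n. u n x) = 0" if "x < 0" for x
      using u that unfolding half_line_space_def by simp
    then show "(\<lambda>i. \<Sum>n. u n i) \<in> half_line_space \<and> ?N (\<lambda>i. \<Sum>n. u n i) \<le> suminf a"
      using r unfolding half_line_space_def by simp
  next
    fix h :: 'h
    note m = majorized_imp_reverse_space[OF semigroup_majorized, of h]
    show "flow h \<in> half_line_space" unfolding flow_eq by (rule cut(1)[OF m(1)])
    show "?N (flow h) \<le> norm h" unfolding flow_eq cut(2)[OF m(1)] by (rule m(2))
  next
    fix a b :: real and x y :: 'h
    show "flow (a *\<^sub>R x + b *\<^sub>R y) = (\<lambda>i. a *\<^sub>R flow x i + b *\<^sub>R flow y i)"
      unfolding flow_def using semigroup_comb[of _ a x b y] by (auto simp: fun_eq_iff)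
  qed (rule C)
  then show ?thesis by blast
qed

end

section \<open>The local stable manifold of a closed bilinear map\<close>

context spectral_equation
begin

lemma symmetrized_self_mem:
  assumes "u \<in> reverse_space M co"
  shows "symmetrized u u \<in> reverse_space M co"
  using D_closed assms unfolding symmetrized_self closed_under_D_star_def by blast

lemma fixed_point_imp_mild_solution:
  assumes u: "u \<in> half_line_space" and h: "h \<in> stable_subspace M co \<gamma>"
    and fp: "u = (\<lambda>x. flow h x + duhamel u u x)"
  shows "mild_solution M co \<gamma> D u" "stable_proj M co \<gamma> (u 0) = h"
    "u 0 - h \<in> unstable_subspace M co \<gamma>"
    "\<And>x. 0 \<le> x \<Longrightarrow> u x = stable_semigroup M co \<gamma> x (stable_proj M co \<gamma> h) + K_plus M co \<gamma> (symmetrized u u) x"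
proof -
  have uH: "u \<in> reverse_space M co" using u unfolding half_line_space_def by simp
  show eq: "u x = stable_semigroup M co \<gamma> x (stable_proj M co \<gamma> h) + K_plus M co \<gamma> (symmetrized u u) x"
    if "0 \<le> x" for x
    using fun_cong[OF fp, of x] that by (simp add: flow_def duhamel_def)
  have u0: "u 0 = h + K_plus M co \<gamma> (symmetrized u u) 0"
    using eq[of 0] semigroup_zero[OF h] by simp
  have K0: "K_plus M co \<gamma> (symmetrized u u) 0 \<in> unstable_subspace M co \<gamma>"
    by (rule K_plus_zero_unstable[OF symmetrized_self_mem[OF uH]])
  show "u 0 - h \<in> unstable_subspace M co \<gamma>" using K0 u0 by simp
  show P: "stable_proj M co \<gamma> (u 0) = h"
    unfolding u0 by (rule stable_proj_graph[OF h K0])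
  show "mild_solution M co \<gamma> D u"
    unfolding mild_solution_def P symmetrized_self[symmetric]
  proof (intro allI impI)
    fix x :: real assume "0 \<le> x"
    from eq[OF this] show "u x = stable_semigroup M co \<gamma> x h + K_plus M co \<gamma> (symmetrized u u) x"
      by (simp only: stable_proj_id[OF h])
  qed
qed

lemma mild_solution_imp_fixed_point:
  assumes v: "v \<in> reverse_space M co" and mild: "mild_solution M co \<gamma> D v"
    and P: "stable_proj M co \<gamma> (v 0) = h"
  defines "w \<equiv> \<lambda>x. if x < 0 then 0 else v x"
  shows "w \<in> half_line_space" "reverse_norm M co w = reverse_norm M co v"
    "w = (\<lambda>x. flow h x + duhamel w w x)"
proof -
  have wv: "\<And>x. 0 \<le> x \<Longrightarrow> w x = v x" by (simp add: w_def)
  show w: "w \<in> half_line_space" "reverse_norm M co w = reverse_norm M co v"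
    using reverse_norm_cong[OF wv] v unfolding half_line_space_def by (auto simp: w_def)
  have h: "stable_proj M co \<gamma> h = h" using stable_proj_id[OF stable_proj_mem] P by metis
  show "w = (\<lambda>x. flow h x + duhamel w w x)"
  proof (rule ext)
    fix x
    show "w x = flow h x + duhamel w w x"
    proof (cases "x < 0")
      case True
      then show ?thesis by (simp add: w_def flow_def duhamel_def)
    next
      case False
      then have x: "0 \<le> x" by simp
      have "K_plus M co \<gamma> (symmetrized v v) x = K_plus M co \<gamma> (symmetrized w w) x"
        by (rule K_plus_cong[OF symmetrized_self_mem[OF v] _ x]) (simp add: symmetrized_def wv)
      moreover have "v x = stable_semigroup M co \<gamma> x h + K_plus M co \<gamma> (symmetrized v v) x"
        using mild x P unfolding mild_solution_def symmetrized_self by blast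
      ultimately show ?thesis using False by (simp add: flow_def duhamel_def wv h)
    qed
  qed
qed

text \<open>
  The sum of the terms of degree at least two of the series for \<open>u 0\<close> is \<open>J h\<close>; the term of degree
  one is \<open>h\<close> itself. The bound on solutions is the one for which fixed points are unique,
  and does not depend on \<open>r\<close>; only the radius of the ball does.
\<close>

lemma local_stable_manifold:
  fixes r :: nat
  shows "\<exists>\<epsilon>\<^sub>1>0. \<exists>\<epsilon>\<^sub>2>0. \<exists>(\<u> :: real \<Rightarrow> 'h \<Rightarrow> 'h) (J :: 'h \<Rightarrow> 'h).
        let B = {h \<in> stable_subspace M co \<gamma>. norm h < \<epsilon>\<^sub>1};
            \<M>\<^sub>s = {\<u> 0 h | h. h \<in> B}
        in (\<forall>h\<in>B. small_solution M co \<gamma> D \<epsilon>\<^sub>2 h (\<lambda>x. \<u> x h) \<and>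
              (\<forall>v. small_solution M co \<gamma> D \<epsilon>\<^sub>2 h v \<longrightarrow> (\<forall>x\<ge>0. v x = \<u> x h))) \<and>
           J ` B \<subseteq> unstable_subspace M co \<gamma> \<and>
           C_r_on (stable_subspace M co \<gamma>) r B J \<and>
           \<M>\<^sub>s = {h + J h | h. h \<in> B} \<and>
           (\<forall>h\<in>B. \<forall>x\<^sub>0\<ge>0. stable_proj M co \<gamma> (\<u> x\<^sub>0 h) \<in> B \<longrightarrow> \<u> x\<^sub>0 h \<in> \<M>\<^sub>s)"
proof -
  obtain C where QE: "quadratic_equation half_line_space (reverse_norm M co) flow duhamel C"
    using ex_quadratic_equation by blast
  interpret QE: quadratic_equation half_line_space "reverse_norm M co" flow duhamel C by (rule QE)
  \<comment> \<open>The coefficients grow like \<open>(16 * C)\<^sup>n\<close>, and \<open>r\<close> differentiations require one eighth of the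
     radius of convergence divided by \<open>2 ^ r\<close>.\<close>
  define \<epsilon> where "\<epsilon> = 1 / (128 * C * 2 ^ r)"
  have \<epsilon>: "0 < \<epsilon>" "2 ^ r * (16 * C) * \<epsilon> \<le> 1/8" "\<epsilon> \<le> 1 / (32 * C)" "16 * C * \<epsilon> \<le> 1/8"
  proof -
    have p: "1 \<le> (2::real) ^ r" by (rule one_le_power) simp
    show "0 < \<epsilon>" "2 ^ r * (16 * C) * \<epsilon> \<le> 1/8"
      unfolding \<epsilon>_def using QE.C_pos by (auto simp: field_simps)
    have "\<epsilon> \<le> 1 / (128 * C * 1)"
      unfolding \<epsilon>_def using p QE.C_pos by (intro divide_left_mono mult_left_mono) auto
    then show "\<epsilon> \<le> 1 / (32 * C)" "16 * C * \<epsilon> \<le> 1/8" using QE.C_pos by (auto simp: field_simps)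
  qed
  define \<epsilon>2 where "\<epsilon>2 = 1 / (4 * C)"
  have \<epsilon>2: "0 < \<epsilon>2" unfolding \<epsilon>2_def using QE.C_pos by simp
  define B where "B = {h \<in> stable_subspace M co \<gamma>. norm h < \<epsilon>}"
  define u where "u x h = QE.solution h x" for x h
  define F where "F hs = (if 2 \<le> length hs then QE.expansion hs 0 else 0)" for hs
  define J where "J = power_sum F"
  have small: "norm h \<le> 1 / (32 * C)" if "h \<in> B" for h
    using that \<epsilon>(3) unfolding B_def by auto
  have B_stable: "h \<in> stable_subspace M co \<gamma>" if "h \<in> B" for h using that unfolding B_def by simp
  have sol: "small_solution M co \<gamma> D \<epsilon>2 h (\<lambda>x. u x h)" "u 0 h - h \<in> unstable_subspace M co \<gamma>" if h: "h \<in> B" for h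
  proof -
    note m = QE.solution_mem[OF small[OF h]]
    note f = fixed_point_imp_mild_solution[OF m(1) B_stable[OF h] QE.solution_fixed_point[OF small[OF h]]]
    show "small_solution M co \<gamma> D \<epsilon>2 h (\<lambda>x. u x h)"
      unfolding small_solution_def u_def \<epsilon>2_def using m f(1,2) by (simp add: half_line_space_def)
    show "u 0 h - h \<in> unstable_subspace M co \<gamma>" unfolding u_def by (rule f(3))
  qed
  have unique: "v x = u x h" if h: "h \<in> B" and v: "small_solution M co \<gamma> D \<epsilon>2 h v" and x: "0 \<le> x" for h v x
  proof -
    let ?w = "\<lambda>x. if x < 0 then 0 else v x"
    have v: "v \<in> reverse_space M co" "mild_solution M co \<gamma> D v" "reverse_norm M co v \<le> 1 / (4 * C)"
      "stable_proj M co \<gamma> (v 0) = h"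
      using v unfolding small_solution_def \<epsilon>2_def by auto
    note w = mild_solution_imp_fixed_point[OF v(1,2,4)]
    have "?w = QE.solution h"
    proof (rule QE.small_fixed_point_unique)
      show "reverse_norm M co ?w \<le> 1 / (4 * C)" using w(2) v(3) by simp
    qed (rule w QE.solution_mem[OF small[OF h]] QE.solution_fixed_point[OF small[OF h]])+
    then have "?w x = QE.solution h x" by (rule fun_cong)
    then show ?thesis using x unfolding u_def by simp
  qed
  have F: "geometric_family (1 / (8 * C)) (16 * C) F"
    unfolding geometric_family_def
  proof (intro conjI allI)
    note E = QE.expansion_geometric_family[of 0, unfolded geometric_family_def]
    show "multilinear F" using E unfolding multilinear_def F_def by simp
    show "0 \<le> 1 / (8 * C)" "0 \<le> 16 * C" using E by blast+
    fix hs
    have "norm (F hs) \<le> norm (QE.expansion hs 0)" by (simp add: F_def)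
    then show "norm (F hs) \<le> 1 / (8 * C) * (16 * C) ^ length hs * prod_list (map norm hs)"
      using E by (meson order_trans)
  qed
  have J: "u 0 h = h + J h" if h: "h \<in> B" for h
  proof -
    let ?E = "\<lambda>hs. QE.expansion hs 0"
    have hn: "norm h \<le> \<epsilon>" using h unfolding B_def by simp
    note sE = summable_powers(1)[OF QE.expansion_geometric_family[of 0] hn \<epsilon>(4,1)]
    note sF = summable_powers(1)[OF F hn \<epsilon>(4,1)]
    have "power_sum ?E h - power_sum F h = (\<Sum>n. ?E (replicate n h) - F (replicate n h))"
      unfolding power_sum_def by (rule suminf_diff[OF sE sF])
    also have "\<dots> = (\<Sum>n\<in>{1}. ?E (replicate n h) - F (replicate n h))"
    proof (rule suminf_finite)
      fix n :: nat assume "n \<notin> {1}"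
      then consider "n = 0" | "2 \<le> n" by fastforce
      then show "?E (replicate n h) - F (replicate n h) = 0"
        by cases (simp_all add: F_def QE.expansion_Nil)
    qed simp
    also have "\<dots> = flow h 0" by (simp add: F_def QE.expansion_single)
    also have "\<dots> = h" unfolding flow_def using semigroup_zero[OF B_stable[OF h]] by simp
    finally show ?thesis unfolding u_def QE.solution_def J_def by (simp add: algebra_simps)
  qed
  have invariant: "u x0 h \<in> {u 0 h | h. h \<in> B}"
    if h: "h \<in> B" and x0: "0 \<le> x0" and P: "stable_proj M co \<gamma> (u x0 h) \<in> B" for h x0
  proof -
    let ?s = "QE.solution h" and ?v = "\<lambda>x. QE.solution h (x0 + x)"
    note m = QE.solution_mem[OF small[OF h]]
    note f = fixed_point_imp_mild_solution[OF m(1) B_stable[OF h] QE.solution_fixed_point[OF small[OF h]]]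
    have sH: "?s \<in> reverse_space M co" using m(1) unfolding half_line_space_def by simp
    have "mild_solution M co \<gamma> D ?v"
      unfolding mild_solution_def
    proof (intro allI impI)
      fix x :: real assume x: "0 \<le> x"
      have "D_star D ?v ?v = (\<lambda>y. symmetrized ?s ?s (x0 + y))"
        unfolding symmetrized_self[symmetric] by (simp add: symmetrized_def fun_eq_iff)
      with shifted_mild_solution[OF symmetrized_self_mem[OF sH] x0 x f(4)]
      show "?v x = stable_semigroup M co \<gamma> x (stable_proj M co \<gamma> (?v 0)) + K_plus M co \<gamma> (D_star D ?v ?v) x"
        by simp
    qed
    then have "small_solution M co \<gamma> D \<epsilon>2 (stable_proj M co \<gamma> (u x0 h)) ?v"
      using reverse_norm_shift[OF sH x0] m(2) unfolding small_solution_def u_def \<epsilon>2_def by simp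
    from unique[OF P this order_refl] show ?thesis using P unfolding u_def by auto
  qed
  have graph: "{u 0 h | h. h \<in> B} = {h + J h | h. h \<in> B}"
    unfolding setcompr_eq_image by (rule image_cong) (simp_all add: J)
  have J_unstable: "J ` B \<subseteq> unstable_subspace M co \<gamma>"
    using sol(2) J by (auto simp: algebra_simps)
  have smooth: "C_r_on (stable_subspace M co \<gamma>) r B J"
    unfolding J_def by (rule C_r_on_power_sum[OF F \<epsilon>(1,2)]) (simp add: B_def)
  show ?thesis
    unfolding Let_def
  proof (rule exI[of _ \<epsilon>], rule conjI[OF \<epsilon>(1)], rule exI[of _ \<epsilon>2], rule conjI[OF \<epsilon>2],
      rule exI[of _ u], rule exI[of _ J], unfold B_def[symmetric], intro conjI ballI allI impI)
    show "small_solution M co \<gamma> D \<epsilon>2 h (\<lambda>x. u x h)" if "h \<in> B" for h by (rule sol(1)[OF that])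
    show "v x = u x h" if "h \<in> B" "small_solution M co \<gamma> D \<epsilon>2 h v" "0 \<le> x" for h v x
      by (rule unique[OF that])
    show "u x0 h \<in> {u 0 h | h. h \<in> B}"
      if "h \<in> B" "0 \<le> x0" "stable_proj M co \<gamma> (u x0 h) \<in> B" for h x0
      by (rule invariant[OF that])
  qed (rule J_unstable smooth graph)+
qed

end

section \<open>The stable manifold theorem\<close>

theorem theorem1p5:
  fixes \<Gamma> :: "'h::{real_inner, banach} \<Rightarrow> 'h"
    and D :: "'h \<Rightarrow> 'h \<Rightarrow> 'h"
    and M :: "'l measure"
    and co :: "'h \<Rightarrow> 'l \<Rightarrow> real"
    and \<gamma> :: "'l \<Rightarrow> real"
  assumes "bounded_linear \<Gamma>"
    and "\<And>u v. inner (\<Gamma> u) v = inner u (\<Gamma> v)"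
    and "inj \<Gamma>"
    and "\<nexists>G. bounded_linear G \<and> G \<circ> \<Gamma> = id \<and> \<Gamma> \<circ> G = id"
    and "bounded_bilinear D"
    and "spectral_representation M co \<gamma> \<Gamma>"
  shows "(\<forall>\<kappa>. has_kernel M co D \<kappa> \<and> (abs_kernel_bounded M co \<kappa> \<or> kernel_square_integrable M \<kappa>)
            \<longrightarrow> closed_under_D_star M co D) \<and>
    (closed_under_D_star M co D \<longrightarrow>
      (\<forall>r\<ge>1::nat. \<exists>\<epsilon>\<^sub>1>0. \<exists>\<epsilon>\<^sub>2>0. \<exists>(\<u> :: real \<Rightarrow> 'h \<Rightarrow> 'h) (J :: 'h \<Rightarrow> 'h).
        let B = {h \<in> stable_subspace M co \<gamma>. norm h < \<epsilon>\<^sub>1};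
            \<M>\<^sub>s = {\<u> 0 h | h. h \<in> B}
        in (\<forall>h\<in>B. small_solution M co \<gamma> D \<epsilon>\<^sub>2 h (\<lambda>x. \<u> x h) \<and>
              (\<forall>v. small_solution M co \<gamma> D \<epsilon>\<^sub>2 h v \<longrightarrow> (\<forall>x\<ge>0. v x = \<u> x h))) \<and>
           J ` B \<subseteq> unstable_subspace M co \<gamma> \<and>
           C_r_on (stable_subspace M co \<gamma>) r B J \<and>
           \<M>\<^sub>s = {h + J h | h. h \<in> B} \<and>
           (\<forall>h\<in>B. \<forall>x\<^sub>0\<ge>0. stable_proj M co \<gamma> (\<u> x\<^sub>0 h) \<in> B \<longrightarrow> \<u> x\<^sub>0 h \<in> \<M>\<^sub>s)))"
proof -
  interpret spectral_space M co \<gamma> by (rule spectral_spaceI) fact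
  have kernel: "closed_under_D_star M co D"
    if "has_kernel M co D \<kappa> \<and> (abs_kernel_bounded M co \<kappa> \<or> kernel_square_integrable M \<kappa>)" for \<kappa>
    using that closed_if_abs_kernel_bounded closed_if_kernel_square_integrable by blast
  have equation: "spectral_equation M co \<gamma> D" if "closed_under_D_star M co D"
    by (intro spectral_equation.intro spectral_equation_axioms.intro spectral_space_axioms assms(5) that)
  show ?thesis
    by (intro conjI allI impI) (erule kernel, rule spectral_equation.local_stable_manifold[OF equation])
qed

end
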